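(* For every prime $p$ and every integer $n \ge 160$, there exists an ab-maximal finite $p$-group $G$ such that $|G:G'| = p^n$ and $|G'| = p^{n-3}$; moreover, if $p \ne 2$, then $G$ can be taken to have exponent $p$.
   Context: $G' = [G,G]$ denotes the derived subgroup of $G$. A finite group $G$ is called ab-maximal if $|H:H'| < |G:G'|$ for every proper subgroup $H$ of $G$. *)

theory Defs
  imports "HOL-Algebra.Multiplicative_Group" "HOL-Computational_Algebra.Primes"
begin

definition group_index :: "('a, 'b) monoid_scheme \<Rightarrow> 'a set \<Rightarrow> nat"
  where "group_index G H = card (rcosets\<^bsub>G\<^esub> H)"

definition finite_p_group :: "nat \<Rightarrow> ('a, 'b) monoid_scheme \<Rightarrow> bool"
  where "finite_p_group p G \<longleftrightarrow> group G \<and> finite (carrier G) \<and> (\<exists>k. order G = p ^ k)"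

text \<open>The value is 0 if the group has no finite exponent.\<close>

definition group_exponent :: "('a, 'b) monoid_scheme \<Rightarrow> nat"
  where "group_exponent G = Lcm (group.ord G ` carrier G)"

text \<open>The index of \<open>derived G H\<close> is taken inside \<open>H\<close>, viewed as a group in its own right; taking
  the right cosets with respect to \<open>G\<close> would give the index in \<open>G\<close> instead.\<close>

definition ab_maximal :: "('a, 'b) monoid_scheme \<Rightarrow> bool"
  where "ab_maximal G \<longleftrightarrow> group G \<and> finite (carrier G) \<and>
    (\<forall>H. subgroup H G \<and> H \<noteq> carrier G \<longrightarrow>
      group_index (G\<lparr>carrier := H\<rparr>) (derived G H) < group_index G (derived G (carrier G)))"

end

theory Submission
  imports Defs "HOL-Library.Function_Algebras" Complex_Main
begin

text \<open>
  Let \<open>V\<close> and \<open>W\<close> be vector spaces of dimensions \<open>n\<close> and \<open>n - 3\<close> over the field with \<open>p\<close> elements. A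
  bilinear map \<open>\<beta> : V \<times> V \<rightarrow> W\<close> makes \<open>V \<times> W\<close> a group of class 2 whose commutator map is the
  alternating map \<open>b(x, y) = \<beta>(x, y) - \<beta>(y, x)\<close>. It is as required once every proper subspace
  \<open>U\<close> of \<open>V\<close> satisfies \<open>dim b(U, U) \<ge> dim U - 2\<close>, and this is arranged by a random choice of \<open>\<beta>\<close>.

  If the inequality fails for \<open>U\<close> of dimension \<open>d\<close>, then \<open>n - d\<close> independent functionals on \<open>W\<close>
  kill \<open>b(U, U)\<close>. For \<open>d \<ge> 4\<close> the expected number of such configurations is tiny. For \<open>d = 3\<close> the
  expected number of totally isotropic 3-spaces is about 3 (for \<open>p = 2\<close>), so a union bound is not
  enough. Choose the first \<open>n - 4\<close> coordinate forms of \<open>b\<close> such that at most \<open>7/2 p\<^sup>3\<close> totally isotropic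
  3-spaces survive and any 11 of these are independent. For a uniformly random last form the
  events that it vanishes on a surviving 3-space have probability \<open>p\<^sup>-\<^sup>3\<close> and are 11-wise independent, and
  the Bonferroni inequality of order 11 shows that with probability at least 1/200 none of them occurs.
\<close>

subsection \<open>Bonferroni sums and counting\<close>

text \<open>Why the inequality suffices: if a proper subgroup \<open>H\<close> has image
  \<open>U\<close> in \<open>V\<close>, then \<open>|H| \<le> |U| |W|\<close> and
  \<open>|H'| \<ge> |U| / p^2\<close>, so \<open>|H:H'| \<le> p^(n-1)\<close>. If
  \<open>U = V\<close>, the inequality for a hyperplane already puts \<open>W\<close> inside
  \<open>H'\<close>, and then \<open>H\<close> is the whole group. Why dimension 3 is critical: in
  dimension \<open>d\<close> there are about \<open>p^(d(n-d))\<close> choices of \<open>U\<close>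
  and \<open>p^((n-d)(d-3))\<close> choices of the space of functionals, and each succeeds with
  probability \<open>p^(-(n-d)d(d-1)/2)\<close>. The total exponent
  \<open>-(n-d)(d-2)(d-3)/2\<close> is 0 for \<open>d = 3\<close> and at most \<open>-(n-4)\<close>
  for \<open>4 \<le> d < n\<close>. Why one form is held back: once the others are fixed, the
  surviving 3-spaces form a fixed list, and inclusion-exclusion over the last form has exact
  intersection probabilities wherever the sum of the 3-spaces is direct. The price is that the
  earlier forms must avoid the rare coincidences in which a few survivors fail to form a direct sum.
  Odd orders give lower bounds, and 11 is the least odd order at which the remainder estimate leaves
  a positive bound.\<close>

definition bonferroni :: "nat \<Rightarrow> nat \<Rightarrow> real \<Rightarrow> real"
  where "bonferroni N k q = (\<Sum>j\<le>k. (-1) ^ j * real (N choose j) * q ^ j)"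

lemma bonferroni_Suc_Suc: "bonferroni (Suc N) (Suc k) q = bonferroni N (Suc k) q - q * bonferroni N k q"
proof -
  have "bonferroni (Suc N) (Suc k) q = 1 + (\<Sum>j\<le>k. (-1) ^ Suc j * real (Suc N choose Suc j) * q ^ Suc j)"
    unfolding bonferroni_def by (subst sum.atMost_Suc_shift) simp
  also have "\<dots> = (1 + (\<Sum>j\<le>k. (-1) ^ Suc j * real (N choose Suc j) * q ^ Suc j)) -
      q * (\<Sum>j\<le>k. (-1) ^ j * real (N choose j) * q ^ j)"
  proof -
    have "(-1) ^ Suc j * real (Suc N choose Suc j) * q ^ Suc j =
      (-1) ^ Suc j * real (N choose Suc j) * q ^ Suc j - q * ((-1) ^ j * real (N choose j) * q ^ j)" for j
      by (simp add: algebra_simps)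
    then show ?thesis
      by (simp only: sum_subtractf sum_distrib_left)
  qed
  also have "1 + (\<Sum>j\<le>k. (-1) ^ Suc j * real (N choose Suc j) * q ^ Suc j) = bonferroni N (Suc k) q"
    unfolding bonferroni_def by (subst sum.atMost_Suc_shift) simp
  finally show ?thesis
    by (simp add: bonferroni_def)
qed

text \<open>Pascal's rule gives the truncated sum and \<open>(1 - q) ^ N\<close> the same recursion
  in \<open>N\<close>. The signed error of order \<open>k\<close> at \<open>Suc N\<close> is
  therefore that of order \<open>k\<close> plus \<open>q\<close> times that of order
  \<open>k - 1\<close>, both at \<open>N\<close>, and nonnegativity passes through the
  induction.\<close>

lemma bonferroni_alternates:
  assumes "0 \<le> q" "q \<le> 1"
  shows "(-1) ^ k * (bonferroni N k q - (1 - q) ^ N) \<ge> 0"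
proof (induction N arbitrary: k)
  case 0
  have "bonferroni 0 k q = (\<Sum>j\<le>k. if j = 0 then 1 else 0)"
    unfolding bonferroni_def by (intro sum.cong) auto
  then show ?case by simp
next
  case (Suc N)
  show ?case
  proof (cases k)
    case 0
    then show ?thesis
      using power_le_one[of "1 - q" "Suc N"] assms by (simp add: bonferroni_def)
  next
    case (Suc k')
    have "(-1) ^ k * (bonferroni (Suc N) k q - (1 - q) ^ Suc N) =
      (-1) ^ k * (bonferroni N k q - (1 - q) ^ N) + q * ((-1) ^ k' * (bonferroni N k' q - (1 - q) ^ N))"
      unfolding Suc bonferroni_Suc_Suc by (simp add: algebra_simps)
    then show ?thesis
      using Suc.IH[of k] Suc.IH[of k'] assms by simp
  qed
qed

text \<open>The constants come from \<open>(1 - q) ^ N \<ge> exp (- 4) \<ge> 1 / 81\<close> and \<open>(7 / 2) ^ 12 / 12! < 1 / 81 - 1 / 200\<close>.\<close>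

lemma bonferroni_11_ge:
  assumes q: "0 \<le> q" "q \<le> 1 / 8" and N: "real N * q \<le> 7 / 2"
  shows "bonferroni N 11 q \<ge> 1 / 200"
proof -
  have "1 / (1 - q) = 1 + q / (1 - q)"
    using q by (simp add: field_simps)
  also have "\<dots> \<le> exp (q / (1 - q))"
    by (rule exp_ge_add_one_self)
  \<comment> \<open>\<open>8 / 7\<close> is \<open>1 / (1 - 1 / 8)\<close>; with
    \<open>real N * q \<le> 7 / 2\<close> it bounds the final exponent by exactly 4.\<close>
  also have "q / (1 - q) \<le> 8 / 7 * q"
    using q mult_left_mono[of q "1/8" q] by (simp add: field_simps)
  finally have "1 / (1 - q) \<le> exp (8 / 7 * q)"
    by simp
  then have "exp (- (8 / 7 * q)) \<le> 1 - q"
    using q by (simp add: exp_minus field_simps)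
  then have "exp (- (8 / 7 * q)) ^ N \<le> (1 - q) ^ N"
    by (intro power_mono) auto
  moreover have "exp (- (8 / 7 * q)) ^ N = exp (- (8 / 7 * (real N * q)))"
    by (simp add: exp_of_nat_mult[symmetric] algebra_simps)
  moreover have "exp (-4) \<le> exp (- (8 / 7 * (real N * q)))"
    unfolding exp_le_cancel_iff using N by linarith
  moreover have "exp (4::real) \<le> 81"
  proof -
    have "exp (4::real) = exp 1 ^ 4"
      by (simp add: exp_of_nat_mult[symmetric])
    also have "\<dots> \<le> 3 ^ 4"
      by (intro power_mono exp_le) simp
    finally show ?thesis by simp
  qed
  then have "1 / 81 \<le> exp (-4::real)"
    by (simp add: exp_minus field_simps)
  ultimately have 1: "1 / 81 \<le> (1 - q) ^ N"
    by linarith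
  have 2: "(1 - q) ^ N \<le> bonferroni N 12 q"
    using bonferroni_alternates[of q 12 N] q by simp
  have "real (N choose 12) * q ^ 12 * fact 12 \<le> (real N * q) ^ 12"
  proof -
    have "real ((N choose 12) * fact 12) \<le> real (N ^ 12)"
      by (intro of_nat_mono binomial_fact_pow)
    then have "real (N choose 12) * fact 12 * q ^ 12 \<le> real N ^ 12 * q ^ 12"
      using q by (intro mult_right_mono) auto
    then show ?thesis
      by (simp add: power_mult_distrib mult_ac)
  qed
  also have "\<dots> \<le> (7 / 2) ^ 12"
    using N q by (intro power_mono) auto
  finally have 3: "real (N choose 12) * q ^ 12 \<le> (7 / 2) ^ 12 / fact 12"
    by (simp add: field_simps)
  have "bonferroni N 12 q = bonferroni N 11 q + real (N choose 12) * q ^ 12"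
    using sum.atMost_Suc[of "\<lambda>j. (-1) ^ j * real (N choose j) * q ^ j" 11] by (simp add: bonferroni_def)
  moreover have "(1::real) / 200 \<le> 1 / 81 - (7 / 2) ^ 12 / fact 12"
    by (simp add: fact_numeral power_divide)
  ultimately show ?thesis
    using 1 2 3 by linarith
qed

section \<open>Double counting and Markov's inequality\<close>

lemma sum_card_swap:
  assumes "finite A" "finite P"
  shows "(\<Sum>f\<in>A. card {J \<in> P. R f J}) = (\<Sum>J\<in>P. card {f \<in> A. R f J})"
proof -
  have "(\<Sum>f\<in>A. card {J \<in> P. R f J}) = (\<Sum>f\<in>A. \<Sum>J\<in>P. if R f J then 1 else 0)"
    using assms(2) by (simp add: sum.If_cases Int_def)
  also have "\<dots> = (\<Sum>J\<in>P. \<Sum>f\<in>A. if R f J then 1 else 0)"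
    by (rule sum.swap)
  also have "\<dots> = (\<Sum>J\<in>P. card {f \<in> A. R f J})"
    using assms(1) by (simp add: sum.If_cases Int_def)
  finally show ?thesis .
qed

lemma card_Markov:
  fixes t :: real
  assumes "finite A" "t \<ge> 0"
  shows "real (card {a \<in> A. real (g a) \<ge> t}) * t \<le> real (\<Sum>a\<in>A. g a)"
proof -
  have "real (card {a \<in> A. real (g a) \<ge> t}) * t = (\<Sum>a\<in>{a \<in> A. real (g a) \<ge> t}. t)"
    by simp
  also have "\<dots> \<le> (\<Sum>a\<in>{a \<in> A. real (g a) \<ge> t}. real (g a))"
    by (intro sum_mono) auto
  also have "\<dots> \<le> (\<Sum>a\<in>A. real (g a))"
    using assms(1) by (intro sum_mono2) auto
  finally show ?thesis by simp
qed

subsection \<open>Linear algebra over a prime field inside a ring\<close>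

text \<open>The default value 0 outside \<open>I\<close>, in place of the \<open>undefined\<close>
  of \<open>PiE\<close>, makes these sets closed under pointwise sums and differences, so the
  additive structure of the function type serves for vectors, matrices and tuples of matrices
  alike.\<close>

definition zfun :: "'i set \<Rightarrow> 'b::zero set \<Rightarrow> ('i \<Rightarrow> 'b) set"
  where "zfun I S = {x. (\<forall>i\<in>I. x i \<in> S) \<and> (\<forall>i. i \<notin> I \<longrightarrow> x i = 0)}"

lemma zfunI: "(\<And>i. i \<in> I \<Longrightarrow> x i \<in> S) \<Longrightarrow> (\<And>i. i \<notin> I \<Longrightarrow> x i = 0) \<Longrightarrow> x \<in> zfun I S"
  by (simp add: zfun_def)

lemma zfun_in: "x \<in> zfun I S \<Longrightarrow> i \<in> I \<Longrightarrow> x i \<in> S"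
  by (simp add: zfun_def)

lemma zfun_out: "x \<in> zfun I S \<Longrightarrow> i \<notin> I \<Longrightarrow> x i = 0"
  by (simp add: zfun_def)

lemma zfun_bij_betw_PiE: "bij_betw (\<lambda>x. restrict x I) (zfun I S) (I \<rightarrow>\<^sub>E S)"
proof (rule bij_betw_byWitness[where f' = "\<lambda>x i. if i \<in> I then x i else 0"])
qed (auto simp: zfun_def fun_eq_iff restrict_def PiE_def extensional_def)

lemma card_zfun: "finite I \<Longrightarrow> card (zfun I S) = card S ^ card I"
  using bij_betw_same_card[OF zfun_bij_betw_PiE, of I S] by (simp add: card_PiE)

lemma finite_zfun: "finite I \<Longrightarrow> finite S \<Longrightarrow> finite (zfun I S)"
  using bij_betw_finite[OF zfun_bij_betw_PiE, of I S] by (simp add: finite_PiE)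

text \<open>The field is an ideal \<open>K\<close> of a ring; its unit element \<open>u\<close> is not the \<open>1\<close> of the ring.\<close>

locale prime_field_ideal =
  fixes K :: "'a::comm_ring_1 set" and u :: 'a and p :: nat
  assumes prime_p: "Factorial_Ring.prime p"
    and card_K: "card K = p"
    and u_in: "u \<in> K"
    and add_in: "x \<in> K \<Longrightarrow> y \<in> K \<Longrightarrow> x + y \<in> K"
    and mult_in: "x \<in> K \<Longrightarrow> x * r \<in> K"
    and u_mult: "x \<in> K \<Longrightarrow> u * x = x"
    and ex_inverse: "x \<in> K \<Longrightarrow> x \<noteq> 0 \<Longrightarrow> \<exists>y\<in>K. x * y = u"
    and ex_nat: "x \<in> K \<Longrightarrow> \<exists>k. x = of_nat k * u"
    and char_p: "of_nat p * u = 0"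
begin

lemma p_ge_2: "p \<ge> 2"
  using prime_p prime_ge_2_nat by blast

lemma finite_K: "finite K"
  using card_K p_ge_2 by (metis card.infinite not_numeral_le_zero)

lemma zero_in: "0 \<in> K"
  using mult_in[OF u_in, of 0] by simp

lemma uminus_in: "x \<in> K \<Longrightarrow> - x \<in> K"
  using mult_in[of x "-1"] by simp

lemma diff_in: "x \<in> K \<Longrightarrow> y \<in> K \<Longrightarrow> x - y \<in> K"
  using add_in[of x "-y"] uminus_in by simp

lemma mult_in': "x \<in> K \<Longrightarrow> r * x \<in> K"
  using mult_in[of x r] by (simp add: mult.commute)

lemma mult_u: "x \<in> K \<Longrightarrow> x * u = x"
  by (metis u_mult mult.commute)

lemma sum_in: "(\<And>i. i \<in> A \<Longrightarrow> f i \<in> K) \<Longrightarrow> sum f A \<in> K"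
  by (induction A rule: infinite_finite_induct) (auto intro: zero_in add_in)

lemma u_nonzero: "u \<noteq> 0"
proof
  assume "u = 0"
  then have "K \<subseteq> {0}"
    using u_mult by fastforce
  then have "card K \<le> 1"
    by (metis card_mono card.empty card_insert_disjoint finite.emptyI finite_insert empty_iff One_nat_def)
  then show False
    using card_K p_ge_2 by simp
qed

section \<open>Vectors, subspaces, spans and dual families over \<open>K\<close>\<close>

definition dot :: "nat \<Rightarrow> (nat \<Rightarrow> 'a) \<Rightarrow> (nat \<Rightarrow> 'a) \<Rightarrow> 'a"
  where "dot n x y = (\<Sum>i<n. x i * y i)"

abbreviation vec :: "nat \<Rightarrow> (nat \<Rightarrow> 'a) set"
  where "vec n \<equiv> zfun {..<n} K"

definition smul :: "'a \<Rightarrow> ('i \<Rightarrow> 'a) \<Rightarrow> 'i \<Rightarrow> 'a"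
  where "smul c x = (\<lambda>i. c * x i)"

definition comb :: "'j set \<Rightarrow> ('j \<Rightarrow> 'a) \<Rightarrow> ('j \<Rightarrow> 'i \<Rightarrow> 'a) \<Rightarrow> 'i \<Rightarrow> 'a"
  where "comb J \<alpha> x = (\<lambda>i. \<Sum>j\<in>J. \<alpha> j * x j i)"

definition subsp :: "('i \<Rightarrow> 'a) set \<Rightarrow> bool"
  where "subsp U \<longleftrightarrow> 0 \<in> U \<and> (\<forall>x\<in>U. \<forall>y\<in>U. x + y \<in> U) \<and> (\<forall>c\<in>K. \<forall>x\<in>U. smul c x \<in> U)"

definition lspan :: "'j set \<Rightarrow> ('j \<Rightarrow> 'i \<Rightarrow> 'a) \<Rightarrow> ('i \<Rightarrow> 'a) set"
  where "lspan J x = (\<lambda>\<alpha>. comb J \<alpha> x) ` zfun J K"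

definition indep :: "'j set \<Rightarrow> ('j \<Rightarrow> 'i \<Rightarrow> 'a) \<Rightarrow> bool"
  where "indep J x \<longleftrightarrow> (\<forall>\<alpha>\<in>zfun J K. comb J \<alpha> x = 0 \<longrightarrow> \<alpha> = 0)"

text \<open>Biorthogonal families are the certificates of independence used throughout: they turn
  the independence of linear conditions into explicit witnesses.\<close>

definition dual :: "nat \<Rightarrow> 'j set \<Rightarrow> ('j \<Rightarrow> nat \<Rightarrow> 'a) \<Rightarrow> ('j \<Rightarrow> nat \<Rightarrow> 'a) \<Rightarrow> bool"
  where "dual n J x \<xi> \<longleftrightarrow> (\<forall>i\<in>J. \<xi> i \<in> vec n \<and> (\<forall>j\<in>J. dot n (\<xi> i) (x j) = (if i = j then u else 0)))"

lemma dot_in: "x \<in> vec n \<Longrightarrow> dot n x y \<in> K"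
  unfolding dot_def by (intro sum_in mult_in) (auto simp: zfun_def)

lemma dot_in': "y \<in> vec n \<Longrightarrow> dot n x y \<in> K"
  unfolding dot_def by (intro sum_in mult_in') (auto simp: zfun_def)

lemma dot_diff_right: "dot n x (y - z) = dot n x y - dot n x z"
  by (simp add: dot_def algebra_simps sum_subtractf)

lemma dot_diff_left: "dot n (x - y) z = dot n x z - dot n y z"
  by (simp add: dot_def algebra_simps sum_subtractf)

lemma dot_smul_left: "dot n (smul c x) y = c * dot n x y"
  by (simp add: dot_def smul_def sum_distrib_left mult.assoc)

lemma dot_smul_right: "dot n x (smul c y) = c * dot n x y"
  by (simp add: dot_def smul_def sum_distrib_left mult.left_commute)

lemma dot_comb_right: "dot n y (comb J \<alpha> x) = (\<Sum>j\<in>J. \<alpha> j * dot n y (x j))"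
  unfolding dot_def comb_def sum_distrib_left
  by (subst sum.swap) (simp add: mult.left_commute)

lemma dot_comb_left: "dot n (comb J \<alpha> x) y = (\<Sum>j\<in>J. \<alpha> j * dot n (x j) y)"
  unfolding dot_def comb_def sum_distrib_left sum_distrib_right
  by (subst sum.swap) (simp add: mult.assoc)

lemma dot_zero_right: "dot n x 0 = 0"
  by (simp add: dot_def)

lemma subsp_zero: "subsp U \<Longrightarrow> 0 \<in> U"
  and subsp_add: "subsp U \<Longrightarrow> x \<in> U \<Longrightarrow> y \<in> U \<Longrightarrow> x + y \<in> U"
  and subsp_smul: "subsp U \<Longrightarrow> c \<in> K \<Longrightarrow> x \<in> U \<Longrightarrow> smul c x \<in> U"
  by (auto simp: subsp_def)

lemma subsp_comb:
  assumes "subsp U" "\<And>j. j \<in> J \<Longrightarrow> \<alpha> j \<in> K" "\<And>j. j \<in> J \<Longrightarrow> x j \<in> U"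
  shows "comb J \<alpha> x \<in> U"
  using assms(2,3)
proof (induction J rule: infinite_finite_induct)
  case (insert j J)
  have "comb (insert j J) \<alpha> x = smul (\<alpha> j) (x j) + comb J \<alpha> x"
    using insert.hyps by (simp add: comb_def smul_def fun_eq_iff)
  moreover have "smul (\<alpha> j) (x j) + comb J \<alpha> x \<in> U"
    by (intro subsp_add subsp_smul assms(1) insert) auto
  ultimately show ?case by (simp only:)
qed (use subsp_zero[OF assms(1)] in \<open>simp_all add: comb_def zero_fun_def\<close>)

lemma subsp_vec: "subsp (zfun I K)"
  by (auto simp: subsp_def zfun_def smul_def intro: zero_in add_in mult_in)

lemma smul_in_vec: "c \<in> K \<Longrightarrow> x \<in> zfun I K \<Longrightarrow> smul c x \<in> zfun I K"
  using subsp_vec subsp_smul by blast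

lemma diff_in_vec: "x \<in> zfun I K \<Longrightarrow> y \<in> zfun I K \<Longrightarrow> x - y \<in> zfun I K"
  by (auto simp: zfun_def intro: diff_in)

lemma comb_in_vec: "(\<And>j. j \<in> J \<Longrightarrow> \<alpha> j \<in> K) \<Longrightarrow> (\<And>j. j \<in> J \<Longrightarrow> x j \<in> zfun I K) \<Longrightarrow> comb J \<alpha> x \<in> zfun I K"
  by (rule subsp_comb[OF subsp_vec])

lemma subsp_Int: "subsp U \<Longrightarrow> subsp S \<Longrightarrow> subsp (U \<inter> S)"
  by (auto simp: subsp_def)

lemma subsp_lspan: "subsp (lspan J x)"
  unfolding subsp_def
proof (intro conjI ballI)
  have "comb J 0 x = 0"
    by (simp add: comb_def fun_eq_iff)
  then show "0 \<in> lspan J x"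
    unfolding lspan_def using subsp_zero[OF subsp_vec] by (metis image_eqI)
next
  fix y z assume "y \<in> lspan J x" "z \<in> lspan J x"
  then obtain \<alpha> \<beta> where *: "\<alpha> \<in> zfun J K" "\<beta> \<in> zfun J K" "y = comb J \<alpha> x" "z = comb J \<beta> x"
    by (auto simp: lspan_def)
  then have "y + z = comb J (\<alpha> + \<beta>) x"
    by (simp add: comb_def fun_eq_iff algebra_simps sum.distrib)
  then show "y + z \<in> lspan J x"
    unfolding lspan_def using subsp_add[OF subsp_vec *(1,2)] by blast
next
  fix c y assume "c \<in> K" "y \<in> lspan J x"
  then obtain \<alpha> where *: "\<alpha> \<in> zfun J K" "y = comb J \<alpha> x"
    by (auto simp: lspan_def)
  then have "smul c y = comb J (smul c \<alpha>) x"
    by (simp add: comb_def smul_def fun_eq_iff sum_distrib_left mult.assoc)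
  then show "smul c y \<in> lspan J x"
    unfolding lspan_def using smul_in_vec[OF \<open>c \<in> K\<close> *(1)] by blast
qed

lemma lspan_subset: "subsp U \<Longrightarrow> (\<And>j. j \<in> J \<Longrightarrow> x j \<in> U) \<Longrightarrow> lspan J x \<subseteq> U"
  by (auto simp: lspan_def intro!: subsp_comb dest: zfun_in)

lemma comb_in_lspan:
  assumes "\<And>j. j \<in> J \<Longrightarrow> \<alpha> j \<in> K"
  shows "comb J \<alpha> x \<in> lspan J x"
proof -
  have "comb J \<alpha> x = comb J (\<lambda>j. if j \<in> J then \<alpha> j else 0) x"
    by (auto simp: comb_def intro!: sum.cong)
  moreover have "(\<lambda>j. if j \<in> J then \<alpha> j else 0) \<in> zfun J K"
    using assms by (simp add: zfun_def)
  ultimately show ?thesis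
    unfolding lspan_def by blast
qed

text \<open>The coefficient is \<open>u\<close> because coefficients must lie in \<open>K\<close>;
  multiplication by \<open>u\<close> fixes only elements of \<open>K\<close>, whence the hypothesis
  on \<open>x k\<close>.\<close>

lemma comb_unit:
  assumes "finite J" "k \<in> J" "x k \<in> zfun I K"
  shows "comb J (\<lambda>j. if j = k then u else 0) x = x k"
proof
  fix i
  have "comb J (\<lambda>j. if j = k then u else 0) x i = (\<Sum>j\<in>J. if j = k then u * x j i else 0)"
    unfolding comb_def by (intro sum.cong) auto
  also have "\<dots> = u * x k i"
    using assms by (simp add: sum.delta)
  also have "\<dots> = x k i"
    using assms(3) u_mult by (cases "i \<in> I") (auto simp: zfun_def)
  finally show "comb J (\<lambda>j. if j = k then u else 0) x i = x k i" .
qed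

lemma in_lspan:
  assumes "finite J" "k \<in> J" "x k \<in> zfun I K"
  shows "x k \<in> lspan J x"
  using comb_in_lspan[of J "\<lambda>j. if j = k then u else 0" x] comb_unit[of J k x I] assms u_in zero_in by auto

lemma card_lspan_le: "finite J \<Longrightarrow> card (lspan J x) \<le> p ^ card J"
  unfolding lspan_def using card_image_le[OF finite_zfun[OF _ finite_K], of J] by (simp add: card_zfun card_K)

lemma finite_lspan: "finite J \<Longrightarrow> finite (lspan J x)"
  unfolding lspan_def using finite_zfun finite_K by blast

lemma indepD: "indep J x \<Longrightarrow> \<alpha> \<in> zfun J K \<Longrightarrow> comb J \<alpha> x = 0 \<Longrightarrow> \<alpha> = 0"
  by (simp add: indep_def)

lemma comb_diff: "comb J (\<alpha> - \<beta>) x = comb J \<alpha> x - comb J \<beta> x"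
  by (simp add: comb_def fun_eq_iff algebra_simps sum_subtractf)

lemma indep_inj: "indep J x \<Longrightarrow> inj_on (\<lambda>\<alpha>. comb J \<alpha> x) (zfun J K)"
  by (rule inj_onI) (metis comb_diff diff_in_vec indepD eq_iff_diff_eq_0)

lemma card_lspan: "finite J \<Longrightarrow> indep J x \<Longrightarrow> card (lspan J x) = p ^ card J"
  unfolding lspan_def by (simp add: card_image indep_inj card_zfun card_K)

lemma comb_cong: "J = J' \<Longrightarrow> (\<And>j. j \<in> J \<Longrightarrow> \<alpha> j = \<beta> j) \<Longrightarrow> (\<And>j. j \<in> J \<Longrightarrow> x j = y j) \<Longrightarrow> comb J \<alpha> x = comb J' \<beta> y"
  by (simp add: comb_def)

lemma indep_cong: "(\<And>j. j \<in> J \<Longrightarrow> x j = y j) \<Longrightarrow> indep J x = indep J y"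
  unfolding indep_def using comb_cong[of J J _ _ x y] by metis

lemma lspan_cong: "(\<And>j. j \<in> J \<Longrightarrow> x j = y j) \<Longrightarrow> lspan J x = lspan J y"
  unfolding lspan_def by (intro image_cong refl comb_cong) auto

lemma indep_subset:
  assumes "finite J" "indep J x" "J' \<subseteq> J"
  shows "indep J' x"
  unfolding indep_def
proof (intro ballI impI)
  fix \<alpha> assume \<alpha>: "\<alpha> \<in> zfun J' K" "comb J' \<alpha> x = 0"
  have "comb J \<alpha> x = comb J' \<alpha> x"
    unfolding comb_def using assms \<alpha>(1)
    by (intro ext sum.mono_neutral_right) (auto simp: zfun_def)
  moreover have "\<alpha> \<in> zfun J K"
    using \<alpha>(1) assms(3) zero_in by (auto simp: zfun_def)
  ultimately show "\<alpha> = 0"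
    using indepD[OF assms(2)] \<alpha>(2) by simp
qed

lemma comb_insert: "finite J \<Longrightarrow> k \<notin> J \<Longrightarrow> comb (insert k J) \<alpha> x = smul (\<alpha> k) (x k) + comb J \<alpha> x"
  by (simp add: comb_def smul_def fun_eq_iff)

lemma smul_smul: "smul c (smul d x) = smul (c * d) x"
  by (simp add: smul_def mult.assoc)

lemma smul_u: "x \<in> zfun I K \<Longrightarrow> smul u x = x"
  by (auto simp: smul_def fun_eq_iff zfun_def) (metis mult_zero_right u_mult)

lemma indep_insert:
  assumes "finite J" "indep J x" "k \<notin> J" "x k \<notin> lspan J x" "x k \<in> zfun I K" 
  shows "indep (insert k J) x"
  unfolding indep_def
proof (intro ballI impI)
  fix \<alpha> assume \<alpha>: "\<alpha> \<in> zfun (insert k J) K" "comb (insert k J) \<alpha> x = 0"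
  have eq: "smul (\<alpha> k) (x k) + comb J \<alpha> x = 0"
    using \<alpha>(2) comb_insert[OF assms(1,3)] by metis
  have 0: "\<alpha> k = 0"
  proof (rule ccontr)
    assume nz: "\<alpha> k \<noteq> 0"
    then obtain w where w: "w \<in> K" "\<alpha> k * w = u"
      using ex_inverse zfun_in[OF \<alpha>(1)] by blast
    have "smul (\<alpha> k) (x k) = - comb J \<alpha> x"
      using eq by (simp add: eq_neg_iff_add_eq_0)
    then have "smul (-w) (comb J \<alpha> x) = smul w (smul (\<alpha> k) (x k))"
      by (simp add: smul_def fun_eq_iff)
    also have "\<dots> = x k"
      using smul_u[OF assms(5)] w(2) by (simp add: smul_smul mult.commute)
    finally show False
      using subsp_smul[OF subsp_lspan uminus_in[OF w(1)] comb_in_lspan, of J \<alpha> x] assms(4) zfun_in[OF \<alpha>(1)] by auto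
  qed
  then have "comb J \<alpha> x = 0"
    using eq by (simp add: smul_def zero_fun_def plus_fun_def)
  moreover have "\<alpha> \<in> zfun J K"
    using \<alpha>(1) 0 by (auto simp: zfun_def)
  ultimately show "\<alpha> = 0"
    using assms(2) indepD by blast
qed

lemma indep_notin_lspan:
  assumes "finite J" "indep (insert k J) x" "k \<notin> J" "x k \<in> zfun I K"
  shows "x k \<notin> lspan J x"
proof
  assume "x k \<in> lspan J x"
  then obtain \<alpha> where \<alpha>: "\<alpha> \<in> zfun J K" "x k = comb J \<alpha> x"
    by (auto simp: lspan_def)
  define \<beta> where "\<beta> = \<alpha>(k := -u)"
  have "comb (insert k J) \<beta> x = smul (-u) (x k) + comb J \<beta> x"
    using comb_insert[OF assms(1,3), of \<beta> x] by (simp add: \<beta>_def)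
  also have "comb J \<beta> x = x k"
    using \<alpha>(2) assms(3) by (auto simp: \<beta>_def comb_def intro!: sum.cong)
  also have "smul (-u) (x k) + x k = 0"
    using smul_u[OF assms(4)] by (simp add: smul_def fun_eq_iff)
  finally have "comb (insert k J) \<beta> x = 0" .
  moreover have "\<beta> \<in> zfun (insert k J) K"
    using \<alpha>(1) uminus_in[OF u_in] by (auto simp: \<beta>_def zfun_def)
  ultimately have "\<beta> = 0"
    using assms(2) indepD by blast
  then have "\<beta> k = 0" by simp
  then show False
    using u_nonzero by (simp add: \<beta>_def)
qed

lemma dual_imp_indep:
  assumes "finite J" "dual n J x \<xi>"
  shows "indep J x"
  unfolding indep_def
proof (intro ballI impI ext)
  fix \<alpha> i assume \<alpha>: "\<alpha> \<in> zfun J K" "comb J \<alpha> x = 0"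
  show "\<alpha> i = 0 i"
  proof (cases "i \<in> J")
    case True
    have "0 = dot n (\<xi> i) (comb J \<alpha> x)"
      using \<alpha>(2) by (simp add: dot_zero_right)
    also have "\<dots> = (\<Sum>j\<in>J. if j = i then \<alpha> j * u else 0)"
      unfolding dot_comb_right using assms(2) True by (intro sum.cong) (auto simp: dual_def)
    also have "\<dots> = \<alpha> i"
      using assms(1) True zfun_in[OF \<alpha>(1) True] by (simp add: mult_u)
    finally show ?thesis by simp
  qed (use \<alpha> in \<open>simp add: zfun_def\<close>)
qed

text \<open>Gram-Schmidt with functionals. The new vector minus its components along the old family
  is nonzero, so a coordinate functional detects it. This functional is corrected to vanish on the
  old family, and the old duals are then corrected to vanish on the new vector.\<close>

lemma ex_dual:
  assumes "finite J" "indep J x" "\<And>j. j \<in> J \<Longrightarrow> x j \<in> vec n"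
  shows "\<exists>\<xi>. dual n J x \<xi>"
  using assms
proof (induction J)
  case empty
  then show ?case by (simp add: dual_def)
next
  case (insert k J)
  have "indep J x"
    using insert.prems insert.hyps indep_subset by blast
  then obtain \<xi> where \<xi>: "dual n J x \<xi>"
    using insert by auto
  define v where "v = x k"
  have v: "v \<in> vec n" "v \<notin> lspan J x"
    using insert.prems insert.hyps indep_notin_lspan[of J k x "{..<n}"] by (auto simp: v_def)
  have \<xi>K: "\<xi> j \<in> vec n" if "j \<in> J" for j
    using \<xi> that by (auto simp: dual_def)
  have \<xi>x: "dot n (\<xi> i) (x j) = (if i = j then u else 0)" if "i \<in> J" "j \<in> J" for i j
    using \<xi> that by (auto simp: dual_def)
  define v' where "v' = v - comb J (\<lambda>j. dot n (\<xi> j) v) x"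
  have c_in: "comb J (\<lambda>j. dot n (\<xi> j) v) x \<in> lspan J x"
    by (rule comb_in_lspan) (use \<xi>K dot_in in auto)
  have "v' \<noteq> 0"
    using c_in v(2) by (auto simp: v'_def)
  moreover have "v' \<in> vec n"
    unfolding v'_def using insert.prems \<xi>K dot_in v by (intro diff_in_vec comb_in_vec) auto
  moreover obtain c where c: "v' c \<noteq> 0"
    using calculation by (auto simp: fun_eq_iff)
  ultimately have c: "v' c \<noteq> 0" "c < n" "v' c \<in> K"
    using c by (auto simp: zfun_def dest: spec[of _ c])
  then obtain w where w: "w \<in> K" "v' c * w = u"
    using ex_inverse by blast
  define \<eta>0 where "\<eta>0 = (\<lambda>i. if i = c then w else 0)"
  have \<eta>0: "\<eta>0 \<in> vec n"
    using c w by (auto simp: \<eta>0_def zfun_def zero_in)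
  have "dot n \<eta>0 v' = (\<Sum>i<n. if i = c then w * v' i else 0)"
    unfolding dot_def \<eta>0_def by (intro sum.cong) auto
  then have \<eta>0v': "dot n \<eta>0 v' = u"
    using c w by (simp add: mult.commute)
  define \<eta> where "\<eta> = \<eta>0 - comb J (\<lambda>j. dot n \<eta>0 (x j)) \<xi>"
  have \<eta>_in: "\<eta> \<in> vec n"
    unfolding \<eta>_def using \<eta>0 \<xi>K dot_in by (intro diff_in_vec comb_in_vec) auto
  have \<eta>x: "dot n \<eta> (x j) = 0" if "j \<in> J" for j
  proof -
    have "(\<Sum>i\<in>J. dot n \<eta>0 (x i) * dot n (\<xi> i) (x j)) = (\<Sum>i\<in>J. if i = j then dot n \<eta>0 (x i) * u else 0)"
      using \<xi>x that by (intro sum.cong) auto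
    also have "\<dots> = dot n \<eta>0 (x j)"
      using that insert.hyps mult_u[OF dot_in[OF \<eta>0]] by simp
    finally show ?thesis
      by (simp add: \<eta>_def dot_diff_left dot_comb_left)
  qed
  \<comment> \<open>Removing the components from the vector or from the functional gives the same
    value.\<close>
  have "dot n \<eta>0 v' = dot n \<eta> v"
    unfolding v'_def \<eta>_def dot_diff_left dot_diff_right dot_comb_left dot_comb_right
    by (simp add: mult.commute)
  then have \<eta>v: "dot n \<eta> v = u"
    using \<eta>0v' by simp
  define \<xi>' where "\<xi>' = (\<lambda>j. if j = k then \<eta> else \<xi> j - smul (dot n (\<xi> j) v) \<eta>)"
  have "dual n (insert k J) x \<xi>'"
    unfolding dual_def
  proof (intro ballI conjI)
    fix i assume i: "i \<in> insert k J"
    show "\<xi>' i \<in> vec n"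
      using i \<eta>_in \<xi>K insert.hyps by (auto simp: \<xi>'_def intro!: diff_in_vec smul_in_vec dot_in)
    fix j assume j: "j \<in> insert k J"
    show "dot n (\<xi>' i) (x j) = (if i = j then u else 0)"
      using i j insert.hyps \<eta>v \<eta>x \<xi>x \<xi>K mult_u[OF dot_in]
      by (auto simp: \<xi>'_def dot_diff_left dot_smul_left v_def)
  qed
  then show ?case by blast
qed

text \<open>Each added vector multiplies the size of the span by \<open>p\<close>, so the
  cardinality of \<open>U\<close> bounds the process. Dimensions are read off from cardinalities
  \<open>p ^ d\<close>.\<close>

lemma basis_extension:
  assumes "subsp U" "U \<subseteq> zfun I K" "finite I" "indep {..<a} x" "\<And>j. j < a \<Longrightarrow> x j \<in> U"
  shows "\<exists>d\<ge>a::nat. \<exists>y. (\<forall>j<a. y j = x j) \<and> indep {..<d} y \<and> (\<forall>j<d. y j \<in> U) \<and> lspan {..<d} y = U"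
  using assms(4,5)
proof (induction "card U - p ^ a" arbitrary: a x rule: less_induct)
  case less
  have fU: "finite U"
    using finite_subset[OF assms(2) finite_zfun[OF assms(3) finite_K]] .
  have sub: "lspan {..<a} x \<subseteq> U"
    by (rule lspan_subset[OF assms(1)]) (simp add: less.prems)
  show ?case
  proof (cases "lspan {..<a} x = U")
    case True
    then show ?thesis using less.prems by blast
  next
    case False
    then obtain v where v: "v \<in> U" "v \<notin> lspan {..<a} x"
      using sub by blast
    let ?x = "x(a := v)"
    have "lspan {..<a} ?x = lspan {..<a} x"
      by (rule lspan_cong) auto
    moreover have "indep {..<a} ?x"
      using less.prems indep_cong[of "{..<a}" x ?x] by auto
    ultimately have ind: "indep {..<Suc a} ?x"
      using indep_insert[of "{..<a}" ?x a I] v assms(2) by (auto simp: lessThan_Suc)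
    have U': "?x j \<in> U" if "j < Suc a" for j
      using that v less.prems(2)[of j] by (cases "j = a") auto
    have "lspan {..<Suc a} ?x \<subseteq> U"
      by (rule lspan_subset[OF assms(1)]) (use U' in simp)
    then have "p ^ Suc a \<le> card U"
      using card_lspan[OF _ ind] card_mono[OF fU, of "lspan {..<Suc a} ?x"] by simp
    moreover have "p ^ a < p ^ Suc a"
      using p_ge_2 by simp
    ultimately have "card U - p ^ Suc a < card U - p ^ a"
      by linarith
    from less.hyps[OF this ind U'] obtain d y where
      dy: "d \<ge> Suc a" "\<forall>j<Suc a. y j = ?x j" "indep {..<d} y" "\<forall>j<d. y j \<in> U" "lspan {..<d} y = U"
      by blast
    have "\<forall>j<a. y j = x j"
    proof (intro allI impI)
      fix j assume "j < a"
      then show "y j = x j"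
        using dy(2)[rule_format, of j] by simp
    qed
    moreover have "a \<le> d"
      using dy(1) by simp
    ultimately show ?thesis
      using dy(3-5) by blast
  qed
qed

lemma ex_basis:
  assumes "subsp U" "U \<subseteq> zfun I K" "finite I"
  shows "\<exists>d x. indep {..<d} x \<and> (\<forall>j<d. x j \<in> U) \<and> lspan {..<d} x = U \<and> card U = p ^ d"
proof -
  have "indep {..<0::nat} (\<lambda>_. 0)"
    by (auto simp: indep_def zfun_def fun_eq_iff)
  from basis_extension[OF assms this] obtain d y where "indep {..<d} y" "\<forall>j<d. y j \<in> U" "lspan {..<d::nat} y = U"
    by blast
  moreover from this have "card U = p ^ d"
    using card_lspan[of "{..<d}" y] by simp
  ultimately show ?thesis
    by blast
qed

subsection \<open>Counting forms and subspaces\<close>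

abbreviation mats :: "nat \<Rightarrow> (nat \<times> nat \<Rightarrow> 'a) set"
  where "mats n \<equiv> zfun ({..<n} \<times> {..<n}) K"

text \<open>The form of a square matrix \<open>f\<close> is \<open>x\<^sup>T f y - y\<^sup>T f x\<close>: a uniformly random matrix gives a uniformly random
  alternating form in every characteristic.\<close>

definition ev :: "nat \<Rightarrow> (nat \<times> nat \<Rightarrow> 'a) \<Rightarrow> (nat \<Rightarrow> 'a) \<Rightarrow> (nat \<Rightarrow> 'a) \<Rightarrow> 'a"
  where "ev n f x y = (\<Sum>a<n. \<Sum>b<n. f (a, b) * (x a * y b - y a * x b))"

text \<open>A rank one matrix, whose form is the wedge of \<open>\<xi>\<close> and
  \<open>\<eta>\<close> (see \<open>ev_tens\<close>). Wedges of dual vectors are the witnesses in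
  all independence counts for forms.\<close>

definition tens :: "(nat \<Rightarrow> 'a) \<Rightarrow> (nat \<Rightarrow> 'a) \<Rightarrow> nat \<times> nat \<Rightarrow> 'a"
  where "tens \<xi> \<eta> = (\<lambda>(a, b). \<xi> a * \<eta> b)"

lemma ev_in: "f \<in> mats n \<Longrightarrow> ev n f x y \<in> K"
  unfolding ev_def by (intro sum_in mult_in) (auto simp: zfun_def)

lemma ev_smul: "ev n (smul c f) x y = c * ev n f x y"
  by (simp add: ev_def smul_def sum_distrib_left mult.assoc)

lemma ev_zero: "ev n 0 x y = 0"
  by (simp add: ev_def)

lemma ev_self: "ev n f x x = 0"
  by (simp add: ev_def)

lemma ev_swap: "ev n f y x = - ev n f x y"
  unfolding ev_def sum_negf[symmetric] by (simp add: algebra_simps)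

lemma ev_comb_right: "ev n f y (comb J \<alpha> x) = (\<Sum>j\<in>J. \<alpha> j * ev n f y (x j))"
proof -
  have *: "f (a, b) * (y a * comb J \<alpha> x b - comb J \<alpha> x a * y b)
    = (\<Sum>j\<in>J. \<alpha> j * (f (a, b) * (y a * x j b - x j a * y b)))" for a b
    unfolding comb_def sum_distrib_left sum_distrib_right sum_subtractf[symmetric]
    by (intro sum.cong refl) (simp add: algebra_simps)
  show ?thesis
    unfolding ev_def * sum_distrib_left
    by (subst sum.swap[of _ J], subst sum.swap[of _ J]) (rule refl)
qed

lemma ev_comb_left: "ev n f (comb J \<alpha> x) y = (\<Sum>j\<in>J. \<alpha> j * ev n f (x j) y)"
  by (subst ev_swap, subst (2) ev_swap) (simp add: ev_comb_right sum_negf)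

lemma ev_tens: "ev n (tens \<xi> \<eta>) x y = dot n \<xi> x * dot n \<eta> y - dot n \<xi> y * dot n \<eta> x"
  unfolding ev_def dot_def sum_product sum_subtractf[symmetric] tens_def
  by (intro sum.cong refl) (simp add: algebra_simps)

lemma tens_in: "\<xi> \<in> vec n \<Longrightarrow> \<eta> \<in> vec n \<Longrightarrow> tens \<xi> \<eta> \<in> mats n"
  by (auto simp: tens_def zfun_def intro: mult_in)

lemma finite_mats: "finite (mats n)"
  by (intro finite_zfun finite_K) auto

lemma finite_vec: "finite (vec n)"
  by (intro finite_zfun finite_K) auto

lemma card_vec: "card (vec n) = p ^ n"
  by (simp add: card_zfun card_K)

section \<open>Counting solutions of independent linear conditions\<close>

lemma card_kernel:
  fixes Z :: "'z::ab_group_add set" and l :: "'z \<Rightarrow> 'a"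
  assumes "\<And>z w. z \<in> Z \<Longrightarrow> w \<in> Z \<Longrightarrow> z - w \<in> Z"
    and "\<And>z w. z \<in> Z \<Longrightarrow> w \<in> Z \<Longrightarrow> l (z - w) = l z - l w"
    and "\<And>z. z \<in> Z \<Longrightarrow> l z \<in> K"
    and "\<And>c. c \<in> K \<Longrightarrow> D c \<in> Z" "\<And>c. c \<in> K \<Longrightarrow> l (D c) = c"
  shows "card Z = p * card {z \<in> Z. l z = 0}"
proof -
  have 0: "0 \<in> Z" "l 0 = 0"
    using assms(1,2)[OF assms(4)[OF zero_in] assms(4)[OF zero_in]] by auto
  have minus: "- z \<in> Z" "l (- z) = - l z" if "z \<in> Z" for z
    using assms(1,2)[OF 0(1) that] 0 by auto
  have plus: "z + w \<in> Z" "l (z + w) = l z + l w" if "z \<in> Z" "w \<in> Z" for z w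
    using assms(1,2)[OF that(1) minus(1)[OF that(2)]] minus(2)[OF that(2)] by auto
  \<comment> \<open>Every point splits uniquely into the representative \<open>D (l z)\<close> of
    its fibre and an element of the kernel.\<close>
  have "bij_betw (\<lambda>(c, z). D c + z) (K \<times> {z \<in> Z. l z = 0}) Z"
    by (rule bij_betw_byWitness[where f' = "\<lambda>z. (l z, z - D (l z))"])
      (auto simp: assms plus)
  from bij_betw_same_card[OF this] show ?thesis
    by (simp add: card_K card_cartesian_product)
qed

text \<open>The conditions are imposed one at a time. The witnesses \<open>D\<close> are dual to the
  functionals \<open>l\<close>, so those for the next condition satisfy all earlier ones, and each
  step divides the count by exactly \<open>p\<close>.\<close>

lemma card_kernels:
  fixes Z :: "'z::ab_group_add set" and l :: "'j \<Rightarrow> 'z \<Rightarrow> 'a"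
  assumes "finite J"
    and "\<And>z w. z \<in> Z \<Longrightarrow> w \<in> Z \<Longrightarrow> z - w \<in> Z"
    and "\<And>j z w. j \<in> J \<Longrightarrow> z \<in> Z \<Longrightarrow> w \<in> Z \<Longrightarrow> l j (z - w) = l j z - l j w"
    and "\<And>j z. j \<in> J \<Longrightarrow> z \<in> Z \<Longrightarrow> l j z \<in> K"
    and "\<And>j c. j \<in> J \<Longrightarrow> c \<in> K \<Longrightarrow> D j c \<in> Z"
    and "\<And>i j c. i \<in> J \<Longrightarrow> j \<in> J \<Longrightarrow> c \<in> K \<Longrightarrow> l i (D j c) = (if i = j then c else 0)"
  shows "card Z = p ^ card J * card {z \<in> Z. \<forall>j\<in>J. l j z = 0}"
  using assms
proof (induction J)
  case empty
  then show ?case by simp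
next
  case (insert k J)
  let ?Z = "{z \<in> Z. \<forall>j\<in>J. l j z = 0}"
  have "card Z = p ^ card J * card ?Z"
    by (rule insert.IH) (use insert.prems in auto)
  also have "card ?Z = p * card {z \<in> ?Z. l k z = 0}"
  proof (rule card_kernel[where D = "D k"])
    show "z - w \<in> ?Z" if "z \<in> ?Z" "w \<in> ?Z" for z w
      using that insert.prems(1,2) by auto
    show "D k c \<in> ?Z" if "c \<in> K" for c
      using that insert.hyps insert.prems(4,5) by auto
  qed (use insert.prems in auto)
  also have "{z \<in> ?Z. l k z = 0} = {z \<in> Z. \<forall>j\<in>insert k J. l j z = 0}"
    by auto
  finally show ?case
    using insert.hyps by simp
qed

abbreviation fam :: "nat \<Rightarrow> nat \<Rightarrow> (nat \<Rightarrow> nat \<times> nat \<Rightarrow> 'a) set"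
  where "fam m n \<equiv> zfun {..<m} (mats n)"

lemma finite_fam: "finite (fam m n)"
  by (intro finite_zfun finite_mats) auto

lemma card_fam: "card (fam m n) = card (mats n) ^ m"
  by (simp add: card_zfun[of "{..<m}"])

lemma card_mats_pos: "card (mats n) > 0"
  using finite_mats subsp_zero[OF subsp_vec] card_gt_0_iff by blast

text \<open>The functional \<open>\<mu>\<close> on \<open>W\<close> applied to the bracket of
  \<open>x\<close> and \<open>y\<close>.\<close>

definition evl :: "nat \<Rightarrow> nat \<Rightarrow> (nat \<Rightarrow> 'a) \<Rightarrow> (nat \<Rightarrow> nat \<times> nat \<Rightarrow> 'a) \<Rightarrow> (nat \<Rightarrow> 'a) \<Rightarrow> (nat \<Rightarrow> 'a) \<Rightarrow> 'a"
  where "evl m n \<mu> B x y = dot m \<mu> (\<lambda>c. ev n (B c) x y)"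

definition pairs :: "nat \<Rightarrow> (nat \<times> nat) set"
  where "pairs d = {(i, j). i < j \<and> j < d}"

lemma pairs_Suc: "pairs (Suc d) = pairs d \<union> (\<lambda>i. (i, d)) ` {..<d}"
  by (auto simp: pairs_def less_Suc_eq)

lemma finite_pairs: "finite (pairs d)"
  by (induction d) (simp_all add: pairs_Suc, simp add: pairs_def)

lemma card_pairs: "card (pairs d) = d * (d - 1) div 2"
proof (induction d)
  case (Suc d)
  have "card (pairs (Suc d)) = card (pairs d) + card ((\<lambda>i. (i, d)) ` {..<d})"
    unfolding pairs_Suc by (intro card_Un_disjoint finite_pairs) (auto simp: pairs_def)
  also have "card ((\<lambda>i. (i, d)) ` {..<d}) = d"
    by (simp add: card_image inj_on_def)
  finally show ?case
    using Suc by (cases d) auto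
qed (simp add: pairs_def)

lemma ev_diff: "ev n (f - g) x y = ev n f x y - ev n g x y"
  unfolding ev_def sum_subtractf[symmetric] by (intro sum.cong refl) (simp add: algebra_simps)

lemma dual_dot: "dual n J x \<xi> \<Longrightarrow> i \<in> J \<Longrightarrow> j \<in> J \<Longrightarrow> dot n (\<xi> i) (x j) = (if i = j then u else 0)"
  by (auto simp: dual_def)

lemma dual_in: "dual n J x \<xi> \<Longrightarrow> i \<in> J \<Longrightarrow> \<xi> i \<in> vec n"
  by (auto simp: dual_def)

text \<open>On the transposed pair the wedge takes the value \<open>- u\<close>; the last hypothesis
  excludes this case.\<close>

lemma ev_tens_dual:
  assumes "dual n J x \<xi>" "i \<in> J" "j \<in> J" "k \<in> J" "l \<in> J" "i \<noteq> j" "k \<noteq> l" "(l, k) \<noteq> (i, j)"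
  shows "ev n (tens (\<xi> i) (\<xi> j)) (x k) (x l) = (if (i, j) = (k, l) then u else 0)"
  unfolding ev_tens using assms by (auto simp: dual_dot u_mult[OF u_in])

text \<open>The conditions are independent: for dual families \<open>\<nu>\<close> and
  \<open>\<xi>\<close>, the tensor of \<open>\<nu> l\<close> with the wedge of
  \<open>\<xi> i\<close> and \<open>\<xi> j\<close> violates only the condition indexed by
  \<open>(l, i, j)\<close>.\<close>

lemma card_vanishing_on_basis:
  assumes "indep {..<d} x" "\<And>j. j < d \<Longrightarrow> x j \<in> vec n"
    and "indep {..<q} \<mu>" "\<And>j. j < q \<Longrightarrow> \<mu> j \<in> vec m"
  shows "card (fam m n) = p ^ (q * (d * (d - 1) div 2)) *
    card {B \<in> fam m n. \<forall>(l, i, j)\<in>{..<q} \<times> pairs d. evl m n (\<mu> l) B (x i) (x j) = 0}"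
proof -
  obtain \<xi> where \<xi>: "dual n {..<d} x \<xi>"
    using ex_dual[of "{..<d}" x n] assms by auto
  obtain \<nu> where \<nu>: "dual m {..<q} \<mu> \<nu>"
    using ex_dual[of "{..<q}" \<mu> m] assms by auto
  let ?J = "{..<q} \<times> pairs d"
  let ?l = "\<lambda>(l, i, j) B. evl m n (\<mu> l) B (x i) (x j)"
  let ?D = "\<lambda>(l, i, j) c. (\<lambda>k. smul (c * \<nu> l k) (tens (\<xi> i) (\<xi> j)))"
  have "card (fam m n) = p ^ card ?J * card {B \<in> fam m n. \<forall>t\<in>?J. ?l t B = 0}"
  proof (rule card_kernels[where D = ?D])
    show "finite ?J"
      using finite_pairs by blast
    show "z - w \<in> fam m n" if "z \<in> fam m n" "w \<in> fam m n" for z w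
    proof (rule zfunI)
      fix c assume "c \<in> {..<m}"
      then show "(z - w) c \<in> mats n"
        using that[THEN zfun_in] by (simp add: diff_in_vec)
    next
      fix c assume "c \<notin> {..<m}"
      then show "(z - w) c = 0"
        using that[THEN zfun_out] by simp
    qed
    show "?l t (z - w) = ?l t z - ?l t w" for t z w
    proof -
      have "(\<lambda>c. ev n ((z - w) c) x y) = (\<lambda>c. ev n (z c) x y) - (\<lambda>c. ev n (w c) x y)" for x y
        by (simp add: fun_eq_iff ev_diff)
      then show ?thesis
        by (cases t) (simp add: evl_def dot_diff_right)
    qed
    show "?l t z \<in> K" if "t \<in> ?J" for t z
      using that assms(4) by (auto simp: evl_def intro: dot_in)
    show "?D t c \<in> fam m n" if "t \<in> ?J" "c \<in> K" for t c
    proof (cases t)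
      case (fields l i j)
      then have "i < d" "j < d" "l < q"
        using that by (auto simp: pairs_def)
      then have T: "tens (\<xi> i) (\<xi> j) \<in> mats n" "\<nu> l \<in> vec m"
        using tens_in dual_in[OF \<xi>] dual_in[OF \<nu>] by auto
      show ?thesis
      proof (rule zfunI)
        fix k assume "k \<in> {..<m}"
        show "?D t c k \<in> mats n"
          using fields smul_in_vec[OF mult_in[OF \<open>c \<in> K\<close>] T(1)] by simp
      next
        fix k assume "k \<notin> {..<m}"
        then show "?D t c k = 0"
          using fields zfun_out[OF T(2)] by (simp add: smul_def fun_eq_iff)
      qed
    qed
    show "?l s (?D t c) = (if s = t then c else 0)" if st: "s \<in> ?J" "t \<in> ?J" and c: "c \<in> K" for s t c
    proof -
      obtain l i j l' i' j' where st_eq: "s = (l, i, j)" "t = (l', i', j')"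
        using prod_cases3 by metis
      then have b: "i < j" "j < d" "l < q" "i' < j'" "j' < d" "l' < q"
        using st by (auto simp: pairs_def)
      have "(\<lambda>k. ev n (smul (c * \<nu> l' k) (tens (\<xi> i') (\<xi> j'))) (x i) (x j))
        = smul (c * ev n (tens (\<xi> i') (\<xi> j')) (x i) (x j)) (\<nu> l')"
        by (rule ext) (simp add: ev_smul, simp add: smul_def ac_simps)
      then have "?l s (?D t c) = c * ev n (tens (\<xi> i') (\<xi> j')) (x i) (x j) * dot m (\<nu> l') (\<mu> l)"
        by (simp add: st_eq evl_def dot_smul_right) (simp add: dot_def mult.commute)
      also have "ev n (tens (\<xi> i') (\<xi> j')) (x i) (x j) = (if (i', j') = (i, j) then u else 0)"
        using b by (intro ev_tens_dual[OF \<xi>]) auto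
      also have "dot m (\<nu> l') (\<mu> l) = (if l' = l then u else 0)"
        using b dual_dot[OF \<nu>] by simp
      finally show ?thesis
        using c by (auto simp: st_eq mult_u)
    qed
  qed
  then show ?thesis
    by (simp add: card_cartesian_product card_pairs split_def)
qed

section \<open>Counting subspaces of a given dimension\<close>

lemma card_indep_tuples_ge:
  assumes "subsp U" "U \<subseteq> zfun I K" "finite I" "card U = p ^ d" 
  shows "(\<Prod>i<k. p ^ d - p ^ i) \<le> card {x \<in> zfun {..<k} U. indep {..<k} x}"
proof (induction k)
  case 0
  have "{x \<in> zfun {..<0::nat} U. indep {..<0} x} = {0}"
    by (auto simp: zfun_def indep_def fun_eq_iff)
  then show ?case by simp
next
  case (Suc k)
  let ?T = "\<lambda>k. {x \<in> zfun {..<k} U. indep {..<k} x}"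
  have fU: "finite U"
    using finite_subset[OF assms(2) finite_zfun[OF assms(3) finite_K]] .
  have fT: "finite (?T k)" for k :: nat
    using finite_zfun[of "{..<k}" U] fU by simp
  have inj: "inj_on (\<lambda>(x, v). x(k := v)) (Sigma (?T k) (\<lambda>x. U - lspan {..<k} x))"
  proof (rule inj_onI, clarify)
    fix x v y w
    assume *: "x(k := v) = y(k := w)" "x \<in> zfun {..<k} U" "y \<in> zfun {..<k} U"
    have "x k = 0" "y k = 0"
      using *(2,3) by (auto simp: zfun_def)
    then show "x = y \<and> v = w"
      using *(1) by (metis fun_upd_idem_iff fun_upd_same fun_upd_upd)
  qed
  have sub: "(\<lambda>(x, v). x(k := v)) ` Sigma (?T k) (\<lambda>x. U - lspan {..<k} x) \<subseteq> ?T (Suc k)"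
  proof clarify
    fix x v assume x: "x \<in> zfun {..<k} U" "indep {..<k} x" "v \<in> U" "v \<notin> lspan {..<k} x"
    let ?x = "x(k := v)"
    have "lspan {..<k} ?x = lspan {..<k} x" "indep {..<k} ?x"
      using lspan_cong[of "{..<k}" x ?x] indep_cong[of "{..<k}" x ?x] x by auto
    then have "indep {..<Suc k} ?x"
      using indep_insert[of "{..<k}" ?x k I] x assms(2) by (auto simp: lessThan_Suc)
    moreover have "?x \<in> zfun {..<Suc k} U"
      using x by (auto simp: zfun_def less_Suc_eq)
    ultimately show "?x \<in> zfun {..<Suc k} U \<and> indep {..<Suc k} ?x"
      by blast
  qed
  \<comment> \<open>For \<open>k \<ge> d\<close> the truncated difference is 0 and the bound is
    empty.\<close>
  have "card (U - lspan {..<k} x) \<ge> p ^ d - p ^ k" for x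
    using diff_card_le_card_Diff[OF finite_lspan, of "{..<k}" U x] card_lspan_le[of "{..<k}" x] assms(4)
    by simp
  then have "(\<Prod>i<Suc k. p ^ d - p ^ i) \<le> (\<Sum>x\<in>?T k. card (U - lspan {..<k} x))"
    using Suc.IH sum_bounded_below[of "?T k" "p ^ d - p ^ k" "\<lambda>x. card (U - lspan {..<k} x)"]
    by simp (meson le_trans mult_le_mono1)
  also have "\<dots> = card (Sigma (?T k) (\<lambda>x. U - lspan {..<k} x))"
    using fT fU by simp
  also have "\<dots> \<le> card (?T (Suc k))"
    using card_inj_on_le[OF inj sub fT] .
  finally show ?case .
qed

definition subs :: "nat \<Rightarrow> nat \<Rightarrow> (nat \<Rightarrow> 'a) set set"
  where "subs n d = {U. subsp U \<and> U \<subseteq> vec n \<and> card U = p ^ d}"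

lemma finite_subs: "finite (subs n d)"
  by (rule finite_subset[of _ "Pow (vec n)"]) (auto simp: subs_def finite_vec)

lemma subsD:
  assumes "U \<in> subs n d"
  shows "subsp U" "U \<subseteq> vec n" "card U = p ^ d" "finite U"
  using assms finite_subset[OF _ finite_vec] by (auto simp: subs_def)

lemma lspan_eqI:
  assumes "U \<in> subs n d" "x \<in> zfun {..<d} U" "indep {..<d} x"
  shows "lspan {..<d} x = U"
proof (rule card_subset_eq)
  show "lspan {..<d} x \<subseteq> U"
    by (rule lspan_subset) (use assms subsD in \<open>auto dest: zfun_in\<close>)
qed (use assms subsD card_lspan[of "{..<d}" x] in auto)

text \<open>Count pairs of a subspace and an ordered basis of it: the basis determines the subspace,
  so there are at most as many pairs as \<open>d\<close>-tuples of vectors.\<close>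

lemma card_subs_le: "card (subs n d) * (\<Prod>i<d. p ^ d - p ^ i) \<le> p ^ (n * d)"
proof -
  let ?T = "\<lambda>U. {x \<in> zfun {..<d} U. indep {..<d} x}"
  have "inj_on snd (Sigma (subs n d) ?T)"
  proof (rule inj_onI, clarify)
    fix U x V y
    assume "U \<in> subs n d" "x \<in> zfun {..<d} U" "indep {..<d} x"
      "V \<in> subs n d" "y \<in> zfun {..<d} V" "indep {..<d} y" "snd (U, x) = snd (V, y)"
    then show "U = V \<and> x = y"
      using lspan_eqI[of U n d x] lspan_eqI[of V n d y] by simp
  qed
  moreover have "snd ` Sigma (subs n d) ?T \<subseteq> zfun {..<d} (vec n)"
    using subsD(2) by (force simp: zfun_def)
  ultimately have "card (Sigma (subs n d) ?T) \<le> card (zfun {..<d} (vec n))"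
    by (intro card_inj_on_le finite_zfun finite_vec) auto
  also have "\<dots> = p ^ (n * d)"
    by (simp add: card_zfun card_K power_mult)
  also have "card (Sigma (subs n d) ?T) = (\<Sum>U\<in>subs n d. card (?T U))"
  proof (rule card_SigmaI[OF finite_subs], rule ballI)
    fix U assume "U \<in> subs n d"
    then have "finite (zfun {..<d} U)"
      using subsD(4) by (intro finite_zfun) auto
    then show "finite (?T U)" by simp
  qed
  finally have "(\<Sum>U\<in>subs n d. card (?T U)) \<le> p ^ (n * d)" .
  moreover have "(\<Sum>U\<in>subs n d. \<Prod>i<d. p ^ d - p ^ i) \<le> (\<Sum>U\<in>subs n d. card (?T U))"
    by (intro sum_mono card_indep_tuples_ge[where I = "{..<n}"]) (use subsD in auto)
  ultimately show ?thesis by simp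
qed

text \<open>The summand \<open>1 / 2 ^ Suc d\<close> only makes the induction go through.\<close>

lemma prod_one_minus_ge: "(\<Prod>i<d. 1 - 1 / real p ^ Suc i) \<ge> 1 / 4 + 1 / 2 ^ Suc d" if "d \<ge> 1"
  using that
proof (induction d rule: nat_induct_at_least)
  case base
  have "1 / real p \<le> 1 / 2"
    using p_ge_2 by (intro divide_left_mono) auto
  then show ?case by simp
next
  case (Suc d)
  define t :: real where "t = 1 / 2 ^ Suc d"
  have t: "0 < t" "t \<le> 1 / 4"
    using Suc.hyps power_increasing[of 2 "Suc d" "2::real"] by (auto simp: t_def divide_simps)
  have "1 / real p ^ Suc d \<le> t"
    unfolding t_def using p_ge_2 by (intro divide_left_mono power_mono) auto
  then have "(1 / 4 + t) * (1 - t) \<le> (\<Prod>i<d. 1 - 1 / real p ^ Suc i) * (1 - 1 / real p ^ Suc d)"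
    using Suc.IH t unfolding t_def[symmetric] by (intro mult_mono) auto
  moreover have "1 / 4 + t / 2 \<le> (1 / 4 + t) * (1 - t)"
  proof -
    have "t * t \<le> t * (1 / 4)"
      using t by (intro mult_left_mono) auto
    moreover have "(1 / 4 + t) * (1 - t) = 1 / 4 + t - t / 4 - t * t"
      by (simp add: field_simps)
    ultimately show ?thesis by simp
  qed
  ultimately show ?case
    by (simp add: t_def)
qed

lemma prod_diff_powers:
  "real (\<Prod>i<d. p ^ d - p ^ i) = real p ^ (d * d) * (\<Prod>i<d. 1 - 1 / real p ^ Suc i)"
proof -
  have "real (\<Prod>i<d. p ^ d - p ^ i) = (\<Prod>i<d. real p ^ d * (1 - 1 / real p ^ Suc (d - Suc i)))"
    unfolding of_nat_prod
  proof (intro prod.cong refl)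
    fix i assume "i \<in> {..<d}"
    then have "i < d" by simp
    then have "p ^ i \<le> p ^ d"
      using p_ge_2 by (intro power_increasing) auto
    moreover have "real p ^ d = real p ^ i * real p ^ Suc (d - Suc i)"
      using \<open>i < d\<close> by (simp flip: power_add add: power_Suc[symmetric] Suc_diff_Suc del: power_Suc)
    ultimately show "real (p ^ d - p ^ i) = real p ^ d * (1 - 1 / real p ^ Suc (d - Suc i))"
      using p_ge_2 by (simp add: of_nat_diff field_simps)
  qed
  also have "\<dots> = real p ^ (d * d) * (\<Prod>i<d. 1 - 1 / real p ^ Suc (d - Suc i))"
    by (simp add: prod.distrib power_mult)
  also have "(\<Prod>i<d. 1 - 1 / real p ^ Suc (d - Suc i)) = (\<Prod>i<d. 1 - 1 / real p ^ Suc i)"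
    by (rule prod.nat_diff_reindex)
  finally show ?thesis .
qed

text \<open>The factor 4 bounds the inverse of the product of the \<open>1 - 1 / p ^ i\<close> with
  \<open>i \<ge> 1\<close>, uniformly in \<open>d\<close> and \<open>p\<close>.\<close>

lemma card_subs: "real (card (subs n d)) * real p ^ (d * d) \<le> 4 * real p ^ (n * d)"
proof -
  have "1 / 4 \<le> (\<Prod>i<d. 1 - 1 / real p ^ Suc i)"
  proof (cases "d = 0")
    case False
    have "(0::real) < 1 / 2 ^ Suc d" by simp
    then show ?thesis
      using prod_one_minus_ge[of d] False by linarith
  qed simp
  then have "real (card (subs n d)) * real p ^ (d * d) * (1 / 4)
    \<le> real (card (subs n d)) * real p ^ (d * d) * (\<Prod>i<d. 1 - 1 / real p ^ Suc i)"
    by (intro mult_left_mono) auto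
  also have "\<dots> = real (card (subs n d) * (\<Prod>i<d. p ^ d - p ^ i))"
    unfolding of_nat_mult prod_diff_powers by simp
  also have "\<dots> \<le> real (p ^ (n * d))"
    using card_subs_le of_nat_mono by blast
  finally show ?thesis by simp
qed

text \<open>For \<open>p = 2\<close> the product is \<open>1/2 * 3/4 * 7/8 = 21/64\<close>. The
  sharper constant matters: the mean number of surviving 3-spaces must stay below
  \<open>7/2 * p ^ 3\<close>, and \<open>64/21 < 7/2 < 4\<close>.\<close>

lemma card_subs3: "21 * real (card (subs n 3)) * real p ^ 9 \<le> 64 * real p ^ (3 * n)"
proof -
  have le: "1 / real p ^ k \<le> 1 / 2 ^ k" for k
    using p_ge_2 by (intro divide_left_mono power_mono) auto
  have pos: "0 \<le> 1 - 1 / real p ^ k" for k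
    using p_ge_2 by simp
  have "(1 - 1 / 2 ^ 1) * (1 - 1 / 2 ^ 2) * (1 - 1 / 2 ^ 3) \<le>
    (1 - 1 / real p ^ 1) * (1 - 1 / real p ^ 2) * (1 - 1 / real p ^ 3)"
    by (intro mult_mono mult_nonneg_nonneg diff_left_mono le pos) auto
  then have "21 / 64 \<le> (\<Prod>i<3. 1 - 1 / real p ^ Suc i)"
    by (simp add: numeral_3_eq_3 lessThan_Suc power2_eq_square mult.assoc ac_simps)
  then have "real (card (subs n 3)) * real p ^ 9 * (21 / 64)
    \<le> real (card (subs n 3)) * real p ^ (3 * 3) * (\<Prod>i<3. 1 - 1 / real p ^ Suc i)"
    using mult_left_mono[of "21 / 64" _ "real (card (subs n 3)) * real p ^ 9"] by simp
  also have "\<dots> = real (card (subs n 3) * (\<Prod>i<3. p ^ 3 - p ^ i))"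
    unfolding of_nat_mult prod_diff_powers by simp
  also have "\<dots> \<le> real (p ^ (n * 3))"
    using card_subs_le of_nat_mono by blast
  finally show ?thesis by (simp add: mult.commute)
qed

text \<open>With \<open>m = n - 3\<close> and \<open>q = n - d\<close> this is the failure to be
  avoided: the brackets of some \<open>U\<close> of dimension \<open>d\<close> span at most
  \<open>d - 3\<close> dimensions, because \<open>n - d\<close> independent functionals kill
  them.\<close>

definition degenerate :: "nat \<Rightarrow> nat \<Rightarrow> nat \<Rightarrow> nat \<Rightarrow> (nat \<Rightarrow> nat \<times> nat \<Rightarrow> 'a) set"
  where "degenerate m n d q = (\<Union>(U, F)\<in>subs n d \<times> subs m q.
    {B \<in> fam m n. \<forall>\<mu>\<in>F. \<forall>x\<in>U. \<forall>y\<in>U. evl m n \<mu> B x y = 0})"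

lemma ex_basis_subs:
  assumes "U \<in> subs n d"
  shows "\<exists>x. indep {..<d} x \<and> (\<forall>j<d. x j \<in> U) \<and> lspan {..<d} x = U"
proof -
  obtain d' x where x: "indep {..<d'} x" "\<forall>j<d'. x j \<in> U" "lspan {..<d'} x = U" "card U = p ^ d'"
    using ex_basis[of U "{..<n}"] subsD[OF assms] by auto
  moreover have "d' = d"
    using x(4) subsD(3)[OF assms] p_ge_2 power_inject_exp[of p d' d] by simp
  ultimately show ?thesis by blast
qed

text \<open>Union bound over the pairs of subspaces; 16 is the product of two factors 4 from
  \<open>card_subs\<close>.\<close>

lemma card_degenerate:
  "real (card (degenerate m n d q)) * real p ^ (d * d + q * q + q * (d * (d - 1) div 2))
    \<le> 16 * real p ^ (n * d + m * q) * real (card (fam m n))"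
proof -
  let ?e = "q * (d * (d - 1) div 2)"
  let ?S = "\<lambda>(U, F). {B \<in> fam m n. \<forall>\<mu>\<in>F. \<forall>x\<in>U. \<forall>y\<in>U. evl m n \<mu> B x y = 0}"
  have S: "p ^ ?e * card (?S UF) \<le> card (fam m n)" if UF: "UF \<in> subs n d \<times> subs m q" for UF
  proof -
    obtain U F where UF_eq: "UF = (U, F)" by (cases UF)
    then have U: "U \<in> subs n d" and F: "F \<in> subs m q"
      using UF by auto
    obtain x where x: "indep {..<d} x" "\<forall>j<d. x j \<in> U"
      using ex_basis_subs[OF U] by blast
    obtain \<mu> where \<mu>: "indep {..<q} \<mu>" "\<forall>j<q. \<mu> j \<in> F"
      using ex_basis_subs[OF F] by blast
    let ?V = "{B \<in> fam m n. \<forall>(l, i, j)\<in>{..<q} \<times> pairs d. evl m n (\<mu> l) B (x i) (x j) = 0}"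
    have "?S UF \<subseteq> ?V"
    proof
      fix B assume "B \<in> ?S UF"
      then have B: "B \<in> fam m n" "\<And>\<mu> x y. \<mu> \<in> F \<Longrightarrow> x \<in> U \<Longrightarrow> y \<in> U \<Longrightarrow> evl m n \<mu> B x y = 0"
        by (simp_all add: UF_eq)
      have "evl m n (\<mu> l) B (x i) (x j) = 0" if "l < q" "(i, j) \<in> pairs d" for l i j
        using that x(2) \<mu>(2) by (intro B(2)) (auto simp: pairs_def)
      then show "B \<in> ?V"
        using B(1) by blast
    qed
    then have "card (?S UF) \<le> card ?V"
      using finite_fam by (intro card_mono) simp_all
    moreover have "card (fam m n) = p ^ ?e * card ?V"
      using x(2) \<mu>(2) subsD(2)[OF U] subsD(2)[OF F] by (intro card_vanishing_on_basis x(1) \<mu>(1)) blast+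
    ultimately show ?thesis
      by simp
  qed
  have "real (card (degenerate m n d q)) * real p ^ ?e \<le> real (card (subs n d)) * real (card (subs m q)) * real (card (fam m n))"
  proof -
    have "p ^ ?e * card (degenerate m n d q) \<le> p ^ ?e * (\<Sum>UF\<in>subs n d \<times> subs m q. card (?S UF))"
      unfolding degenerate_def by (intro mult_le_mono2 card_UN_le) (auto simp: finite_subs)
    also have "\<dots> \<le> (\<Sum>UF\<in>subs n d \<times> subs m q. card (fam m n))"
      unfolding sum_distrib_left by (intro sum_mono S)
    also have "\<dots> = card (subs n d) * card (subs m q) * card (fam m n)"
      by (simp add: card_cartesian_product)
    finally have "real (p ^ ?e * card (degenerate m n d q)) \<le> real (card (subs n d) * card (subs m q) * card (fam m n))"
      using of_nat_mono by blast
    then show ?thesis by (simp add: mult.commute)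
  qed
  then have "real (card (degenerate m n d q)) * real p ^ ?e * (real p ^ (d * d) * real p ^ (q * q))
    \<le> (real (card (subs n d)) * real (card (subs m q)) * real (card (fam m n))) * (real p ^ (d * d) * real p ^ (q * q))"
    by (intro mult_right_mono) auto
  also have "\<dots> = (real (card (subs n d)) * real p ^ (d * d)) * (real (card (subs m q)) * real p ^ (q * q)) * real (card (fam m n))"
    by (simp add: ac_simps)
  also have "\<dots> \<le> (4 * real p ^ (n * d)) * (4 * real p ^ (m * q)) * real (card (fam m n))"
    by (intro mult_right_mono mult_mono card_subs) auto
  finally show ?thesis
    by (simp add: power_add ac_simps)
qed

section \<open>Forms vanishing on prescribed pairs of vectors\<close>

lemma dot_dual_comb:
  assumes "finite I" "dual n I x \<xi>" "I' \<subseteq> I" "\<alpha> \<in> zfun I' K" "i \<in> I"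
  shows "dot n (\<xi> i) (comb I' \<alpha> x) = \<alpha> i"
proof -
  have "dot n (\<xi> i) (comb I' \<alpha> x) = (\<Sum>j\<in>I'. if j = i then \<alpha> j * u else 0)"
    unfolding dot_comb_right using assms by (intro sum.cong refl) (auto simp: dual_dot subset_iff)
  also have "\<dots> = (if i \<in> I' then \<alpha> i * u else 0)"
    using assms finite_subset by (subst sum.delta) auto
  finally show ?thesis
    using assms(4) by (auto simp: zfun_def mult_u)
qed

text \<open>Forms are alternating, so loops and reversed pairs would give trivial or repeated
  conditions. In their absence the wedges of dual vectors are independent witnesses.\<close>

lemma card_pairs_kernel:
  assumes "finite I" "dual n I x \<xi>" "P \<subseteq> I \<times> I"
    and "\<And>i j. (i, j) \<in> P \<Longrightarrow> i \<noteq> j \<and> (j, i) \<notin> P"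
  shows "card (mats n) = p ^ card P * card {f \<in> mats n. \<forall>(i, j)\<in>P. ev n f (x i) (x j) = 0}"
proof -
  let ?l = "\<lambda>t f. ev n f (x (fst t)) (x (snd t))"
  let ?D = "\<lambda>t c. smul c (tens (\<xi> (fst t)) (\<xi> (snd t)))"
  have "card (mats n) = p ^ card P * card {f \<in> mats n. \<forall>t\<in>P. ?l t f = 0}"
  proof (rule card_kernels[where D = ?D])
    show "finite P"
      using assms(1,3) finite_subset by blast
    show "?l s (?D t c) = (if s = t then c else 0)"
      if "s \<in> P" "t \<in> P" "c \<in> K" for s t c
    proof -
      obtain k l i j where st: "s = (k, l)" "t = (i, j)"
        by (metis surj_pair)
      have "ev n (tens (\<xi> i) (\<xi> j)) (x k) (x l) = (if (i, j) = (k, l) then u else 0)"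
      proof (rule ev_tens_dual[OF assms(2)])
        show "(l, k) \<noteq> (i, j)"
          using that assms(4)[of k l] by (auto simp: st)
        show "i \<in> I" "j \<in> I" "k \<in> I" "l \<in> I" "i \<noteq> j" "k \<noteq> l"
          using that assms(3) assms(4)[of k l] assms(4)[of i j] by (auto simp: st)
      qed
      then show ?thesis
        using that(3) by (simp add: st ev_smul mult_u)
    qed
  next
    show "?D t c \<in> mats n" if "t \<in> P" "c \<in> K" for t c
    proof (cases t)
      case (Pair i j)
      then have "i \<in> I" "j \<in> I"
        using that assms(3) by auto
      then show ?thesis
        using Pair smul_in_vec[OF that(2) tens_in] dual_in[OF assms(2)] by simp
    qed
  qed (simp_all add: ev_diff ev_in diff_in_vec split_beta)
  then show ?thesis
    by (simp add: split_def)
qed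

text \<open>The value on the two combinations involves the coordinate at \<open>(a, b)\<close> with
  the minor as coefficient, and \<open>P\<close> leaves that coordinate free. A multiple of the
  wedge of \<open>\<xi> a\<close> and \<open>\<xi> b\<close> is therefore a witness for the new
  condition that respects the old ones.\<close>

lemma card_pairs_kernel_minor:
  assumes I: "finite I" "dual n I x \<xi>" "P \<subseteq> I \<times> I"
    and P: "\<And>i j. (i, j) \<in> P \<Longrightarrow> i \<noteq> j \<and> (j, i) \<notin> P"
    and ab: "a \<in> I" "b \<in> I" "a \<noteq> b" "(a, b) \<notin> P" "(b, a) \<notin> P"
    and "\<alpha> \<in> zfun I K" "\<beta> \<in> zfun I K" "\<alpha> a * \<beta> b - \<beta> a * \<alpha> b \<noteq> 0"
  shows "card (mats n) = p ^ (card P + 1) * card {f \<in> mats n. (\<forall>(i, j)\<in>P. ev n f (x i) (x j) = 0) \<and>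
    ev n f (comb I \<alpha> x) (comb I \<beta> x) = 0}"
proof -
  let ?Z = "{f \<in> mats n. \<forall>(i, j)\<in>P. ev n f (x i) (x j) = 0}"
  let ?l = "\<lambda>f. ev n f (comb I \<alpha> x) (comb I \<beta> x)"
  have "\<alpha> a * \<beta> b - \<beta> a * \<alpha> b \<in> K"
    using assms(10,11) ab by (auto intro!: diff_in mult_in dest: zfun_in)
  then obtain w where w: "w \<in> K" "(\<alpha> a * \<beta> b - \<beta> a * \<alpha> b) * w = u"
    using ex_inverse assms(12) by blast
  have T: "tens (\<xi> a) (\<xi> b) \<in> mats n"
    using tens_in dual_in[OF I(2)] ab by blast
  have "card ?Z = p * card {f \<in> ?Z. ?l f = 0}"
  proof (rule card_kernel[where D = "\<lambda>c. smul (c * w) (tens (\<xi> a) (\<xi> b))"])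
    fix c assume c: "c \<in> K"
    have "ev n (tens (\<xi> a) (\<xi> b)) (x i) (x j) = 0" if "(i, j) \<in> P" for i j
    proof -
      have "ev n (tens (\<xi> a) (\<xi> b)) (x i) (x j) = (if (a, b) = (i, j) then u else 0)"
        using that I(3) P[OF that] ab by (intro ev_tens_dual[OF I(2)]) auto
      then show ?thesis
        using that ab by auto
    qed
    moreover have "smul (c * w) (tens (\<xi> a) (\<xi> b)) \<in> mats n"
      by (intro smul_in_vec mult_in c T)
    ultimately show "smul (c * w) (tens (\<xi> a) (\<xi> b)) \<in> ?Z"
      by (auto simp: ev_smul)
    have "ev n (tens (\<xi> a) (\<xi> b)) (comb I \<alpha> x) (comb I \<beta> x) = \<alpha> a * \<beta> b - \<beta> a * \<alpha> b"
      unfolding ev_tens using dot_dual_comb[OF I(1,2) subset_refl] assms(10,11) ab by simp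
    then have "?l (smul (c * w) (tens (\<xi> a) (\<xi> b))) = c * ((\<alpha> a * \<beta> b - \<beta> a * \<alpha> b) * w)"
      unfolding ev_smul by (simp only: ac_simps)
    then show "?l (smul (c * w) (tens (\<xi> a) (\<xi> b))) = c"
      using w(2) mult_u[OF c] by simp
  qed (simp_all add: ev_diff ev_in diff_in_vec split_beta)
  moreover have "card (mats n) = p ^ card P * card ?Z"
    by (rule card_pairs_kernel[OF I P])
  moreover have "{f \<in> ?Z. ?l f = 0} = {f \<in> mats n. (\<forall>(i, j)\<in>P. ev n f (x i) (x j) = 0) \<and> ?l f = 0}"
    by auto
  ultimately show ?thesis by simp
qed

text \<open>The condition on \<open>y\<close> and \<open>z\<close> is one more pair. For the other
  two, take \<open>a\<close> with \<open>\<alpha> a \<noteq> 0\<close>: the wedges of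
  \<open>\<xi> a\<close> with \<open>\<xi> y\<close> and with \<open>\<xi> z\<close> vanish on all
  pairs of \<open>P\<close>, since \<open>y\<close> and \<open>z\<close> lie outside
  \<open>I\<close>, and each violates only its own condition.\<close>

lemma card_pairs_kernel_extension:
  assumes I: "finite I" "dual n (insert y (insert z I)) x \<xi>" "P \<subseteq> I \<times> I"
    and P: "\<And>i j. (i, j) \<in> P \<Longrightarrow> i \<noteq> j \<and> (j, i) \<notin> P"
    and yz: "y \<notin> I" "z \<notin> I" "y \<noteq> z"
    and \<alpha>: "\<alpha> \<in> zfun I K" "\<alpha> \<noteq> 0"
  shows "card (mats n) = p ^ (card P + 3) * card {f \<in> mats n. (\<forall>(i, j)\<in>P. ev n f (x i) (x j) = 0) \<and>
    ev n f (comb I \<alpha> x) (x y) = 0 \<and> ev n f (comb I \<alpha> x) (x z) = 0 \<and> ev n f (x y) (x z) = 0}"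
proof -
  let ?v = "comb I \<alpha> x"
  let ?I = "insert y (insert z I)"
  let ?P = "insert (y, z) P"
  let ?Z = "{f \<in> mats n. \<forall>(i, j)\<in>?P. ev n f (x i) (x j) = 0}"
  let ?Z2 = "{f \<in> ?Z. ev n f ?v (x y) = 0}"
  obtain a where a: "a \<in> I" "\<alpha> a \<noteq> 0" "\<alpha> a \<in> K"
    using \<alpha> by (auto simp: zfun_def fun_eq_iff)
  then obtain w where w: "w \<in> K" "\<alpha> a * w = u"
    using ex_inverse by blast
  have fI: "finite ?I"
    using I(1) by simp
  have finP: "finite P"
    using I(1,3) finite_subset by blast
  have yzP: "(y, z) \<notin> P"
    using I(3) yz by auto
  have P': "i \<noteq> j \<and> (j, i) \<notin> ?P" if "(i, j) \<in> ?P" for i j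
    using that P[of i j] I(3) yz by auto
  have sub: "?P \<subseteq> ?I \<times> ?I"
    using I(3) by auto
  have dv: "dot n (\<xi> i) ?v = \<alpha> i" if "i \<in> ?I" for i
    by (rule dot_dual_comb[OF fI I(2) _ \<alpha>(1) that]) auto
  have D_in: "smul (c * w) (tens (\<xi> a) (\<xi> t)) \<in> ?Z" if "c \<in> K" "t = y \<or> t = z" for c t
  proof -
    have "ev n (tens (\<xi> a) (\<xi> t)) (x i) (x j) = 0" if "(i, j) \<in> ?P" for i j
    proof -
      have "ev n (tens (\<xi> a) (\<xi> t)) (x i) (x j) = (if (a, t) = (i, j) then u else 0)"
        using that I(3) P'[OF that] a yz \<open>t = y \<or> t = z\<close> by (intro ev_tens_dual[OF I(2)]) auto
      then show ?thesis
        using that I(3) a yz \<open>t = y \<or> t = z\<close> by auto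
    qed
    moreover have "tens (\<xi> a) (\<xi> t) \<in> mats n"
      using that a dual_in[OF I(2)] by (intro tens_in) auto
    then have "smul (c * w) (tens (\<xi> a) (\<xi> t)) \<in> mats n"
      by (intro smul_in_vec mult_in that)
    ultimately show ?thesis
      by (auto simp: ev_smul)
  qed
  have evt: "ev n (tens (\<xi> a) (\<xi> t)) ?v (x s) = (if s = t then \<alpha> a else 0)"
    if "s = y \<or> s = z" "t = y \<or> t = z" for s t
  proof -
    have "dot n (\<xi> t) ?v = 0"
      using dv[of t] zfun_out[OF \<alpha>(1), of t] that(2) yz by fastforce
    moreover have "dot n (\<xi> a) ?v = \<alpha> a"
      using dv[of a] a(1) by simp
    moreover have "dot n (\<xi> t) (x s) = (if t = s then u else 0)"
      by (rule dual_dot[OF I(2)]) (use that in auto)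
    ultimately show ?thesis
      unfolding ev_tens using mult_u[OF a(3)] by simp
  qed
  have scal: "c * w * \<alpha> a = c" if "c \<in> K" for c
  proof -
    have "c * w * \<alpha> a = c * (\<alpha> a * w)"
      by (simp add: ac_simps)
    then show ?thesis
      using w(2) mult_u[OF that] by simp
  qed
  have "card ?Z2 = p * card {f \<in> ?Z2. ev n f ?v (x z) = 0}"
  proof (rule card_kernel[where D = "\<lambda>c. smul (c * w) (tens (\<xi> a) (\<xi> z))"])
    fix c assume c: "c \<in> K"
    show "smul (c * w) (tens (\<xi> a) (\<xi> z)) \<in> ?Z2"
      using D_in[OF c, of z] evt[of y z] yz by (simp add: ev_smul)
    show "ev n (smul (c * w) (tens (\<xi> a) (\<xi> z))) ?v (x z) = c"
      using evt[of z z] scal[OF c] by (simp add: ev_smul)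
  qed (simp_all add: ev_diff ev_in diff_in_vec split_beta)
  moreover have "card ?Z = p * card ?Z2"
  proof (rule card_kernel[where D = "\<lambda>c. smul (c * w) (tens (\<xi> a) (\<xi> y))"])
    fix c assume c: "c \<in> K"
    show "smul (c * w) (tens (\<xi> a) (\<xi> y)) \<in> ?Z"
      using D_in[OF c, of y] by blast
    show "ev n (smul (c * w) (tens (\<xi> a) (\<xi> y))) ?v (x y) = c"
      using evt[of y y] scal[OF c] by (simp add: ev_smul)
  qed (simp_all add: ev_diff ev_in diff_in_vec split_beta)
  moreover have "card (mats n) = p ^ card ?P * card ?Z"
    by (rule card_pairs_kernel[OF fI I(2) sub P'])
  moreover have "{f \<in> ?Z2. ev n f ?v (x z) = 0} = {f \<in> mats n. (\<forall>(i, j)\<in>P. ev n f (x i) (x j) = 0) \<and>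
    ev n f ?v (x y) = 0 \<and> ev n f ?v (x z) = 0 \<and> ev n f (x y) (x z) = 0}"
    by auto
  ultimately show ?thesis
    using finP yzP by (simp add: power_add power3_eq_cube ac_simps)
qed

section \<open>Reindexing, direct sums and annihilators\<close>

lemma indep_reindex:
  assumes "inj_on h I" "finite I"
  shows "indep (h ` I) x \<longleftrightarrow> indep I (x \<circ> h)" "lspan (h ` I) x = lspan I (x \<circ> h)"
proof -
  have c: "comb (h ` I) \<alpha> x = comb I (\<alpha> \<circ> h) (x \<circ> h)" for \<alpha>
    by (simp add: comb_def sum.reindex[OF assms(1)])
  have fwd: "\<exists>\<beta>\<in>zfun I K. comb (h ` I) \<alpha> x = comb I \<beta> (x \<circ> h) \<and> (\<forall>i\<in>I. \<beta> i = \<alpha> (h i))"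
    if "\<alpha> \<in> zfun (h ` I) K" for \<alpha>
  proof (intro bexI conjI)
    show "comb (h ` I) \<alpha> x = comb I (\<lambda>i. if i \<in> I then \<alpha> (h i) else 0) (x \<circ> h)"
      unfolding c by (rule comb_cong) auto
  qed (use that in \<open>auto simp: zfun_def\<close>)
  have bwd: "\<exists>\<alpha>\<in>zfun (h ` I) K. comb (h ` I) \<alpha> x = comb I \<beta> (x \<circ> h) \<and> (\<forall>i\<in>I. \<beta> i = \<alpha> (h i))"
    if "\<beta> \<in> zfun I K" for \<beta>
  proof (intro bexI conjI)
    let ?\<alpha> = "\<lambda>j. if j \<in> h ` I then \<beta> (inv_into I h j) else 0"
    show "comb (h ` I) ?\<alpha> x = comb I \<beta> (x \<circ> h)"
      unfolding c by (rule comb_cong) (use assms in auto)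
    show "?\<alpha> \<in> zfun (h ` I) K"
      using that by (auto simp: zfun_def inv_into_into)
    show "\<forall>i\<in>I. \<beta> i = ?\<alpha> (h i)"
      using assms by auto
  qed
  show "lspan (h ` I) x = lspan I (x \<circ> h)"
    unfolding lspan_def using fwd bwd by (auto simp: image_iff) metis+
  show "indep (h ` I) x \<longleftrightarrow> indep I (x \<circ> h)"
  proof
    assume *: "indep (h ` I) x"
    show "indep I (x \<circ> h)"
      unfolding indep_def
    proof (intro ballI impI)
      fix \<beta> assume \<beta>: "\<beta> \<in> zfun I K" "comb I \<beta> (x \<circ> h) = 0"
      obtain \<alpha> where \<alpha>: "\<alpha> \<in> zfun (h ` I) K" "comb (h ` I) \<alpha> x = 0" "\<forall>i\<in>I. \<beta> i = \<alpha> (h i)"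
        using bwd[OF \<beta>(1)] \<beta>(2) by metis
      then have "\<alpha> = 0"
        using * indepD by blast
      then show "\<beta> = 0"
        using \<alpha>(3) \<beta>(1) by (auto simp: zfun_def fun_eq_iff)
    qed
  next
    assume *: "indep I (x \<circ> h)"
    show "indep (h ` I) x"
      unfolding indep_def
    proof (intro ballI impI)
      fix \<alpha> assume \<alpha>: "\<alpha> \<in> zfun (h ` I) K" "comb (h ` I) \<alpha> x = 0"
      obtain \<beta> where \<beta>: "\<beta> \<in> zfun I K" "comb I \<beta> (x \<circ> h) = 0" "\<forall>i\<in>I. \<beta> i = \<alpha> (h i)"
        using fwd[OF \<alpha>(1)] \<alpha>(2) by metis
      then have "\<beta> = 0"
        using * indepD by blast
      then have "\<alpha> j = 0" for j
        using \<beta>(3) zfun_out[OF \<alpha>(1), of j] by (cases "j \<in> h ` I") auto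
      then show "\<alpha> = 0"
        by (simp add: fun_eq_iff)
    qed
  qed
qed

lemma comb_Un:
  "finite I \<Longrightarrow> finite I' \<Longrightarrow> I \<inter> I' = {} \<Longrightarrow> comb (I \<union> I') \<alpha> x = comb I \<alpha> x + comb I' \<alpha> x"
  by (simp add: comb_def fun_eq_iff sum.union_disjoint)

lemma comb_restrict: "comb I (\<lambda>i. if i \<in> I then \<alpha> i else 0) x = comb I \<alpha> x"
  by (rule comb_cong) auto

lemma restrict_zfun: "(\<And>i. i \<in> I \<Longrightarrow> \<alpha> i \<in> K) \<Longrightarrow> (\<lambda>i. if i \<in> I then \<alpha> i else 0) \<in> zfun I K"
  by (simp add: zfun_def)

lemma indep_comb_zero:
  assumes "indep I x" "\<And>i. i \<in> I \<Longrightarrow> \<alpha> i \<in> K" "comb I \<alpha> x = 0" "i \<in> I"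
  shows "\<alpha> i = 0"
proof -
  have "(\<lambda>i. if i \<in> I then \<alpha> i else 0) = 0"
    using assms(2,3) by (intro indepD[OF assms(1) restrict_zfun]) (simp_all add: comb_restrict)
  from fun_cong[OF this, of i] show ?thesis
    using assms(4) by simp
qed

lemma indep_Un:
  assumes "finite I" "finite I'" "I \<inter> I' = {}" "indep I x" "indep I' x" "lspan I x \<inter> lspan I' x \<subseteq> {0}"
  shows "indep (I \<union> I') x"
  unfolding indep_def
proof (intro ballI impI)
  fix \<alpha> assume \<alpha>: "\<alpha> \<in> zfun (I \<union> I') K" "comb (I \<union> I') \<alpha> x = 0"
  have eq: "comb I \<alpha> x + comb I' \<alpha> x = 0"
    using \<alpha>(2) comb_Un[OF assms(1-3)] by metis
  have K: "\<alpha> i \<in> K" if "i \<in> I \<union> I'" for i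
    using \<alpha>(1) that by (auto simp: zfun_def)
  have "comb I \<alpha> x = comb I' (- \<alpha>) x"
    using eq by (simp add: comb_def fun_eq_iff sum_negf eq_neg_iff_add_eq_0)
  moreover have "comb I' (- \<alpha>) x \<in> lspan I' x" "comb I \<alpha> x \<in> lspan I x"
    by (auto intro!: comb_in_lspan uminus_in K)
  ultimately have 0: "comb I \<alpha> x = 0"
    using assms(6) by auto
  then have null': "comb I' \<alpha> x = 0"
    using eq by simp
  have "\<alpha> i = 0" if "i \<in> I \<union> I'" for i
    using that indep_comb_zero[OF assms(4) _ 0, of i] indep_comb_zero[OF assms(5) _ null', of i] K by auto
  then show "\<alpha> = 0"
    using \<alpha>(1) by (auto simp: zfun_def fun_eq_iff)
qed

lemma indep_Un_Int_lspan:
  assumes "finite I" "finite I'" "I \<inter> I' = {}" "indep (I \<union> I') x"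
  shows "lspan I x \<inter> lspan I' x \<subseteq> {0}"
proof
  fix v assume "v \<in> lspan I x \<inter> lspan I' x"
  then obtain \<alpha> \<beta> where *: "\<alpha> \<in> zfun I K" "v = comb I \<alpha> x" "\<beta> \<in> zfun I' K" "v = comb I' \<beta> x"
    by (auto simp: lspan_def)
  have "comb I (\<alpha> - \<beta>) x = v" 
    unfolding *(2) by (rule comb_cong) (use *(3) assms(3) in \<open>auto simp: zfun_def\<close>)
  moreover have "comb I' (\<alpha> - \<beta>) x = comb I' (- \<beta>) x"
    by (rule comb_cong) (use *(1) assms(3) in \<open>auto simp: zfun_def\<close>)
  moreover have "comb I' (- \<beta>) x = - v"
    unfolding *(4) by (simp add: comb_def fun_eq_iff sum_negf)
  ultimately have "comb (I \<union> I') (\<alpha> - \<beta>) x = 0"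
    by (simp add: comb_Un[OF assms(1-3)])
  moreover have "\<alpha> - \<beta> \<in> zfun (I \<union> I') K"
    using *(1,3) zero_in by (auto simp: zfun_def intro!: diff_in)
  ultimately have "\<alpha> - \<beta> = 0"
    using indepD assms(4) by blast
  then have "\<alpha> i = 0" if "i \<in> I" for i
    using that *(3) assms(3) by (auto simp: zfun_def fun_eq_iff)
  then show "v \<in> {0}"
    unfolding *(2) by (simp add: comb_def fun_eq_iff)
qed

text \<open>Extend a basis of \<open>E\<close> to one of the whole space. The members of its dual
  basis from index \<open>k\<close> on vanish on \<open>E\<close>, whose dimension is at most
  \<open>k\<close>.\<close>

lemma annihilator:
  assumes "subsp E" "E \<subseteq> vec m" "card E \<le> p ^ k" "k \<le> m"
  shows "\<exists>F\<in>subs m (m - k). \<forall>\<mu>\<in>F. \<forall>e\<in>E. dot m \<mu> e = 0"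
proof -
  obtain d y where y: "indep {..<d} y" "\<forall>j<d. y j \<in> E" "lspan {..<d} y = E" "card E = p ^ d"
    using ex_basis[OF assms(1,2)] by auto
  have "d \<le> k"
    using assms(3) y(4) p_ge_2 power_le_imp_le_exp[of p d k] by simp
  obtain m' z where z: "\<forall>j<d. z j = y j" "indep {..<m'} z" "\<forall>j<m'. z j \<in> vec m" "lspan {..<m'} z = vec m"
    using basis_extension[OF subsp_vec subset_refl _ y(1), of "{..<m}"] y(2) assms(2) by blast
  have "p ^ m' = p ^ m"
    using card_lspan[OF _ z(2)] z(4) by (simp add: card_vec)
  then have [simp]: "m' = m"
    using p_ge_2 power_inject_exp[of p m' m] by simp
  obtain \<xi> where \<xi>: "dual m {..<m} z \<xi>"
    using ex_dual[of "{..<m}" z m] z by auto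
  define \<mu> where "\<mu> = (\<lambda>l. \<xi> (k + l))"
  \<comment> \<open>Biorthogonality is symmetric: here the \<open>z\<close> certify that the chosen
    dual vectors are independent.\<close>
  have "dual m {..<m - k} \<mu> (\<lambda>l. z (k + l))"
    unfolding dual_def
  proof (intro ballI conjI)
    fix i assume i: "i \<in> {..<m - k}"
    then show "z (k + i) \<in> vec m"
      using z(3) by simp
    fix j assume j: "j \<in> {..<m - k}"
    have "dot m (z (k + i)) (\<mu> j) = dot m (\<mu> j) (z (k + i))"
      by (simp add: dot_def mult.commute)
    then show "dot m (z (k + i)) (\<mu> j) = (if i = j then u else 0)"
      using i j dual_dot[OF \<xi>, of "k + j" "k + i"] by (simp add: \<mu>_def)
  qed
  then have ind: "indep {..<m - k} \<mu>"
    using dual_imp_indep by blast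
  have \<mu>_in: "\<mu> l \<in> vec m" if "l \<in> {..<m - k}" for l
    using that dual_in[OF \<xi>] by (auto simp: \<mu>_def)
  have "lspan {..<m - k} \<mu> \<in> subs m (m - k)"
    unfolding subs_def using subsp_lspan card_lspan[OF _ ind] lspan_subset[OF subsp_vec \<mu>_in, of "{..<m - k}"]
    by simp
  moreover have "dot m v e = 0" if v: "v \<in> lspan {..<m - k} \<mu>" and e: "e \<in> E" for v e
  proof -
    obtain \<alpha> where \<alpha>: "v = comb {..<m - k} \<alpha> \<mu>"
      using v by (auto simp: lspan_def)
    obtain \<beta> where \<beta>: "e = comb {..<d} \<beta> y"
      using e[folded y(3)] by (auto simp: lspan_def)
    have "dot m (\<mu> l) (y j) = 0" if "l < m - k" "j < d" for l j
      using that z(1) dual_dot[OF \<xi>, of "k + l" j] \<open>d \<le> k\<close> by (simp add: \<mu>_def)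
    then show ?thesis
      by (simp add: \<alpha> \<beta> dot_comb_left dot_comb_right)
  qed
  ultimately show ?thesis by blast
qed

subsection \<open>Dependencies between isotropic 3-spaces\<close>

definition isotropic :: "nat \<Rightarrow> (nat \<times> nat \<Rightarrow> 'a) \<Rightarrow> (nat \<Rightarrow> 'a) set \<Rightarrow> bool"
  where "isotropic n f U \<longleftrightarrow> (\<forall>x\<in>U. \<forall>y\<in>U. ev n f x y = 0)"

definition basis3 :: "(nat \<Rightarrow> 'a) set \<Rightarrow> nat \<Rightarrow> nat \<Rightarrow> 'a"
  where "basis3 U = (SOME x. indep {..<3} x \<and> (\<forall>j<3. x j \<in> U) \<and> lspan {..<3} x = U)"

definition block_vec :: "(nat \<Rightarrow> 'a) set \<times> nat \<Rightarrow> nat \<Rightarrow> 'a"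
  where "block_vec = (\<lambda>(U, i). basis3 U i)"

abbreviation blocks :: "(nat \<Rightarrow> 'a) set set \<Rightarrow> ((nat \<Rightarrow> 'a) set \<times> nat) set"
  where "blocks J \<equiv> J \<times> {..<3}"

text \<open>The sum of the members of \<open>J\<close> is direct. Concatenating chosen bases,
  indexed by subspace and position, reduces this to independence of one family of vectors.\<close>

definition jointly_indep :: "(nat \<Rightarrow> 'a) set set \<Rightarrow> bool"
  where "jointly_indep J \<longleftrightarrow> indep (blocks J) block_vec"

text \<open>The three coordinates of a form inside each block; those across two blocks stay free,
  which \<open>plane_dep\<close> exploits.\<close>

definition block_pairs :: "(nat \<Rightarrow> 'a) set set \<Rightarrow> (((nat \<Rightarrow> 'a) set \<times> nat) \<times> ((nat \<Rightarrow> 'a) set \<times> nat)) set"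
  where "block_pairs J = (\<lambda>(U, i, j). ((U, i), (U, j))) ` (J \<times> pairs 3)"

lemma basis3:
  assumes "U \<in> subs n 3"
  shows "indep {..<3} (basis3 U)" "j < 3 \<Longrightarrow> basis3 U j \<in> U" "lspan {..<3} (basis3 U) = U"
  using someI_ex[OF ex_basis_subs[OF assms]] unfolding basis3_def by auto

lemma ev_zero_lspan:
  assumes "\<And>i j. (i, j) \<in> pairs d \<Longrightarrow> ev n f (x i) (x j) = 0" "v \<in> lspan {..<d} x" "w \<in> lspan {..<d} x"
  shows "ev n f v w = 0"
proof -
  obtain \<alpha> \<beta> where vw: "v = comb {..<d} \<alpha> x" "w = comb {..<d} \<beta> x"
    using assms(2,3) unfolding lspan_def by blast
  have "ev n f (x i) (x j) = 0" if "i < d" "j < d" for i j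
  proof (cases i j rule: linorder_cases)
    case less
    then show ?thesis using assms(1)[of i j] that by (simp add: pairs_def)
  next
    case equal
    then show ?thesis by (simp add: ev_self)
  next
    case greater
    then show ?thesis using assms(1)[of j i] that ev_swap[of n f "x i" "x j"] by (simp add: pairs_def)
  qed
  then show ?thesis
    by (simp add: vw ev_comb_left ev_comb_right)
qed

lemma isotropic_iff:
  assumes "U \<in> subs n 3"
  shows "isotropic n f U \<longleftrightarrow> (\<forall>(i, j)\<in>pairs 3. ev n f (basis3 U i) (basis3 U j) = 0)"
proof
  show "isotropic n f U \<Longrightarrow> \<forall>(i, j)\<in>pairs 3. ev n f (basis3 U i) (basis3 U j) = 0"
    using basis3(2)[OF assms] by (auto simp: isotropic_def pairs_def)
  assume "\<forall>(i, j)\<in>pairs 3. ev n f (basis3 U i) (basis3 U j) = 0"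
  then show "isotropic n f U"
    unfolding isotropic_def using ev_zero_lspan[of 3 n f "basis3 U"] basis3(3)[OF assms] by blast
qed

lemma isotropic_block_pairs_iff:
  assumes "J \<subseteq> subs n 3"
  shows "(\<forall>U\<in>J. isotropic n f U) \<longleftrightarrow> (\<forall>(s, t)\<in>block_pairs J. ev n f (block_vec s) (block_vec t) = 0)"
proof -
  have "(\<forall>(s, t)\<in>block_pairs J. ev n f (block_vec s) (block_vec t) = 0)
    \<longleftrightarrow> (\<forall>U\<in>J. \<forall>(i, j)\<in>pairs 3. ev n f (basis3 U i) (basis3 U j) = 0)"
    by (auto simp: block_pairs_def block_vec_def)
  also have "\<dots> \<longleftrightarrow> (\<forall>U\<in>J. isotropic n f U)"
    using assms isotropic_iff by blast
  finally show ?thesis by simp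
qed

lemma block_pairs_subset: "block_pairs J \<subseteq> blocks J \<times> blocks J"
  by (auto simp: block_pairs_def pairs_def)

lemma block_pairs_asym: "(s, t) \<in> block_pairs J \<Longrightarrow> s \<noteq> t \<and> (t, s) \<notin> block_pairs J"
  by (auto simp: block_pairs_def pairs_def)

lemma block_pairs_fst: "(s, t) \<in> block_pairs J \<Longrightarrow> fst s = fst t"
  by (auto simp: block_pairs_def)

lemma card_block_pairs: "card (block_pairs J) = 3 * card J"
  unfolding block_pairs_def
  by (subst card_image) (auto simp: inj_on_def card_cartesian_product card_pairs)

lemma block_vec_in: "J \<subseteq> subs n 3 \<Longrightarrow> t \<in> blocks J \<Longrightarrow> block_vec t \<in> vec n"
  using basis3(2) subsD(2) by (fastforce simp: block_vec_def)

lemma finite_blocks: "J \<subseteq> subs n 3 \<Longrightarrow> finite (blocks J)"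
  using finite_subset[OF _ finite_subs] by blast

text \<open>The exact independence needed for inclusion-exclusion: in a direct sum all block pairs
  share one dual family, so the three conditions per 3-space are independent.\<close>

lemma card_isotropic:
  assumes "J \<subseteq> subs n 3" "jointly_indep J"
  shows "card (mats n) = p ^ (3 * card J) * card {f \<in> mats n. \<forall>U\<in>J. isotropic n f U}"
proof -
  obtain \<xi> where \<xi>: "dual n (blocks J) block_vec \<xi>"
    using ex_dual[OF finite_blocks[OF assms(1)]] assms(2) block_vec_in[OF assms(1)] unfolding jointly_indep_def by blast
  show ?thesis
    using card_pairs_kernel[OF finite_blocks[OF assms(1)] \<xi> block_pairs_subset block_pairs_asym]
    unfolding isotropic_block_pairs_iff[OF assms(1)] card_block_pairs by blast
qed

text \<open>The indices \<open>({}, 0)\<close> and \<open>({}, 1)\<close> are free for two further vectors, as no subspace is empty.\<close>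

definition ext :: "(nat \<Rightarrow> 'a) \<Rightarrow> (nat \<Rightarrow> 'a) \<Rightarrow> (nat \<Rightarrow> 'a) set \<times> nat \<Rightarrow> nat \<Rightarrow> 'a"
  where "ext y z = (\<lambda>t. if t = ({}, 0) then y else if t = ({}, 1) then z else block_vec t)"

definition ext_index :: "(nat \<Rightarrow> 'a) set set \<Rightarrow> ((nat \<Rightarrow> 'a) set \<times> nat) set"
  where "ext_index J = insert ({}, 0) (insert ({}, 1) (blocks J))"

text \<open>
  Let \<open>J \<union> {U}\<close> be a minimal dependent set of isotropic 3-spaces, so that the span \<open>S\<close> of \<open>J\<close> is a direct
  sum and meets \<open>U\<close>. If \<open>U \<inter> S\<close> is a line, then \<open>U\<close> is spanned by a vector of \<open>S\<close> and two vectors independent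
  modulo \<open>S\<close>, which gives three new linear conditions on each form (\<open>line_dep\<close>). If \<open>U \<inter> S\<close> contains a
  plane and \<open>J\<close> has at least two elements, then the bracket of two vectors of \<open>S\<close> that have a nonzero
  minor across two different blocks is one new condition (\<open>plane_dep\<close>). If \<open>J\<close> is a singleton, then the
  two 3-spaces span a 4-space on which the bracket has rank at most 1.
\<close>

definition line_params :: "nat \<Rightarrow> nat \<Rightarrow> ((nat \<Rightarrow> 'a) set set \<times> ((nat \<Rightarrow> 'a) set \<times> nat \<Rightarrow> 'a) \<times> (nat \<Rightarrow> 'a) \<times> (nat \<Rightarrow> 'a)) set"
  where "line_params n s = {(J, \<alpha>, y, z). J \<subseteq> subs n 3 \<and> card J = s \<and> \<alpha> \<in> zfun (blocks J) K \<and> \<alpha> \<noteq> 0 \<and>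
    y \<in> vec n \<and> z \<in> vec n \<and> indep (ext_index J) (ext y z)}"

definition line_forms :: "nat \<Rightarrow> (nat \<Rightarrow> 'a) set set \<times> ((nat \<Rightarrow> 'a) set \<times> nat \<Rightarrow> 'a) \<times> (nat \<Rightarrow> 'a) \<times> (nat \<Rightarrow> 'a) \<Rightarrow> (nat \<times> nat \<Rightarrow> 'a) set"
  where "line_forms n = (\<lambda>(J, \<alpha>, y, z). {f \<in> mats n. (\<forall>U\<in>J. isotropic n f U) \<and> ev n f (comb (blocks J) \<alpha> block_vec) y = 0 \<and>
    ev n f (comb (blocks J) \<alpha> block_vec) z = 0 \<and> ev n f y z = 0})"

definition line_dep :: "nat \<Rightarrow> nat \<Rightarrow> nat \<Rightarrow> (nat \<Rightarrow> nat \<times> nat \<Rightarrow> 'a) set"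
  where "line_dep m n s = (\<Union>t\<in>line_params n s. zfun {..<m} (line_forms n t))"

definition plane_params :: "nat \<Rightarrow> nat \<Rightarrow> ((nat \<Rightarrow> 'a) set set \<times> ((nat \<Rightarrow> 'a) set \<times> nat \<Rightarrow> 'a) \<times> ((nat \<Rightarrow> 'a) set \<times> nat \<Rightarrow> 'a)) set"
  where "plane_params n s = {(J, \<alpha>, \<beta>). J \<subseteq> subs n 3 \<and> card J = s \<and> jointly_indep J \<and> \<alpha> \<in> zfun (blocks J) K \<and> \<beta> \<in> zfun (blocks J) K \<and>
    (\<exists>a\<in>blocks J. \<exists>b\<in>blocks J. fst a \<noteq> fst b \<and> \<alpha> a * \<beta> b - \<beta> a * \<alpha> b \<noteq> 0)}"

definition plane_forms :: "nat \<Rightarrow> (nat \<Rightarrow> 'a) set set \<times> ((nat \<Rightarrow> 'a) set \<times> nat \<Rightarrow> 'a) \<times> ((nat \<Rightarrow> 'a) set \<times> nat \<Rightarrow> 'a) \<Rightarrow> (nat \<times> nat \<Rightarrow> 'a) set"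
  where "plane_forms n = (\<lambda>(J, \<alpha>, \<beta>). {f \<in> mats n. (\<forall>U\<in>J. isotropic n f U) \<and> ev n f (comb (blocks J) \<alpha> block_vec) (comb (blocks J) \<beta> block_vec) = 0})"

definition plane_dep :: "nat \<Rightarrow> nat \<Rightarrow> nat \<Rightarrow> (nat \<Rightarrow> nat \<times> nat \<Rightarrow> 'a) set"
  where "plane_dep m n s = (\<Union>t\<in>plane_params n s. zfun {..<m} (plane_forms n t))"

section \<open>Counting the dependent configurations\<close>

lemma empty_notin_blocks:
  assumes "J \<subseteq> subs n 3"
  shows "({}, i) \<notin> blocks J"
proof
  assume "({}, i) \<in> blocks J"
  then have "{} \<in> subs n 3"
    using assms by blast
  then show False
    using subsp_zero[OF subsD(1)] by fastforce
qed

lemma ext_simps: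
  "ext y z ({}, 0) = y" "ext y z ({}, 1) = z" "J \<subseteq> subs n 3 \<Longrightarrow> t \<in> blocks J \<Longrightarrow> ext y z t = block_vec t"
  using empty_notin_blocks by (auto simp: ext_def)

lemma card_line_forms:
  assumes "t \<in> line_params n s"
  shows "card (mats n) = p ^ (3 * s + 3) * card (line_forms n t)"
proof -
  obtain J \<alpha> y z where t: "t = (J, \<alpha>, y, z)" by (cases t)
  have J: "J \<subseteq> subs n 3" "card J = s" and \<alpha>: "\<alpha> \<in> zfun (blocks J) K" "\<alpha> \<noteq> 0"
    and yz: "y \<in> vec n" "z \<in> vec n" and ind: "indep (ext_index J) (ext y z)"
    using assms by (auto simp: line_params_def t)
  have "ext y z i \<in> vec n" if "i \<in> ext_index J" for i
    using that yz block_vec_in[OF J(1)] by (auto simp: ext_index_def ext_def)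
  then obtain \<xi> where \<xi>: "dual n (ext_index J) (ext y z) \<xi>"
    using ex_dual[of "ext_index J" "ext y z" n] ind finite_blocks[OF J(1)] by (auto simp: ext_index_def)
  have c: "comb (blocks J) \<alpha> (ext y z) = comb (blocks J) \<alpha> block_vec"
    by (rule comb_cong) (use ext_simps(3)[OF J(1)] in auto)
  have e: "ev n f (ext y z i) (ext y z j) = ev n f (block_vec i) (block_vec j)" if "(i, j) \<in> block_pairs J" for i j f
    using that block_pairs_subset[of J] ext_simps(3)[OF J(1)] by force
  have iff: "(\<forall>(i, j)\<in>block_pairs J. ev n f (ext y z i) (ext y z j) = 0) \<longleftrightarrow> (\<forall>U\<in>J. isotropic n f U)" for f
    unfolding isotropic_block_pairs_iff[OF J(1)] using e by auto
  have "card (mats n) = p ^ (card (block_pairs J) + 3) * card {f \<in> mats n. (\<forall>(i, j)\<in>block_pairs J. ev n f (ext y z i) (ext y z j) = 0) \<and>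
    ev n f (comb (blocks J) \<alpha> (ext y z)) (ext y z ({}, 0)) = 0 \<and> ev n f (comb (blocks J) \<alpha> (ext y z)) (ext y z ({}, 1)) = 0 \<and>
    ev n f (ext y z ({}, 0)) (ext y z ({}, 1)) = 0}"
    by (rule card_pairs_kernel_extension[OF finite_blocks[OF J(1)] \<xi>[unfolded ext_index_def] block_pairs_subset block_pairs_asym
        empty_notin_blocks[OF J(1)] empty_notin_blocks[OF J(1)] _ \<alpha>]) auto
  then show ?thesis
    unfolding iff c ext_simps(1,2) card_block_pairs J(2) by (simp add: line_forms_def t)
qed

lemma card_plane_forms:
  assumes "t \<in> plane_params n s"
  shows "card (mats n) = p ^ (3 * s + 1) * card (plane_forms n t)"
proof -
  obtain J \<alpha> \<beta> where t: "t = (J, \<alpha>, \<beta>)" by (cases t)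
  obtain a b where J: "J \<subseteq> subs n 3" "card J = s" "jointly_indep J" and \<alpha>: "\<alpha> \<in> zfun (blocks J) K" "\<beta> \<in> zfun (blocks J) K"
    and ab: "a \<in> blocks J" "b \<in> blocks J" "fst a \<noteq> fst b" "\<alpha> a * \<beta> b - \<beta> a * \<alpha> b \<noteq> 0"
    using assms unfolding plane_params_def t by blast
  obtain \<xi> where \<xi>: "dual n (blocks J) block_vec \<xi>"
    using ex_dual[OF finite_blocks[OF J(1)]] J(3) block_vec_in[OF J(1)] unfolding jointly_indep_def by blast
  have "a \<noteq> b" "(a, b) \<notin> block_pairs J" "(b, a) \<notin> block_pairs J"
    using ab(3) block_pairs_fst by (blast, metis, metis)
  from card_pairs_kernel_minor[OF finite_blocks[OF J(1)] \<xi> block_pairs_subset block_pairs_asym ab(1,2) this \<alpha> ab(4)]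
  show ?thesis
    unfolding isotropic_block_pairs_iff[OF J(1), symmetric] card_block_pairs J(2) by (simp add: plane_forms_def t)
qed

lemma card_UN_times_le:
  assumes "finite T" "\<And>t. t \<in> T \<Longrightarrow> card (S t) * c \<le> M"
  shows "card (\<Union>t\<in>T. S t) * c \<le> card T * (M::nat)"
proof -
  have "card (\<Union>t\<in>T. S t) * c \<le> (\<Sum>t\<in>T. card (S t) * c)"
    unfolding sum_distrib_right[symmetric] by (intro mult_right_mono card_UN_le assms(1)) simp
  also have "\<dots> \<le> (\<Sum>t\<in>T. M)"
    by (intro sum_mono assms(2))
  finally show ?thesis by simp
qed

lemma card_subsets_le: "finite S \<Longrightarrow> card {J. J \<subseteq> S \<and> card J = s} \<le> card S ^ s"
  using binomial_le_pow[of s "card S"] by (cases "s \<le> card S") (simp_all only: n_subsets binomial_eq_0 not_le)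

lemma finite_card_line_params: "finite (line_params n s)" "card (line_params n s) \<le> card (subs n 3) ^ s * (p ^ (3 * s) * (p ^ n * p ^ n))"
proof -
  let ?Js = "{J. J \<subseteq> subs n 3 \<and> card J = s}"
  let ?T = "Sigma ?Js (\<lambda>J. zfun (blocks J) K \<times> vec n \<times> vec n)"
  have fJ: "finite ?Js"
    using finite_subs by simp
  have fz: "finite (zfun (blocks J) K \<times> vec n \<times> vec n)"
    and cz: "card (zfun (blocks J) K \<times> vec n \<times> vec n) = p ^ (3 * s) * (p ^ n * p ^ n)" if "J \<in> ?Js" for J
  proof -
    have f: "finite (blocks J)"
      using that finite_blocks by blast
    show "finite (zfun (blocks J) K \<times> vec n \<times> vec n)"
      by (intro finite_cartesian_product finite_zfun f finite_K finite_vec)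
    show "card (zfun (blocks J) K \<times> vec n \<times> vec n) = p ^ (3 * s) * (p ^ n * p ^ n)"
      using that by (simp add: card_cartesian_product card_zfun[OF f] card_vec card_K mult.commute)
  qed
  have sub: "line_params n s \<subseteq> ?T"
    by (auto simp: line_params_def)
  have fT: "finite ?T"
    using fJ fz by blast
  show "finite (line_params n s)"
    using finite_subset[OF sub fT] .
  have "card (line_params n s) \<le> card ?T"
    by (rule card_mono[OF fT sub])
  also have "card ?T = (\<Sum>J\<in>?Js. p ^ (3 * s) * (p ^ n * p ^ n))"
    using fJ fz cz by (subst card_SigmaI) auto
  also have "\<dots> = card ?Js * (p ^ (3 * s) * (p ^ n * p ^ n))"
    by simp
  also have "\<dots> \<le> card (subs n 3) ^ s * (p ^ (3 * s) * (p ^ n * p ^ n))"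
    by (intro mult_right_mono card_subsets_le finite_subs) simp
  finally show "card (line_params n s) \<le> card (subs n 3) ^ s * (p ^ (3 * s) * (p ^ n * p ^ n))" .
qed

lemma finite_card_plane_params: "finite (plane_params n s)" "card (plane_params n s) \<le> card (subs n 3) ^ s * (p ^ (3 * s) * p ^ (3 * s))"
proof -
  let ?Js = "{J. J \<subseteq> subs n 3 \<and> card J = s}"
  let ?T = "Sigma ?Js (\<lambda>J. zfun (blocks J) K \<times> zfun (blocks J) K)"
  have fJ: "finite ?Js"
    using finite_subs by simp
  have fz: "finite (zfun (blocks J) K \<times> zfun (blocks J) K)"
    and cz: "card (zfun (blocks J) K \<times> zfun (blocks J) K) = p ^ (3 * s) * p ^ (3 * s)" if "J \<in> ?Js" for J
  proof -
    have f: "finite (blocks J)"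
      using that finite_blocks by blast
    show "finite (zfun (blocks J) K \<times> zfun (blocks J) K)"
      by (intro finite_cartesian_product finite_zfun f finite_K)
    show "card (zfun (blocks J) K \<times> zfun (blocks J) K) = p ^ (3 * s) * p ^ (3 * s)"
      using that by (simp add: card_cartesian_product card_zfun[OF f] card_K mult.commute)
  qed
  have sub: "plane_params n s \<subseteq> ?T"
    by (auto simp: plane_params_def)
  have fT: "finite ?T"
    using fJ fz by blast
  show "finite (plane_params n s)"
    using finite_subset[OF sub fT] .
  have "card (plane_params n s) \<le> card ?T"
    by (rule card_mono[OF fT sub])
  also have "card ?T = (\<Sum>J\<in>?Js. p ^ (3 * s) * p ^ (3 * s))"
    using fJ fz cz by (subst card_SigmaI) auto
  also have "\<dots> = card ?Js * (p ^ (3 * s) * p ^ (3 * s))"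
    by simp
  also have "\<dots> \<le> card (subs n 3) ^ s * (p ^ (3 * s) * p ^ (3 * s))"
    by (intro mult_right_mono card_subsets_le finite_subs) simp
  finally show "card (plane_params n s) \<le> card (subs n 3) ^ s * (p ^ (3 * s) * p ^ (3 * s))" .
qed

text \<open>For \<open>m = n - 4\<close> the density is at most \<open>4 ^ s\<close> times
  \<open>p\<close> to the power \<open>6 * s + 12 - n\<close>: the two new vectors cost
  \<open>p ^ (2 * n)\<close>, but three new conditions on each form gain
  \<open>p ^ (3 * m)\<close>.\<close>

lemma card_line_dep: "real (card (line_dep m n s)) * real p ^ ((3 * s + 3) * m + 9 * s)
  \<le> 4 ^ s * real p ^ (3 * n * s + 3 * s + 2 * n) * real (card (fam m n))"
proof -
  have "card (zfun {..<m} (line_forms n t)) * p ^ ((3 * s + 3) * m) \<le> card (fam m n)" if "t \<in> line_params n s" for t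
    using card_line_forms[OF that] unfolding card_zfun[OF finite_lessThan] card_lessThan power_mult
    by (simp add: power_mult_distrib mult.commute)
  then have "card (line_dep m n s) * p ^ ((3 * s + 3) * m) \<le> card (line_params n s) * card (fam m n)"
    unfolding line_dep_def by (intro card_UN_times_le finite_card_line_params)
  also have "\<dots> \<le> card (subs n 3) ^ s * (p ^ (3 * s) * (p ^ n * p ^ n)) * card (fam m n)"
    by (intro mult_right_mono finite_card_line_params) simp
  finally have "real (card (line_dep m n s) * p ^ ((3 * s + 3) * m)) \<le>
    real (card (subs n 3) ^ s * (p ^ (3 * s) * (p ^ n * p ^ n)) * card (fam m n))"
    by (rule of_nat_mono)
  then have "real (card (line_dep m n s)) * real p ^ ((3 * s + 3) * m) * (real p ^ 9) ^ s \<le>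
    real (card (subs n 3)) ^ s * (real p ^ (3 * s) * (real p ^ n * real p ^ n)) * real (card (fam m n)) * (real p ^ 9) ^ s"
    by (intro mult_right_mono) simp_all
  also have "\<dots> = (real (card (subs n 3)) * real p ^ (3 * 3)) ^ s * (real p ^ (3 * s) * (real p ^ n * real p ^ n)) * real (card (fam m n))"
    by (simp add: power_mult_distrib ac_simps)
  also have "\<dots> \<le> (4 * real p ^ (n * 3)) ^ s * (real p ^ (3 * s) * (real p ^ n * real p ^ n)) * real (card (fam m n))"
    by (intro mult_right_mono power_mono card_subs) auto
  also have "\<dots> = 4 ^ s * real p ^ (3 * n * s + 3 * s + 2 * n) * real (card (fam m n))"
    by (simp add: power_mult_distrib power_add[symmetric] power_mult[symmetric] mult_2 ac_simps)
  finally show ?thesis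
    by (simp add: power_add power_mult[symmetric] ac_simps)
qed

text \<open>Beyond \<open>J\<close>, only coefficients on its \<open>3 * s\<close> basis vectors are
  chosen, at a cost independent of \<open>n\<close>. A single new condition per form, a gain of
  \<open>p ^ m\<close>, therefore suffices once \<open>n\<close> is large compared with
  \<open>s\<close>.\<close>

lemma card_plane_dep: "real (card (plane_dep m n s)) * real p ^ ((3 * s + 1) * m + 9 * s)
  \<le> 4 ^ s * real p ^ (3 * n * s + 6 * s) * real (card (fam m n))"
proof -
  have "card (zfun {..<m} (plane_forms n t)) * p ^ ((3 * s + 1) * m) \<le> card (fam m n)" if "t \<in> plane_params n s" for t
    using card_plane_forms[OF that] unfolding card_zfun[OF finite_lessThan] card_lessThan power_mult
    by (simp add: power_mult_distrib mult.commute)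
  then have "card (plane_dep m n s) * p ^ ((3 * s + 1) * m) \<le> card (plane_params n s) * card (fam m n)"
    unfolding plane_dep_def by (intro card_UN_times_le finite_card_plane_params)
  also have "\<dots> \<le> card (subs n 3) ^ s * (p ^ (3 * s) * p ^ (3 * s)) * card (fam m n)"
    by (intro mult_right_mono finite_card_plane_params) simp
  finally have "real (card (plane_dep m n s) * p ^ ((3 * s + 1) * m)) \<le>
    real (card (subs n 3) ^ s * (p ^ (3 * s) * p ^ (3 * s)) * card (fam m n))"
    by (rule of_nat_mono)
  then have "real (card (plane_dep m n s)) * real p ^ ((3 * s + 1) * m) * (real p ^ 9) ^ s \<le>
    real (card (subs n 3)) ^ s * (real p ^ (3 * s) * real p ^ (3 * s)) * real (card (fam m n)) * (real p ^ 9) ^ s"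
    by (intro mult_right_mono) simp_all
  also have "\<dots> = (real (card (subs n 3)) * real p ^ (3 * 3)) ^ s * (real p ^ (3 * s) * real p ^ (3 * s)) * real (card (fam m n))"
    by (simp add: power_mult_distrib ac_simps)
  also have "\<dots> \<le> (4 * real p ^ (n * 3)) ^ s * (real p ^ (3 * s) * real p ^ (3 * s)) * real (card (fam m n))"
    by (intro mult_right_mono power_mono card_subs) auto
  also have "\<dots> = 4 ^ s * real p ^ (3 * n * s + 6 * s) * real (card (fam m n))"
    by (simp add: power_mult_distrib power_add[symmetric] power_mult[symmetric] ac_simps)
  finally show ?thesis
    by (simp add: power_add power_mult[symmetric] ac_simps)
qed

section \<open>Every dependence falls into a counted configuration\<close>

lemma evl_eq_ev: "evl m n \<mu> B x y = ev n (comb {..<m} \<mu> B) x y"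
proof -
  have "ev n (comb {..<m} \<mu> B) x y = (\<Sum>a<n. \<Sum>b<n. \<Sum>c<m. \<mu> c * (B c (a, b) * (x a * y b - y a * x b)))"
    unfolding ev_def comb_def sum_distrib_right by (simp only: mult.assoc)
  also have "\<dots> = (\<Sum>a<n. \<Sum>c<m. \<Sum>b<n. \<mu> c * (B c (a, b) * (x a * y b - y a * x b)))"
    by (intro sum.cong refl sum.swap)
  also have "\<dots> = (\<Sum>c<m. \<Sum>a<n. \<Sum>b<n. \<mu> c * (B c (a, b) * (x a * y b - y a * x b)))"
    by (rule sum.swap)
  finally show ?thesis
    by (simp add: evl_def dot_def ev_def sum_distrib_left)
qed

lemma indep_nonzero:
  assumes "finite J" "indep J x" "k \<in> J"
  shows "x k \<noteq> 0"
proof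
  assume "x k = 0"
  then have "comb J (\<lambda>j. if j = k then u else 0) x = 0"
    by (auto simp: comb_def fun_eq_iff intro!: sum.neutral)
  then have "(if k = k then u else 0) = 0"
    by (rule indep_comb_zero[OF assms(2), rotated 1]) (use assms u_in zero_in in auto)
  then show False
    using u_nonzero by simp
qed

lemma lspan_empty:
  fixes x :: "'j \<Rightarrow> 'i \<Rightarrow> 'a"
  shows "lspan {} x = {0}"
proof -
  have "comb {} \<alpha> x = 0" for \<alpha>
    by (simp add: comb_def fun_eq_iff)
  moreover have "zfun {} K \<noteq> ({} :: ('j \<Rightarrow> 'a) set)"
    using subsp_zero[OF subsp_vec, of "{}"] by blast
  ultimately show ?thesis
    unfolding lspan_def by (simp add: image_constant_conv)
qed

lemma indep_pair_zero:
  assumes "indep {..<d::nat} r" "2 \<le> d" "c \<in> K" "c' \<in> K" "smul c (r 0) + smul c' (r 1) = 0"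
  shows "c = 0" "c' = 0"
proof -
  let ?\<alpha> = "\<lambda>i::nat. if i = 0 then c else if i = 1 then c' else 0"
  have "comb {..<d} ?\<alpha> r = comb {0, 1} ?\<alpha> r"
    unfolding comb_def by (intro ext sum.mono_neutral_right) (use assms(2) in auto)
  also have "\<dots> = 0"
    using assms(5) by (simp add: comb_def smul_def fun_eq_iff)
  finally have "?\<alpha> i = 0" if "i < d" for i
    using that assms(3,4) zero_in by (intro indep_comb_zero[OF assms(1)]) auto
  from this[of 0] this[of 1] show "c = 0" "c' = 0"
    using assms(2) by auto
qed

lemma ex_extended_basis:
  assumes "U \<in> subs n d" "indep {..<a::nat} r" "\<And>j. j < a \<Longrightarrow> r j \<in> U"
  shows "\<exists>y. a \<le> d \<and> (\<forall>j<a. y j = r j) \<and> indep {..<d} y \<and> (\<forall>j<d. y j \<in> U) \<and> lspan {..<d} y = U"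
proof -
  obtain d' y where y: "a \<le> d'" "\<forall>j<a. y j = r j" "indep {..<d'} y" "\<forall>j<d'. y j \<in> U" "lspan {..<d'} y = U"
    using basis_extension[OF subsD(1,2)[OF assms(1)] finite_lessThan assms(2,3)] by blast
  have "p ^ d' = p ^ d"
    using card_lspan[OF _ y(3)] y(5) subsD(3)[OF assms(1)] by simp
  then have "d' = d"
    using p_ge_2 power_inject_exp[of p d' d] by simp
  then show ?thesis
    using y by blast
qed

text \<open>The intersection is a plane, as \<open>U \<noteq> V\<close>. In the basis
  \<open>r 0\<close>, \<open>r 1\<close>, \<open>y 2\<close>, \<open>y' 2\<close> of the sum of
  \<open>U\<close> and \<open>V\<close>, every pair except the last two vectors lies in
  \<open>U\<close> or in \<open>V\<close>, so one vector \<open>e\<close> of \<open>W\<close> spans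
  all brackets.\<close>

lemma degenerate_4_if_large_intersection:
  assumes U: "U \<in> subs n 3" "V \<in> subs n 3" "U \<noteq> V"
    and B: "B \<in> fam m n" "m \<ge> 1" and iso: "\<And>c. c < m \<Longrightarrow> isotropic n (B c) U \<and> isotropic n (B c) V"
    and r: "indep {..<a::nat} r" "lspan {..<a} r = U \<inter> V" "2 \<le> a" "\<And>j. j < a \<Longrightarrow> r j \<in> U \<inter> V"
  shows "B \<in> degenerate m n 4 (m - 1)"
proof -
  obtain y where y: "a \<le> 3" "\<forall>j<a. y j = r j" "indep {..<3} y" "\<forall>j<3. y j \<in> U" "lspan {..<3} y = U"
    using ex_extended_basis[OF U(1) r(1)] r(4) by blast
  obtain y' where y': "\<forall>j<a. y' j = r j" "indep {..<3} y'" "\<forall>j<3. y' j \<in> V" "lspan {..<3} y' = V"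
    using ex_extended_basis[OF U(2) r(1)] r(4) by blast
  have a2: "a = 2"
  proof (rule ccontr)
    assume "a \<noteq> 2"
    then have "a = 3"
      using r(3) y(1) by simp
    then have "lspan {..<3} y = lspan {..<3} r" "lspan {..<3} y' = lspan {..<3} r"
      using y(2) y'(1) by (auto intro!: lspan_cong)
    then show False
      using U(3) y(5) y'(4) by simp
  qed
  have 3: "{..<3} = insert 2 {..<2::nat}" and 4: "{..<4} = insert 3 {..<3::nat}"
    by auto
  have y'2: "y' 2 \<in> V" "y' 2 \<in> vec n"
    using y'(3) subsD(2)[OF U(2)] by auto
  have "y' 2 \<notin> lspan {..<2} y'"
    using y'(2) y'2 by (intro indep_notin_lspan[where I = "{..<n}"]) (auto simp: 3[symmetric])
  moreover have "lspan {..<2} y' = U \<inter> V"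
    using y'(1) r(2) a2 lspan_cong[of "{..<2}" y' r] by auto
  ultimately have y'2U: "y' 2 \<notin> U"
    using y'2 by blast
  define q where "q = y(3 := y' 2)"
  have qy: "lspan {..<3} q = lspan {..<3} y" "indep {..<3} q"
    using lspan_cong[of "{..<3}" q y] indep_cong[of "{..<3}" q y] y(3) by (auto simp: q_def)
  have ind: "indep {..<4} q"
    unfolding 4 using qy y(5) y'2U y'2 by (intro indep_insert[where I = "{..<n}"]) (auto simp: q_def)
  have qin: "q j \<in> vec n" if "j \<in> {..<4}" for j
    using that y(4) subsD(2)[OF U(1)] y'2(2) by (auto simp: q_def less_Suc_eq numeral_eq_Suc)
  have Q: "lspan {..<4} q \<in> subs n 4"
  proof -
    have "lspan {..<4} q \<subseteq> vec n"
      by (rule lspan_subset[OF subsp_vec qin])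
    then show ?thesis
      unfolding subs_def using subsp_lspan card_lspan[OF _ ind] by simp
  qed
  define e where "e = (\<lambda>c. ev n (B c) (y 2) (y' 2))"
  have e: "e \<in> vec m"
  proof (rule zfunI)
    show "e c \<in> K" if "c \<in> {..<m}" for c
      unfolding e_def using zfun_in[OF B(1) that] by (rule ev_in)
    show "e c = 0" if "c \<notin> {..<m}" for c
      unfolding e_def using zfun_out[OF B(1) that] ev_zero by simp
  qed
  \<comment> \<open>\<open>e\<close> may be 0, so only the upper bound \<open>p\<close> for the size
    of \<open>?E\<close> is available; \<open>annihilator\<close> asks for no more.\<close>
  let ?E = "lspan {0::nat} (\<lambda>_. e)"
  have "card ?E \<le> p ^ 1"
    using card_lspan_le[of "{0::nat}" "\<lambda>_. e"] by simp
  moreover have "?E \<subseteq> vec m"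
    using e by (intro lspan_subset subsp_vec) auto
  ultimately obtain F where F: "F \<in> subs m (m - 1)" "\<forall>\<mu>\<in>F. \<forall>e\<in>?E. dot m \<mu> e = 0"
    using annihilator[OF subsp_lspan _ _ B(2)] by blast
  have eE: "e \<in> ?E"
    using in_lspan[of "{0::nat}" 0 "\<lambda>_. e"] e by auto
  have "evl m n \<mu> B v w = 0" if \<mu>: "\<mu> \<in> F" and vw: "v \<in> lspan {..<4} q" "w \<in> lspan {..<4} q" for \<mu> v w
    unfolding evl_eq_ev
  proof (rule ev_zero_lspan[OF _ vw])
    fix i j :: nat assume ij: "(i, j) \<in> pairs 4"
    show "ev n (comb {..<m} \<mu> B) (q i) (q j) = 0"
    proof (cases "(i, j) = (2, 3)")
      case True
      then show ?thesis
        using F(2) \<mu> eE by (simp add: q_def evl_eq_ev[symmetric] evl_def e_def)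
    next
      case False
      have "(q i \<in> U \<and> q j \<in> U) \<or> (q i \<in> V \<and> q j \<in> V)"
      proof (cases "j < 3")
        case True
        then show ?thesis
          using ij y(4) by (auto simp: pairs_def q_def)
      next
        case False
        then have "j = 3" "i < a"
          using ij \<open>(i, j) \<noteq> (2, 3)\<close> by (auto simp: pairs_def a2)
        then show ?thesis
          using y(2) r(4) y'2(1) a2 by (auto simp: q_def)
      qed
      then have "ev n (B c) (q i) (q j) = 0" if "c < m" for c
        using iso[OF that] by (auto simp: isotropic_def)
      then show ?thesis
        by (simp add: evl_eq_ev[symmetric] evl_def dot_def)
    qed
  qed
  then show ?thesis
    unfolding degenerate_def using Q F(1) B(1) by blast
qed

lemma blocks_single:
  assumes "U \<in> subs n 3"
  shows "indep (blocks {U}) block_vec" "lspan (blocks {U}) block_vec = U"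
proof -
  have eq: "blocks {U} = Pair U ` {..<3}" "block_vec \<circ> Pair U = basis3 U"
    by (auto simp: block_vec_def)
  show "indep (blocks {U}) block_vec" "lspan (blocks {U}) block_vec = U"
    unfolding eq(1) using basis3[OF assms] by (simp_all add: indep_reindex inj_on_def eq(2))
qed

lemma jointly_indep_insert_iff:
  assumes "J \<subseteq> subs n 3" "U \<in> J"
  shows "jointly_indep J \<longleftrightarrow> jointly_indep (J - {U}) \<and> lspan (blocks (J - {U})) block_vec \<inter> U \<subseteq> {0}"
proof -
  have U: "U \<in> subs n 3" using assms by blast
  have eq: "blocks J = blocks (J - {U}) \<union> blocks {U}"
    using assms(2) by auto
  have f: "finite (blocks (J - {U}))" "finite (blocks {U})" "blocks (J - {U}) \<inter> blocks {U} = {}" "finite (blocks J)"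
    using finite_blocks[OF assms(1)] by (auto intro: finite_subset[of _ "blocks J"])
  show ?thesis
  proof
    assume "jointly_indep J"
    then show "jointly_indep (J - {U}) \<and> lspan (blocks (J - {U})) block_vec \<inter> U \<subseteq> {0}"
      using indep_subset[OF f(4), of block_vec "blocks (J - {U})"] indep_Un_Int_lspan[OF f(1-3), of block_vec] eq blocks_single(2)[OF U]
      unfolding jointly_indep_def by auto
  next
    assume "jointly_indep (J - {U}) \<and> lspan (blocks (J - {U})) block_vec \<inter> U \<subseteq> {0}"
    then show "jointly_indep J"
      unfolding jointly_indep_def eq using blocks_single[OF U] by (intro indep_Un f) auto
  qed
qed

lemma line_dep_if_intersection_line:
  assumes J: "J \<subseteq> subs n 3" "jointly_indep J" and U: "U \<in> subs n 3"
    and B: "B \<in> fam m n" and iso: "\<And>c V. c < m \<Longrightarrow> V \<in> insert U J \<Longrightarrow> isotropic n (B c) V"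
    and r: "indep {..<1::nat} r" "r 0 \<in> U \<inter> lspan (blocks J) block_vec" "lspan {..<1} r = U \<inter> lspan (blocks J) block_vec"
  shows "B \<in> line_dep m n (card J)"
proof -
  obtain \<alpha> where \<alpha>: "\<alpha> \<in> zfun (blocks J) K" "r 0 = comb (blocks J) \<alpha> block_vec"
    using r(2) by (auto simp: lspan_def)
  have "r 0 \<noteq> 0"
    using indep_nonzero[OF _ r(1), of 0] by simp
  moreover have "comb (blocks J) 0 block_vec = 0"
    by (simp add: comb_def fun_eq_iff)
  ultimately have "\<alpha> \<noteq> 0"
    using \<alpha>(2) by auto
  obtain y where y: "\<forall>j<1. y j = r j" "indep {..<3::nat} y" "\<forall>j<3. y j \<in> U"
    using ex_extended_basis[OF U r(1)] r(2) by (metis IntD1 less_one)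
  let ?x = "ext (y 1) (y 2)"
  \<comment> \<open>\<open>h\<close> moves the positions 1 and 2 of \<open>y\<close> to the two
    spare indices of \<open>ext\<close>.\<close>
  define h :: "nat \<Rightarrow> (nat \<Rightarrow> 'a) set \<times> nat" where "h = (\<lambda>i. ({}, i - 1))"
  have h: "inj_on h {1, 2}" "h ` {1, 2} = {({}, 0), ({}, 1)}"
    by (auto simp: h_def)
  have hy: "(?x \<circ> h) j = y j" if "j \<in> {1, 2}" for j
    using that by (auto simp: h_def ext_def)
  have y12: "indep {1, 2} y"
    by (rule indep_subset[OF _ y(2)]) auto
  have 2: "indep {({}, 0), ({}, 1)} ?x"
    unfolding h(2)[symmetric] indep_reindex(1)[OF h(1) finite.insertI[OF finite.insertI[OF finite.emptyI]]]
    using y12 indep_cong[of "{1, 2}" "?x \<circ> h" y, OF hy] by blast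
  have ls2: "lspan {({}, 0), ({}, 1)} ?x = lspan {1, 2} y"
    unfolding h(2)[symmetric] indep_reindex(2)[OF h(1) finite.insertI[OF finite.insertI[OF finite.emptyI]]]
    by (rule lspan_cong[OF hy])
  have ext_eq: "?x t = block_vec t" if "t \<in> blocks J" for t
    by (rule ext_simps(3)[OF J(1) that])
  have "indep (blocks J) ?x" "lspan (blocks J) ?x = lspan (blocks J) block_vec"
    using J(2) indep_cong[of "blocks J" ?x block_vec, OF ext_eq] lspan_cong[of "blocks J" ?x block_vec, OF ext_eq]
    unfolding jointly_indep_def by blast+
  \<comment> \<open>The intersection of \<open>U\<close> with the span of \<open>J\<close> is
    spanned by \<open>y 0\<close>, which is independent of \<open>y 1\<close> and
    \<open>y 2\<close>.\<close>
  moreover have "lspan (blocks J) block_vec \<inter> lspan {1, 2} y \<subseteq> {0}"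
  proof -
    have "lspan {1, 2} y \<subseteq> U"
      using y(3) by (intro lspan_subset subsD(1)[OF U]) auto
    then have "lspan (blocks J) block_vec \<inter> lspan {1, 2} y \<subseteq> lspan {..<1} r"
      using r(3) by auto
    moreover have "lspan {..<1} r = lspan {..<1} y"
      by (rule lspan_cong) (use y(1) in simp)
    moreover have "{..<1} = {0::nat}"
      by auto
    moreover have "lspan {0} y \<inter> lspan {1, 2} y \<subseteq> {0}"
      using y(2) by (intro indep_Un_Int_lspan) (auto simp: numeral_eq_Suc lessThan_Suc insert_commute)
    ultimately show ?thesis by auto
  qed
  ultimately have "indep (blocks J \<union> {({}, 0), ({}, 1)}) ?x"
    using 2 ls2 empty_notin_blocks[OF J(1), of 0] empty_notin_blocks[OF J(1), of 1] finite_blocks[OF J(1)]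
    by (intro indep_Un) auto
  moreover have "blocks J \<union> {({}, 0), ({}, 1)} = ext_index J"
    by (auto simp: ext_index_def)
  ultimately have t: "(J, \<alpha>, y 1, y 2) \<in> line_params n (card J)"
    using J(1) \<alpha>(1) \<open>\<alpha> \<noteq> 0\<close> y(3) subsD(2)[OF U] by (auto simp: line_params_def)
  have "B c \<in> line_forms n (J, \<alpha>, y 1, y 2)" if "c < m" for c
  proof -
    have "isotropic n (B c) U"
      using iso[OF that] by simp
    then have "ev n (B c) (r 0) (y 1) = 0" "ev n (B c) (r 0) (y 2) = 0" "ev n (B c) (y 1) (y 2) = 0"
      using r(2) y(3) by (auto simp: isotropic_def)
    then show ?thesis
      using iso[OF that] zfun_in[OF B, of c] that \<alpha>(2) by (simp add: line_forms_def)
  qed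
  then have "B \<in> zfun {..<m} (line_forms n (J, \<alpha>, y 1, y 2))"
    using zfun_out[OF B] by (intro zfunI) auto
  then show ?thesis
    unfolding line_dep_def using t by blast
qed

text \<open>Minimality supplies the nonzero minor. \<open>r 0\<close> has a nonzero coefficient at
  some \<open>(W, j)\<close>. If all minors of this column with the columns of \<open>V\<close>
  vanished, a nontrivial combination of \<open>r 0\<close> and \<open>r 1\<close> would have no
  component in \<open>V\<close>, hence be 0, against their independence.\<close>

lemma plane_dep_if_intersection_plane:
  assumes J: "J \<subseteq> subs n 3" "2 \<le> card J" and U: "U \<in> subs n 3" "U \<notin> J"
    and min: "jointly_indep J" "\<And>V. V \<in> J \<Longrightarrow> jointly_indep (insert U (J - {V}))"
    and B: "B \<in> fam m n" and iso: "\<And>c V. c < m \<Longrightarrow> V \<in> insert U J \<Longrightarrow> isotropic n (B c) V"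
    and r: "indep {..<a::nat} r" "2 \<le> a" "\<And>j. j < a \<Longrightarrow> r j \<in> U \<inter> lspan (blocks J) block_vec"
  shows "B \<in> plane_dep m n (card J)"
proof -
  obtain \<alpha> where \<alpha>: "\<alpha> \<in> zfun (blocks J) K" "r 0 = comb (blocks J) \<alpha> block_vec"
    using r(2) r(3)[of 0] by (auto simp: lspan_def)
  obtain \<beta> where \<beta>: "\<beta> \<in> zfun (blocks J) K" "r 1 = comb (blocks J) \<beta> block_vec"
    using r(2) r(3)[of 1] by (auto simp: lspan_def)
  have rU: "r 0 \<in> U" "r 1 \<in> U"
    using r(2) r(3)[of 0] r(3)[of 1] by auto
  obtain V W where VW: "V \<in> J" "W \<in> J" "V \<noteq> W"
    using J(2) by (metis card_le_Suc0_iff_eq card.infinite not_less_eq_eq numeral_2_eq_2 zero_le)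
  \<comment> \<open>A vector of \<open>U\<close> with no component in \<open>X\<close> lies in the
    span of the other blocks, which meets \<open>U\<close> trivially by minimality.\<close>
  have vanish: "comb (blocks J) \<gamma> block_vec = 0"
    if "\<gamma> \<in> zfun (blocks J) K" "comb (blocks J) \<gamma> block_vec \<in> U" "X \<in> J" "\<And>i. i < 3 \<Longrightarrow> \<gamma> (X, i) = 0" for \<gamma> X
  proof -
    have "comb (blocks J) \<gamma> block_vec = comb (blocks (J - {X})) \<gamma> block_vec"
      unfolding comb_def using finite_blocks[OF J(1)] that(4)
      by (intro ext sum.mono_neutral_right) auto
    also have "\<dots> \<in> lspan (blocks (J - {X})) block_vec"
      using zfun_in[OF that(1)] by (intro comb_in_lspan) auto
    finally have "comb (blocks J) \<gamma> block_vec \<in> lspan (blocks (J - {X})) block_vec \<inter> U"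
      using that(2) by simp
    moreover have "insert U (J - {X}) - {U} = J - {X}"
      using U(2) by auto
    then have "lspan (blocks (J - {X})) block_vec \<inter> U \<subseteq> {0}"
      using jointly_indep_insert_iff[of "insert U (J - {X})" n U] min(2)[OF that(3)] J(1) U(1) by auto
    ultimately show ?thesis by blast
  qed
  have "r 0 \<noteq> 0"
    using indep_nonzero[OF _ r(1), of 0] r(2) by simp
  then obtain j where j: "j < 3" "\<alpha> (W, j) \<noteq> 0"
    using vanish[OF \<alpha>(1) _ VW(2)] \<alpha>(2) rU(1) by auto
  have in_K: "\<alpha> (W, j) \<in> K" "\<beta> (W, j) \<in> K"
    using zfun_in[OF \<alpha>(1)] zfun_in[OF \<beta>(1)] VW(2) j(1) by auto
  have "\<exists>i<3. \<alpha> (V, i) * \<beta> (W, j) - \<beta> (V, i) * \<alpha> (W, j) \<noteq> 0"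
  proof (rule ccontr)
    assume neg: "\<not> ?thesis"
    \<comment> \<open>The combination that cancels the coefficient at \<open>(W, j)\<close>; its
      coefficients in the block \<open>V\<close> are, up to sign, the minors assumed to
      vanish.\<close>
    define \<gamma> where "\<gamma> = smul (\<beta> (W, j)) \<alpha> + smul (- \<alpha> (W, j)) \<beta>"
    have c: "comb (blocks J) \<gamma> block_vec = smul (\<beta> (W, j)) (r 0) + smul (- \<alpha> (W, j)) (r 1)"
      unfolding \<gamma>_def \<alpha>(2) \<beta>(2) comb_def smul_def
      by (rule ext) (simp add: distrib_right left_diff_distrib sum.distrib sum_distrib_left sum_negf sum_subtractf mult.assoc)
    have "comb (blocks J) \<gamma> block_vec = 0"
    proof (rule vanish[OF _ _ VW(1)])
      show "\<gamma> \<in> zfun (blocks J) K"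
        unfolding \<gamma>_def by (intro subsp_add[OF subsp_vec] smul_in_vec uminus_in in_K \<alpha>(1) \<beta>(1))
      show "comb (blocks J) \<gamma> block_vec \<in> U"
        unfolding c using subsD(1)[OF U(1)] rU in_K by (intro subsp_add subsp_smul uminus_in) auto
      show "\<gamma> (V, i) = 0" if "i < 3" for i
        using neg that by (simp add: \<gamma>_def smul_def mult.commute)
    qed
    then have "- \<alpha> (W, j) = 0"
      using indep_pair_zero(2)[OF r(1,2) in_K(2) uminus_in[OF in_K(1)]] c by simp
    then show False
      using j(2) by simp
  qed
  then obtain i where "i < 3" "\<alpha> (V, i) * \<beta> (W, j) - \<beta> (V, i) * \<alpha> (W, j) \<noteq> 0"
    by blast
  then have t: "(J, \<alpha>, \<beta>) \<in> plane_params n (card J)"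
    using J(1) min(1) \<alpha>(1) \<beta>(1) VW j(1) by (force simp: plane_params_def)
  have "B c \<in> plane_forms n (J, \<alpha>, \<beta>)" if "c < m" for c
  proof -
    have "isotropic n (B c) U"
      using iso[OF that] by simp
    then have "ev n (B c) (r 0) (r 1) = 0"
      using rU by (auto simp: isotropic_def)
    then show ?thesis
      using iso[OF that] zfun_in[OF B, of c] that \<alpha>(2) \<beta>(2) by (simp add: plane_forms_def)
  qed
  then have "B \<in> zfun {..<m} (plane_forms n (J, \<alpha>, \<beta>))"
    using zfun_out[OF B] by (intro zfunI) auto
  then show ?thesis
    unfolding plane_dep_def using t by blast
qed

text \<open>Strong induction on the size makes every proper subset direct, so a dependent
  \<open>J\<close> would be a minimal one. The cases are the dimension \<open>a\<close> of the
  intersection of one member \<open>U\<close> with the span of the rest; the rest has fewer than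
  \<open>k\<close> members, which is why \<open>dep\<close> is assumed for \<open>s < k\<close>
  only.\<close>

lemma jointly_indep_if_not_dep:
  assumes B: "B \<in> fam m n" "m \<ge> 1" "B \<notin> degenerate m n 4 (m - 1)"
    and dep: "\<And>s. 1 \<le> s \<Longrightarrow> s < k \<Longrightarrow> B \<notin> line_dep m n s \<and> B \<notin> plane_dep m n s"
    and J: "J \<subseteq> subs n 3" "card J \<le> k" "\<And>c U. c < m \<Longrightarrow> U \<in> J \<Longrightarrow> isotropic n (B c) U"
  shows "jointly_indep J"
  using J
proof (induction "card J" arbitrary: J rule: less_induct)
  case less
  have fJ: "finite J"
    using less.prems(1) finite_subs finite_subset by blast
  show ?case
  proof (cases "J = {}")
    case True
    then show ?thesis
      by (auto simp: jointly_indep_def indep_def zfun_def fun_eq_iff)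
  next
    case False
    then obtain U where U: "U \<in> J" by blast
    then have Us: "U \<in> subs n 3"
      using less.prems(1) by blast
    have smaller: "jointly_indep J'" if "J' \<subset> J" for J'
    proof (rule less.hyps)
      show "card J' < card J"
        using psubset_card_mono[OF fJ that] .
      then show "card J' \<le> k"
        using less.prems(2) by simp
      show "J' \<subseteq> subs n 3"
        using that less.prems(1) by blast
      show "isotropic n (B c) U" if "c < m" "U \<in> J'" for c U
        using less.prems(3) that \<open>J' \<subset> J\<close> by blast
    qed
    let ?J = "J - {U}"
    let ?R = "U \<inter> lspan (blocks ?J) block_vec"
    have psub: "?J \<subset> J"
      using U by blast
    have J': "?J \<subseteq> subs n 3" "jointly_indep ?J" "insert U ?J = J"
      using less.prems(1) smaller[OF psub] U by auto
    have cJ: "card J = Suc (card ?J)"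
      using card.remove[OF fJ U] by simp
    obtain a r where r: "indep {..<a::nat} r" "\<forall>j<a. r j \<in> ?R" "lspan {..<a} r = ?R"
      using ex_basis[OF subsp_Int[OF subsD(1)[OF Us] subsp_lspan] order.trans[OF Int_lower1 subsD(2)[OF Us]] finite_lessThan]
      by blast
    have iso: "isotropic n (B c) V" if "c < m" "V \<in> insert U ?J" for c V
      by (rule less.prems(3)[OF that(1)]) (use that(2) U in auto)
    show ?thesis
    proof (cases "a = 0")
      case True
      then have "?R = {0}"
        using r(3) by (simp add: lspan_empty)
      then show ?thesis
        using jointly_indep_insert_iff[OF less.prems(1) U] J'(2) by (simp add: Int_commute)
    next
      case a: False
      have "r 0 \<noteq> 0"
        using indep_nonzero[OF _ r(1), of 0] a by simp
      have s1: "1 \<le> card ?J"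
      proof (rule ccontr)
        assume "\<not> 1 \<le> card ?J"
        then have "?J = {}"
          using fJ by (metis One_nat_def Suc_leI card_gt_0_iff finite_Diff)
        then have "blocks ?J = {}" by simp
        then have "lspan (blocks ?J) block_vec = {0}"
          using lspan_empty by metis
        then show False
          using r(2) a \<open>r 0 \<noteq> 0\<close> by auto
      qed
      have sk: "card ?J < k"
        using cJ less.prems(2) by simp
      have False
      proof (cases "a = 1")
        case True
        have "B \<in> line_dep m n (card ?J)"
          by (rule line_dep_if_intersection_line[OF J'(1,2) Us B(1) iso]) (use r True in auto)
        then show False
          using dep[OF s1 sk] by blast
      next
        case False
        then have a2: "2 \<le> a"
          using a by simp
        show False
        proof (cases "card ?J = 1")
          case True
          then obtain V where V: "?J = {V}"
            using card_1_singletonE by blast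
          then have VU: "V \<in> subs n 3" "U \<noteq> V"
            using J'(1) by auto
          have "B \<in> degenerate m n 4 (m - 1)"
          proof (rule degenerate_4_if_large_intersection[OF Us VU B(1,2) _ r(1) _ a2])
            show "isotropic n (B c) U \<and> isotropic n (B c) V" if "c < m" for c
              using iso[OF that] V by auto
          qed (use r(2,3) V blocks_single(2)[OF VU(1)] in auto)
          then show False
            using B(3) by blast
        next
          case False
          then have "2 \<le> card ?J"
            using s1 by simp
          have "B \<in> plane_dep m n (card ?J)"
          proof (rule plane_dep_if_intersection_plane[OF J'(1) \<open>2 \<le> card ?J\<close> Us _ J'(2) _ B(1) iso r(1) a2])
            show "jointly_indep (insert U (?J - {V}))" if "V \<in> ?J" for V
              using that U by (intro smaller) auto
          qed (use r(2) in auto)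
          then show False
            using dep[OF s1 sk] by blast
        qed
      qed
      then show ?thesis ..
    qed
  qed
qed

subsection \<open>Choosing the forms\<close>

text \<open>Bonferroni is applied to each form separately and then averaged. The sum of
  \<open>c f choose j\<close> over all forms counts pairs of a form and \<open>j\<close> subspaces
  isotropic for it, and \<open>card_isotropic\<close> evaluates it exactly for
  \<open>j \<le> k\<close>.\<close>

lemma card_avoiding:
  assumes Y: "Y \<subseteq> subs n 3" "odd k" "\<And>J. J \<subseteq> Y \<Longrightarrow> card J \<le> k \<Longrightarrow> jointly_indep J"
  shows "real (card {f \<in> mats n. \<forall>U\<in>Y. \<not> isotropic n f U}) \<ge> real (card (mats n)) * bonferroni (card Y) k (1 / real p ^ 3)"
proof -
  have fY: "finite Y"
    using Y(1) finite_subs finite_subset by blast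
  define c where "c = (\<lambda>f. card {U \<in> Y. isotropic n f U})"
  \<comment> \<open>At \<open>q = 1\<close> the limit \<open>(1 - q) ^ c f\<close> is
    \<open>0 ^ c f\<close>, the indicator that no member of \<open>Y\<close> is isotropic; odd
    \<open>k\<close> bounds it from below.\<close>
  have le: "bonferroni (c f) k 1 \<le> (if \<forall>U\<in>Y. \<not> isotropic n f U then 1 else 0)" for f
  proof -
    have "c f = 0 \<longleftrightarrow> (\<forall>U\<in>Y. \<not> isotropic n f U)"
      using fY by (auto simp: c_def)
    then show ?thesis
      using bonferroni_alternates[of 1 k "c f"] Y(2) by (auto simp: zero_power)
  qed
  have cnt: "(\<Sum>f\<in>mats n. real (c f choose j)) = real (card (mats n)) * (real (card Y choose j) * (1 / real p ^ 3) ^ j)"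
    if "j \<le> k" for j
  proof -
    let ?P = "{J. J \<subseteq> Y \<and> card J = j}"
    have fP: "finite ?P"
      using fY by simp
    have "(c f choose j) = card {J \<in> ?P. \<forall>U\<in>J. isotropic n f U}" for f
    proof -
      have "{J \<in> ?P. \<forall>U\<in>J. isotropic n f U} = {J. J \<subseteq> {U \<in> Y. isotropic n f U} \<and> card J = j}"
        by auto
      then show ?thesis
        using n_subsets[of "{U \<in> Y. isotropic n f U}" j] fY by (simp add: c_def)
    qed
    then have "(\<Sum>f\<in>mats n. c f choose j) = (\<Sum>J\<in>?P. card {f \<in> mats n. \<forall>U\<in>J. isotropic n f U})"
      using sum_card_swap[OF finite_mats fP, of "\<lambda>f J. \<forall>U\<in>J. isotropic n f U"] by simp
    then have "(\<Sum>f\<in>mats n. real (c f choose j)) = (\<Sum>J\<in>?P. real (card {f \<in> mats n. \<forall>U\<in>J. isotropic n f U}))"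
      by (simp only: of_nat_sum[symmetric])
    also have "\<dots> = (\<Sum>J\<in>?P. real (card (mats n)) * (1 / real p ^ 3) ^ j)"
    proof (intro sum.cong refl)
      fix J assume J: "J \<in> ?P"
      then have "card (mats n) = p ^ (3 * j) * card {f \<in> mats n. \<forall>U\<in>J. isotropic n f U}"
        using card_isotropic[of J n] Y(1) Y(3)[of J] that by auto
      then have "real (card (mats n)) = (real p ^ 3) ^ j * real (card {f \<in> mats n. \<forall>U\<in>J. isotropic n f U})"
        by (simp add: power_mult)
      then show "real (card {f \<in> mats n. \<forall>U\<in>J. isotropic n f U}) = real (card (mats n)) * (1 / real p ^ 3) ^ j"
        using p_ge_2 by (simp add: power_divide)
    qed
    also have "\<dots> = real (card (mats n)) * (real (card Y choose j) * (1 / real p ^ 3) ^ j)"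
      using n_subsets[OF fY, of j] by simp
    finally show ?thesis .
  qed
  have "real (card (mats n)) * bonferroni (card Y) k (1 / real p ^ 3) =
    (\<Sum>j\<le>k. (-1) ^ j * (\<Sum>f\<in>mats n. real (c f choose j)))"
    unfolding bonferroni_def
  proof (subst sum_distrib_left, intro sum.cong refl)
    fix j assume "j \<in> {..k}"
    then have "(\<Sum>f\<in>mats n. real (c f choose j)) = real (card (mats n)) * (real (card Y choose j) * (1 / real p ^ 3) ^ j)"
      using cnt by simp
    then show "real (card (mats n)) * ((-1) ^ j * real (card Y choose j) * (1 / real p ^ 3) ^ j) =
      (-1) ^ j * (\<Sum>f\<in>mats n. real (c f choose j))"
      by (simp only: mult_ac)
  qed
  also have "\<dots> = (\<Sum>f\<in>mats n. bonferroni (c f) k 1)"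
    unfolding bonferroni_def sum_distrib_left by (subst sum.swap) simp
  also have "\<dots> \<le> (\<Sum>f\<in>mats n. if \<forall>U\<in>Y. \<not> isotropic n f U then 1 else 0)"
    by (intro sum_mono le)
  also have "\<dots> = real (card {f \<in> mats n. \<forall>U\<in>Y. \<not> isotropic n f U})"
    using finite_mats by (simp add: sum.If_cases Int_def)
  finally show ?thesis .
qed

section \<open>Densities of the bad choices of forms\<close>

definition isotropic3 :: "nat \<Rightarrow> nat \<Rightarrow> (nat \<Rightarrow> nat \<times> nat \<Rightarrow> 'a) \<Rightarrow> (nat \<Rightarrow> 'a) set set"
  where "isotropic3 m n B = {U \<in> subs n 3. \<forall>c<m. isotropic n (B c) U}"

lemma sum_card_isotropic3: "(\<Sum>B\<in>fam m n. card (isotropic3 m n B)) * p ^ (3 * m) = card (subs n 3) * card (fam m n)"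
proof -
  have "(\<Sum>B\<in>fam m n. card (isotropic3 m n B)) = (\<Sum>U\<in>subs n 3. card {B \<in> fam m n. \<forall>c<m. isotropic n (B c) U})"
    unfolding isotropic3_def by (rule sum_card_swap[OF finite_fam finite_subs])
  moreover have "card {B \<in> fam m n. \<forall>c<m. isotropic n (B c) U} * p ^ (3 * m) = card (fam m n)" if U: "U \<in> subs n 3" for U
  proof -
    have "{B \<in> fam m n. \<forall>c<m. isotropic n (B c) U} = zfun {..<m} {f \<in> mats n. isotropic n f U}"
    proof (intro Set.set_eqI iffI)
      fix B assume "B \<in> {B \<in> fam m n. \<forall>c<m. isotropic n (B c) U}"
      then show "B \<in> zfun {..<m} {f \<in> mats n. isotropic n f U}"
        by (intro zfunI) (auto dest: zfun_in zfun_out)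
    next
      fix B assume B: "B \<in> zfun {..<m} {f \<in> mats n. isotropic n f U}"
      have "B \<in> fam m n"
        by (rule zfunI) (use zfun_in[OF B] zfun_out[OF B] in blast)+
      then show "B \<in> {B \<in> fam m n. \<forall>c<m. isotropic n (B c) U}"
        using zfun_in[OF B] by auto
    qed
    moreover have "card (mats n) = p ^ 3 * card {f \<in> mats n. isotropic n f U}"
      using card_isotropic[of "{U}" n] U blocks_single(1)[OF U] by (simp add: jointly_indep_def)
    ultimately show ?thesis
      by (simp add: card_zfun[OF finite_lessThan] power_mult_distrib power_mult[symmetric] mult.commute)
  qed
  ultimately show ?thesis
    by (simp add: sum_distrib_right)
qed

lemma two_power_le_p: "(2::real) ^ k \<le> real p ^ k"
  using p_ge_2 by (intro power_mono) auto

text \<open>Turns a surplus of \<open>k\<close> in the exponent into the numerical density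
  \<open>1 / t\<close>, using only \<open>p ^ k \<ge> 2 ^ k\<close>, so the same constants serve all
  primes.\<close>

lemma le_of_times_power_le:
  fixes x M c :: real
  assumes "x * real p ^ a \<le> c * real p ^ b * M" "b + k \<le> a" "c * t \<le> 2 ^ k" "0 \<le> M" "0 < c" "0 < t" "0 \<le> x"
  shows "x \<le> M / t"
proof -
  have pos: "real p > 0"
    using p_ge_2 by simp
  have "x * real p ^ k * real p ^ b = x * real p ^ (b + k)"
    by (simp add: power_add)
  also have "\<dots> \<le> x * real p ^ a"
    using assms(2,7) p_ge_2 by (intro mult_left_mono power_increasing) auto
  also have "\<dots> \<le> (c * M) * real p ^ b"
    using assms(1) by (simp add: mult_ac)
  finally have "x * real p ^ k \<le> c * M"
    using pos by (simp add: mult_le_cancel_right)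
  moreover have "x * (c * t) \<le> x * real p ^ k"
    using assms(3,7) two_power_le_p[of k] by (intro mult_left_mono) auto
  ultimately have "c * (x * t) \<le> c * M"
    by (simp add: mult_ac)
  then show ?thesis
    using assms(5,6) by (simp add: field_simps)
qed

text \<open>Dimensions up to 2 impose nothing, dimension 3 is left to the last form, and
  \<open>d = n\<close> is excluded because only proper subspaces are constrained.\<close>

definition degenerate_ge_4 :: "nat \<Rightarrow> (nat \<Rightarrow> nat \<times> nat \<Rightarrow> 'a) set"
  where "degenerate_ge_4 n = (\<Union>d\<in>{4..<n}. degenerate (n - 3) n d (n - d))"

lemma finite_degenerate: "finite (degenerate m n d q)"
  unfolding degenerate_def using finite_fam finite_subs by auto

lemma finite_line_dep: "finite (line_dep m n s)"
proof -
  have "finite (line_forms n t)" for t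
    by (rule finite_subset[OF _ finite_mats[of n]]) (auto simp: line_forms_def split: prod.splits)
  then show ?thesis
    unfolding line_dep_def by (intro finite_UN_I finite_card_line_params finite_zfun finite_lessThan)
qed

lemma finite_plane_dep: "finite (plane_dep m n s)"
proof -
  have "finite (plane_forms n t)" for t
    by (rule finite_subset[OF _ finite_mats[of n]]) (auto simp: plane_forms_def split: prod.splits)
  then show ?thesis
    unfolding plane_dep_def by (intro finite_UN_I finite_card_plane_params finite_zfun finite_lessThan)
qed

text \<open>The saving in the exponent is \<open>(n - d) (d - 2) (d - 3) / 2\<close>, which equals
  \<open>n - 4\<close> at \<open>d = 4\<close>.\<close>

lemma degenerate_exponent:
  assumes "4 \<le> d" "d < (n::nat)"
  shows "n * d + (n - 3) * (n - d) + (n - 4) \<le> d * d + (n - d) * (n - d) + (n - d) * (d * (d - 1) div 2)"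
proof -
  \<comment> \<open>The substitution removes the truncated subtractions and doubling removes
    \<open>div\<close>; what remains compares polynomials with nonnegative coefficients.\<close>
  obtain t where t: "d = t + 4"
    using that[of "d - 4"] assms(1) by simp
  obtain q where q: "n = d + Suc q"
    using that[of "n - d - 1"] assms(2) by simp
  define T where "T = d * (d - 1) div 2"
  have "even (d * (d - 1))"
    by auto
  then have T: "2 * T = (t + 4) * (t + 3)"
    unfolding T_def by (simp add: t)
  have "2 * (Suc q * T) = Suc q * ((t + 4) * (t + 3))"
    unfolding T[symmetric] by simp
  moreover have e: "n - d = Suc q" "n - 3 = t + q + 2" "n - 4 = t + Suc q"
    using q t by auto
  moreover have nd: "n * d = (t + q + 5) * (t + 4)" "d * d = (t + 4) * (t + 4)"
    using q t by (simp_all add: algebra_simps)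
  moreover have "2 * ((t + q + 5) * (t + 4) + (t + q + 2) * Suc q + (t + Suc q))
    \<le> 2 * ((t + 4) * (t + 4) + Suc q * Suc q) + Suc q * ((t + 4) * (t + 3))"
    by (simp add: algebra_simps)
  ultimately have "2 * ((t + q + 5) * (t + 4) + (t + q + 2) * Suc q + (t + Suc q))
    \<le> 2 * ((t + 4) * (t + 4) + Suc q * Suc q + Suc q * T)"
    by simp
  then show ?thesis
    unfolding T_def[symmetric] e nd by simp
qed

lemma card_degenerate_ge_4: "real (card (degenerate_ge_4 n)) * real p ^ (n - 4) \<le> 16 * real n * real (card (fam (n - 3) n))"
proof -
  have *: "real (card (degenerate (n - 3) n d (n - d))) * real p ^ (n - 4) \<le> 16 * real (card (fam (n - 3) n))"
    if d: "d \<in> {4..<n}" for d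
  proof -
    let ?b = "n * d + (n - 3) * (n - d)"
    have "real (card (degenerate (n - 3) n d (n - d))) * real p ^ (n - 4) * real p ^ ?b
      = real (card (degenerate (n - 3) n d (n - d))) * real p ^ (?b + (n - 4))"
      by (simp add: power_add)
    also have "\<dots> \<le> real (card (degenerate (n - 3) n d (n - d))) * real p ^ (d * d + (n - d) * (n - d) + (n - d) * (d * (d - 1) div 2))"
      using d p_ge_2 by (intro mult_left_mono power_increasing degenerate_exponent) auto
    also have "\<dots> \<le> 16 * real p ^ ?b * real (card (fam (n - 3) n))"
      by (rule card_degenerate)
    finally have "real (card (degenerate (n - 3) n d (n - d))) * real p ^ (n - 4) * real p ^ ?b
      \<le> 16 * real (card (fam (n - 3) n)) * real p ^ ?b"
      by (simp add: mult_ac)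
    then show ?thesis
      using p_ge_2 by (simp add: mult_le_cancel_right)
  qed
  have "real (card (degenerate_ge_4 n)) \<le> (\<Sum>d\<in>{4..<n}. real (card (degenerate (n - 3) n d (n - d))))"
    unfolding degenerate_ge_4_def using card_UN_le[of "{4..<n}" "\<lambda>d. degenerate (n - 3) n d (n - d)"]
    by (simp only: of_nat_sum[symmetric] of_nat_le_iff finite_atLeastLessThan)
  then have "real (card (degenerate_ge_4 n)) * real p ^ (n - 4)
    \<le> (\<Sum>d\<in>{4..<n}. real (card (degenerate (n - 3) n d (n - d))) * real p ^ (n - 4))"
    unfolding sum_distrib_right[symmetric] by (intro mult_right_mono) auto
  also have "\<dots> \<le> (\<Sum>d\<in>{4..<n}. 16 * real (card (fam (n - 3) n)))"
    by (intro sum_mono *)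
  also have "\<dots> \<le> 16 * real n * real (card (fam (n - 3) n))"
    by (simp add: mult_right_mono)
  finally show ?thesis .
qed

lemma le_two_power: "160 \<le> n \<Longrightarrow> n \<le> 2 ^ (n - 100)"
proof (induction n rule: nat_induct_at_least)
  case (Suc n)
  then have "Suc n - 100 = Suc (n - 100)"
    by simp
  then show ?case
    using Suc by simp
qed simp

text \<open>The hypothesis \<open>n \<ge> 160\<close> pays for \<open>plane_dep\<close>, whose density is at most \<open>4 ^ s * p powi (9 * s + 4 - n)\<close>
  with \<open>s \<le> 10\<close>.\<close>

lemma ex_good_prefix:
  assumes n: "n \<ge> 160"
  defines "m \<equiv> n - 4"
  shows "\<exists>B\<in>fam m n. B \<notin> degenerate m n 4 (m - 1) \<and>
    (\<forall>s. 1 \<le> s \<and> s < 11 \<longrightarrow> B \<notin> line_dep m n s \<and> B \<notin> plane_dep m n s) \<and>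
    real (card (isotropic3 m n B)) * (1 / real p ^ 3) \<le> 7 / 2 \<and>
    real (card {f \<in> mats n. B(m := f) \<in> degenerate_ge_4 n}) < real (card (mats n)) / 200"
proof -
  define M where "M = real (card (fam m n))"
  define A where "A = real (card (mats n))"
  have A: "A > 0"
    using card_mats_pos by (simp add: A_def)
  have M: "M > 0"
    using card_mats_pos by (simp add: M_def card_fam)
  have pp: "real p > 0"
    using p_ge_2 by simp
  have nm: "n = m + 4" "m \<ge> 156"
    using n by (auto simp: m_def)
  \<comment> \<open>The four bad sets have densities at most \<open>1/100\<close>,
    \<open>1/50\<close>, \<open>128/147\<close> and \<open>1/100\<close>, with sum below 1. The rare
    events share the small room that the Markov bound for \<open>?S3\<close> leaves.\<close>
  let ?S1 = "degenerate m n 4 (m - 1)"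
  let ?S2 = "\<Union>s\<in>{1..<11}. line_dep m n s \<union> plane_dep m n s"
  let ?S3 = "{B \<in> fam m n. real (card (isotropic3 m n B)) \<ge> 7 / 2 * real p ^ 3}"
  let ?g = "\<lambda>B. card {f \<in> mats n. B(m := f) \<in> degenerate_ge_4 n}"
  let ?S4 = "{B \<in> fam m n. real (?g B) \<ge> A / 200}"
  have 1: "real (card ?S1) \<le> M / 100"
  proof (rule le_of_times_power_le)
    show "real (card ?S1) * real p ^ (4 * 4 + (m - 1) * (m - 1) + (m - 1) * (4 * (4 - 1) div 2))
      \<le> 16 * real p ^ (n * 4 + m * (m - 1)) * M"
      unfolding M_def by (rule card_degenerate)
    obtain q where q: "m = Suc q" "q \<ge> 100"
      using nm(2) by (cases m) auto
    show "n * 4 + m * (m - 1) + 90 \<le> 4 * 4 + (m - 1) * (m - 1) + (m - 1) * (4 * (4 - 1) div 2)"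
      using q by (simp add: nm(1) algebra_simps)
  qed (use M in auto)
  have 2: "real (card ?S2) \<le> M / 50"
  proof -
    have A_le: "real (card (line_dep m n s)) \<le> M / 1000" and B_le: "real (card (plane_dep m n s)) \<le> M / 1000"
      if s: "s \<in> {1..<11}" for s
    proof -
      have "(4::real) ^ s \<le> 4 ^ 10"
        using s by (intro power_increasing) auto
      then have c: "4 ^ s * 1000 \<le> (2::real) ^ 60"
        by simp
      show "real (card (line_dep m n s)) \<le> M / 1000"
      proof (rule le_of_times_power_le[OF card_line_dep[of m n s, folded M_def] _ c])
        show "3 * n * s + 3 * s + 2 * n + 60 \<le> (3 * s + 3) * m + 9 * s"
          using s nm by (simp add: algebra_simps)
      qed (use M in auto)
      show "real (card (plane_dep m n s)) \<le> M / 1000"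
      proof (rule le_of_times_power_le[OF card_plane_dep[of m n s, folded M_def] _ c])
        show "3 * n * s + 6 * s + 60 \<le> (3 * s + 1) * m + 9 * s"
          using s nm by (simp add: algebra_simps)
      qed (use M in auto)
    qed
    have "real (card ?S2) \<le> real (\<Sum>s\<in>{1..<11}. card (line_dep m n s \<union> plane_dep m n s))"
      by (intro of_nat_mono card_UN_le) simp
    also have "\<dots> \<le> (\<Sum>s\<in>{1..<11::nat}. M / 1000 + M / 1000)"
      unfolding of_nat_sum
    proof (intro sum_mono)
      fix s :: nat assume "s \<in> {1..<11}"
      then show "real (card (line_dep m n s \<union> plane_dep m n s)) \<le> M / 1000 + M / 1000"
        using A_le[of s] B_le[of s] card_Un_le[of "line_dep m n s" "plane_dep m n s"] by linarith
    qed
    also have "\<dots> \<le> M / 50"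
      by simp
    finally show ?thesis .
  qed
  \<comment> \<open>Markov: the mean is at most \<open>64/21 * p ^ 3\<close> and the threshold is
    \<open>7/2 * p ^ 3\<close>, with ratio \<open>128/147\<close>.\<close>
  have 3: "real (card ?S3) \<le> 128 / 147 * M"
  proof -
    have "real (\<Sum>B\<in>fam m n. card (isotropic3 m n B)) * real p ^ (3 * m) = real (card (subs n 3)) * M"
      using arg_cong[OF sum_card_isotropic3[of m n], of real] by (simp add: M_def)
    then have "21 * real (\<Sum>B\<in>fam m n. card (isotropic3 m n B)) * real p ^ (3 * m) * real p ^ 9
      = (21 * real (card (subs n 3)) * real p ^ 9) * M"
      by (simp add: mult_ac)
    also have "\<dots> \<le> (64 * real p ^ (3 * n)) * M"
      using M by (intro mult_right_mono card_subs3) auto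
    \<comment> \<open>There are about \<open>p ^ (3 * n - 9)\<close> 3-spaces, each surviving with
      probability \<open>1 / p ^ (3 * m)\<close>; the remaining 3 is the \<open>p ^ 3\<close> of the
      threshold, due to the form held back.\<close>
    also have "3 * n = 3 * m + 9 + 3"
      using nm by simp
    finally have "(21 * real (\<Sum>B\<in>fam m n. card (isotropic3 m n B))) * (real p ^ (3 * m) * real p ^ 9) \<le>
      (64 * real p ^ 3 * M) * (real p ^ (3 * m) * real p ^ 9)"
      by (simp only: power_add mult_ac)
    then have S: "21 * real (\<Sum>B\<in>fam m n. card (isotropic3 m n B)) \<le> 64 * real p ^ 3 * M"
      using pp by (subst (asm) mult_le_cancel_right) simp
    have "real (card ?S3) * (7 / 2 * real p ^ 3) \<le> real (\<Sum>B\<in>fam m n. card (isotropic3 m n B))"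
      by (rule card_Markov[OF finite_fam]) simp
    then have "21 * (real (card ?S3) * (7 / 2 * real p ^ 3)) \<le> 64 * real p ^ 3 * M"
      using S by linarith
    then have "(real (card ?S3) * (147 / 2)) * real p ^ 3 \<le> (64 * M) * real p ^ 3"
      by (simp add: mult_ac)
    then have "real (card ?S3) * (147 / 2) \<le> 64 * M"
      using pp by (subst (asm) mult_le_cancel_right) simp
    then show ?thesis by simp
  qed
  have 4: "real (card ?S4) \<le> M / 100"
  proof -
    \<comment> \<open>A prefix has the default value 0 at \<open>m\<close>, so both \<open>B\<close>
      and \<open>f\<close> can be recovered from the update.\<close>
    have inj: "inj_on (\<lambda>(B, f). B(m := f)) (Sigma (fam m n) (\<lambda>B. {f \<in> mats n. B(m := f) \<in> degenerate_ge_4 n}))"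
    proof (rule inj_onI, clarify)
      fix B f B' f' assume *: "B(m := f) = B'(m := f')" "B \<in> fam m n" "B' \<in> fam m n"
      have "B m = 0" "B' m = 0"
        using zfun_out[OF *(2), of m] zfun_out[OF *(3), of m] by auto
      then show "B = B' \<and> f = f'"
        using *(1) by (metis fun_upd_idem_iff fun_upd_same fun_upd_upd)
    qed
    have "finite (degenerate_ge_4 n)"
      unfolding degenerate_ge_4_def using finite_degenerate by blast
    then have "card (Sigma (fam m n) (\<lambda>B. {f \<in> mats n. B(m := f) \<in> degenerate_ge_4 n})) \<le> card (degenerate_ge_4 n)"
      by (intro card_inj_on_le[OF inj]) auto
    moreover have "card (Sigma (fam m n) (\<lambda>B. {f \<in> mats n. B(m := f) \<in> degenerate_ge_4 n})) = (\<Sum>B\<in>fam m n. ?g B)"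
      by (rule card_SigmaI[OF finite_fam]) (simp add: finite_mats)
    ultimately have "real (\<Sum>B\<in>fam m n. ?g B) \<le> real (card (degenerate_ge_4 n))"
      by (simp only: of_nat_le_iff)
    moreover have "real (card ?S4) * (A / 200) \<le> real (\<Sum>B\<in>fam m n. ?g B)"
      by (rule card_Markov[OF finite_fam]) (use A in auto)
    ultimately have le: "real (card ?S4) * (A / 200) \<le> real (card (degenerate_ge_4 n))"
      by linarith
    have "n - 3 = Suc m"
      using nm by simp
    then have "real (card (fam (n - 3) n)) = M * A"
      by (simp add: M_def A_def card_fam)
    then have b: "real (card (degenerate_ge_4 n)) * real p ^ (n - 4) \<le> 16 * real n * (M * A)"
      using card_degenerate_ge_4[of n] by simp
    have "real n \<le> real p ^ (n - 100)"
    proof -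
      have "real n \<le> real (2 ^ (n - 100))"
        using le_two_power[OF n] by (rule of_nat_mono)
      also have "\<dots> = 2 ^ (n - 100)"
        by simp
      also have "\<dots> \<le> real p ^ (n - 100)"
        by (rule two_power_le_p)
      finally show ?thesis .
    qed
    then have "16 * real n * (M * A) \<le> 16 * real p ^ (n - 100) * (M * A)"
      using M A by (intro mult_right_mono) auto
    with b have "real (card (degenerate_ge_4 n)) * real p ^ (n - 4) \<le> 16 * real p ^ (n - 100) * (M * A)"
      by linarith
    \<comment> \<open>\<open>20000 = 100 * 200\<close>: by Markov, at most \<open>1/100\<close> of
      the prefixes have \<open>1/200\<close> or more of their extensions degenerate, where
      \<open>1/200\<close> is the Bonferroni bound.\<close>
    then have "real (card (degenerate_ge_4 n)) \<le> M * A / 20000"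
      by (rule le_of_times_power_le[where k = 60]) (use M A n in auto)
    with le have "(real (card ?S4) * 100) * A \<le> M * A"
      by (simp add: field_simps)
    then show ?thesis
      using A by simp
  qed
  have "fam m n - (?S1 \<union> ?S2 \<union> ?S3 \<union> ?S4) \<noteq> {}"
  proof
    assume "fam m n - (?S1 \<union> ?S2 \<union> ?S3 \<union> ?S4) = {}"
    then have sub: "fam m n \<subseteq> ?S1 \<union> ?S2 \<union> ?S3 \<union> ?S4"
      by blast
    have "finite (?S1 \<union> ?S2 \<union> ?S3 \<union> ?S4)"
      using finite_degenerate finite_line_dep finite_plane_dep finite_fam by simp
    then have "card (fam m n) \<le> card (?S1 \<union> ?S2 \<union> ?S3 \<union> ?S4)"
      using sub by (rule card_mono)
    also have "\<dots> \<le> card ?S1 + card ?S2 + card ?S3 + card ?S4"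
      using card_Un_le[of "?S1 \<union> ?S2 \<union> ?S3" ?S4] card_Un_le[of "?S1 \<union> ?S2" ?S3] card_Un_le[of ?S1 ?S2]
      by linarith
    finally have "M \<le> real (card ?S1) + real (card ?S2) + real (card ?S3) + real (card ?S4)"
      unfolding M_def by linarith
    then show False
      using 1 2 3 4 M by linarith
  qed
  then obtain B where B: "B \<in> fam m n" "B \<notin> ?S1" "B \<notin> ?S2" "B \<notin> ?S3" "B \<notin> ?S4"
    by blast
  have "real (card (isotropic3 m n B)) < 7 / 2 * real p ^ 3"
    using B(1,4) by (simp add: not_le)
  then have "real (card (isotropic3 m n B)) * (1 / real p ^ 3) \<le> 7 / 2"
    using pp by (simp add: field_simps)
  moreover have "real (?g B) < A / 200"
    using B(1,5) by (simp add: not_le)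
  moreover have "\<forall>s. 1 \<le> s \<and> s < 11 \<longrightarrow> B \<notin> line_dep m n s \<and> B \<notin> plane_dep m n s"
    using B(3) by auto
  ultimately show ?thesis
    using B(1,2) unfolding A_def by blast
qed

text \<open>The dimension inequality in terms of cardinalities. Letting \<open>E\<close> range over
  all subspaces that contain the brackets of \<open>U\<close> avoids forming their span.\<close>

theorem ex_good_forms:
  assumes n: "n \<ge> 160"
  shows "\<exists>C\<in>fam (n - 3) n. \<forall>U E. subsp U \<and> U \<subset> vec n \<and> subsp E \<and> E \<subseteq> vec (n - 3) \<and>
    (\<forall>x\<in>U. \<forall>y\<in>U. (\<lambda>c. ev n (C c) x y) \<in> E) \<longrightarrow> card U \<le> p ^ 2 * card E"
proof -
  define m where "m = n - 4"
  have nm: "n = m + 4" "n - 3 = Suc m" "m \<ge> 1"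
    using n by (auto simp: m_def)
  obtain B where B: "B \<in> fam m n" "B \<notin> degenerate m n 4 (m - 1)"
    and dep: "\<And>s. 1 \<le> s \<Longrightarrow> s < 11 \<Longrightarrow> B \<notin> line_dep m n s \<and> B \<notin> plane_dep m n s"
    and Y: "real (card (isotropic3 m n B)) * (1 / real p ^ 3) \<le> 7 / 2"
    and few: "real (card {f \<in> mats n. B(m := f) \<in> degenerate_ge_4 n}) < real (card (mats n)) / 200"
    using ex_good_prefix[OF n] unfolding m_def by blast
  let ?Y = "isotropic3 m n B"
  let ?G = "{f \<in> mats n. \<forall>U\<in>?Y. \<not> isotropic n f U}"
  let ?F = "{f \<in> mats n. B(m := f) \<in> degenerate_ge_4 n}"
  have Ysub: "?Y \<subseteq> subs n 3"
    by (auto simp: isotropic3_def)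
  have jY: "jointly_indep J" if "J \<subseteq> ?Y" "card J \<le> 11" for J
    by (rule jointly_indep_if_not_dep[OF B(1) nm(3) B(2) dep]) (use that in \<open>auto simp: isotropic3_def\<close>)
  have q: "1 / real p ^ 3 \<le> 1 / 8"
  proof -
    have "(2::real) ^ 3 \<le> real p ^ 3"
      by (rule two_power_le_p)
    then show ?thesis
      using p_ge_2 by (intro divide_left_mono) auto
  qed
  have "real (card (mats n)) * (1 / 200) \<le> real (card (mats n)) * bonferroni (card ?Y) 11 (1 / real p ^ 3)"
    by (intro mult_left_mono bonferroni_11_ge q Y) auto
  also have "\<dots> \<le> real (card ?G)"
    by (rule card_avoiding[OF Ysub _ jY]) auto
  \<comment> \<open>At least \<open>1/200\<close> of the last forms kill no surviving 3-space, and
    fewer than \<open>1/200\<close> create a degeneracy, so some form does neither.\<close>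
  finally have "card ?F < card ?G"
    using few by linarith
  moreover have "finite ?F"
    using finite_mats by simp
  ultimately have "\<not> ?G \<subseteq> ?F"
    using card_mono[of ?F ?G] by linarith
  then obtain f where f: "f \<in> mats n" "\<forall>U\<in>?Y. \<not> isotropic n f U" "B(m := f) \<notin> degenerate_ge_4 n"
    by blast
  let ?C = "B(m := f)"
  have C: "?C \<in> fam (n - 3) n"
    unfolding nm(2)
  proof (rule zfunI)
    show "?C c \<in> mats n" if "c \<in> {..<Suc m}" for c
      using that f(1) zfun_in[OF B(1), of c] by (cases "c = m") auto
    show "?C c = 0" if "c \<notin> {..<Suc m}" for c
      using that zfun_out[OF B(1), of c] by auto
  qed
  have "card U \<le> p ^ 2 * card E" if U: "subsp U" "U \<subset> vec n" and E: "subsp E" "E \<subseteq> vec (n - 3)"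
    and br: "\<forall>x\<in>U. \<forall>y\<in>U. (\<lambda>c. ev n (?C c) x y) \<in> E" for U E
  proof (rule ccontr)
    assume neg: "\<not> ?thesis"
    obtain d where d: "card U = p ^ d"
      using ex_basis[of U "{..<n}"] U by blast
    obtain e where e: "card E = p ^ e"
      using ex_basis[of E "{..<n - 3}"] E by blast
    have "p ^ d < p ^ n"
      using psubset_card_mono[OF finite_vec U(2)] d by (simp add: card_vec)
    then have dn: "d < n"
      using p_ge_2 power_less_imp_less_exp[of p d n] by simp
    have "p ^ (e + 2) = p ^ 2 * p ^ e"
      by (simp only: power_add mult.commute)
    then have "p ^ (e + 2) < p ^ d"
      using neg by (simp only: d e not_le)
    \<comment> \<open>The inequality can fail only for \<open>d \<ge> 3\<close>, and at
      \<open>d = 3\<close> only with \<open>E = 0\<close>, that is, for a 3-space isotropic for all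
      forms.\<close>
    then have de: "e + 3 \<le> d"
      using p_ge_2 power_less_imp_less_exp[of p "e + 2" d] by simp
    have Us: "U \<in> subs n d"
      using U d by (auto simp: subs_def)
    show False
    proof (cases "d = 3")
      case True
      then have "card E = 1"
        using de e by simp
      then have "E = {0}"
        using subsp_zero[OF E(1)] card_1_singletonE by (metis singletonD)
      then have z: "ev n (?C c) x y = 0" if "x \<in> U" "y \<in> U" for c x y
        using br that by (auto simp: fun_eq_iff)
      have "isotropic n (B c) U" if "c < m" for c
        unfolding isotropic_def using z[of _ _ c] that by auto
      then have "U \<in> ?Y"
        using Us True by (simp add: isotropic3_def)
      moreover have "isotropic n f U"
        unfolding isotropic_def using z[of _ _ m] by auto
      ultimately show False
        using f(2) by blast
    next
      case False
      then have d4: "4 \<le> d"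
        using de by simp
      have "card E \<le> p ^ (d - 3)"
        unfolding e using de p_ge_2 by (intro power_increasing) auto
      moreover have "d - 3 \<le> n - 3" "n - 3 - (d - 3) = n - d"
        using d4 dn by simp_all
      ultimately obtain F where F: "F \<in> subs (n - 3) (n - d)" "\<forall>\<mu>\<in>F. \<forall>e\<in>E. dot (n - 3) \<mu> e = 0"
        using annihilator[OF E, of "d - 3"] by metis
      have "evl (n - 3) n \<mu> ?C x y = 0" if "\<mu> \<in> F" "x \<in> U" "y \<in> U" for \<mu> x y
        unfolding evl_def using F(2) br that by blast
      then have "?C \<in> degenerate (n - 3) n d (n - d)"
        unfolding degenerate_def using C Us F(1) by blast
      then show False
        using f(3) d4 dn by (auto simp: degenerate_ge_4_def)
    qed
  qed
  then show ?thesis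
    using C by blast
qed

end

subsection \<open>The group of a family of forms\<close>

text \<open>\<open>enc\<close> numbers the elements, so that the groups for all \<open>p\<close> and
  \<open>n\<close> live on the single type \<open>nat\<close>.\<close>

locale class_two_group = prime_field_ideal K u p
  for K :: "'a::comm_ring_1 set" and u :: 'a and p :: nat +
  fixes n m :: nat and B :: "nat \<Rightarrow> nat \<times> nat \<Rightarrow> 'a"
    and enc :: "(nat \<Rightarrow> 'a) \<times> (nat \<Rightarrow> 'a) \<Rightarrow> nat"
  assumes B_in: "B \<in> fam m n"
    and enc_inj: "inj_on enc (vec n \<times> vec m)"
begin

definition dec :: "nat \<Rightarrow> (nat \<Rightarrow> 'a) \<times> (nat \<Rightarrow> 'a)"
  where "dec = inv_into (vec n \<times> vec m) enc"

definition beta :: "(nat \<Rightarrow> 'a) \<Rightarrow> (nat \<Rightarrow> 'a) \<Rightarrow> nat \<Rightarrow> 'a"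
  where "beta x y = (\<lambda>c. \<Sum>a<n. \<Sum>b<n. B c (a, b) * (x a * y b))"

text \<open>The central extension of \<open>V\<close> by \<open>W\<close> with the bilinear cocycle
  \<open>beta\<close>. It is not antisymmetrised: a commutator map given by a bilinear
  \<open>beta\<close> needs no division by 2, so \<open>p = 2\<close> is covered.\<close>

definition pmul :: "(nat \<Rightarrow> 'a) \<times> (nat \<Rightarrow> 'a) \<Rightarrow> (nat \<Rightarrow> 'a) \<times> (nat \<Rightarrow> 'a) \<Rightarrow> (nat \<Rightarrow> 'a) \<times> (nat \<Rightarrow> 'a)"
  where "pmul = (\<lambda>(v, w) (v', w'). (v + v', w + w' + beta v v'))"

definition G :: "nat monoid"
  where "G = \<lparr>carrier = enc ` (vec n \<times> vec m), monoid.mult = (\<lambda>x y. enc (pmul (dec x) (dec y))), one = enc (0, 0)\<rparr>"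

lemma beta_in: "beta x y \<in> vec m"
proof (rule zfunI)
  fix c assume "c \<in> {..<m}"
  then have "B c \<in> mats n"
    using zfun_in[OF B_in] by blast
  then show "beta x y c \<in> K"
    unfolding beta_def by (intro sum_in mult_in) (auto simp: zfun_def)
next
  fix c assume "c \<notin> {..<m}"
  then show "beta x y c = 0"
    using zfun_out[OF B_in] by (simp add: beta_def)
qed

lemma beta_add_left: "beta (x + y) z = beta x z + beta y z"
  unfolding beta_def plus_fun_def sum.distrib[symmetric]
  by (intro ext sum.cong refl) (simp add: algebra_simps)

lemma beta_add_right: "beta z (x + y) = beta z x + beta z y"
  unfolding beta_def plus_fun_def sum.distrib[symmetric]
  by (intro ext sum.cong refl) (simp add: algebra_simps)

lemma beta_zero_left: "beta 0 z = 0"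
  by (simp add: beta_def fun_eq_iff)

lemma beta_smul_left: "beta (smul c x) y = smul c (beta x y)"
  unfolding beta_def smul_def sum_distrib_left
  by (intro ext sum.cong refl) (simp add: mult_ac)

lemma beta_minus_left: "beta (- x) y = - beta x y"
  using beta_add_left[of "-x" x y] beta_zero_left[of y] by (simp add: eq_neg_iff_add_eq_0)

lemma beta_diff: "beta x y c - beta y x c = ev n (B c) x y"
  unfolding beta_def ev_def
proof -
  have "(\<Sum>a<n. \<Sum>b<n. B c (a, b) * (x a * y b)) - (\<Sum>a<n. \<Sum>b<n. B c (a, b) * (y a * x b))
    = (\<Sum>a<n. \<Sum>b<n. B c (a, b) * (x a * y b) - B c (a, b) * (y a * x b))"
    by (simp only: sum_subtractf)
  then show "(\<Sum>a<n. \<Sum>b<n. B c (a, b) * (x a * y b)) - (\<Sum>a<n. \<Sum>b<n. B c (a, b) * (y a * x b))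
    = (\<Sum>a<n. \<Sum>b<n. B c (a, b) * (x a * y b - y a * x b))"
    by (simp only: right_diff_distrib)
qed

lemma vec_closed:
  "x \<in> zfun I K \<Longrightarrow> y \<in> zfun I K \<Longrightarrow> x + y \<in> zfun I K" "(0 :: 'i \<Rightarrow> 'a) \<in> zfun I K"
  "x \<in> zfun I K \<Longrightarrow> - x \<in> zfun I K"
  by (auto simp: zfun_def intro: uminus_in add_in zero_in)

lemma dec_enc: "z \<in> vec n \<times> vec m \<Longrightarrow> dec (enc z) = z"
  unfolding dec_def by (rule inv_into_f_f[OF enc_inj])

lemma carrier_G: "carrier G = enc ` (vec n \<times> vec m)"
  by (simp add: G_def)

lemma one_G: "\<one>\<^bsub>G\<^esub> = enc (0, 0)"
  by (simp add: G_def)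

lemma enc_mult:
  assumes "v \<in> vec n" "w \<in> vec m" "v' \<in> vec n" "w' \<in> vec m"
  shows "enc (v, w) \<otimes>\<^bsub>G\<^esub> enc (v', w') = enc (v + v', w + w' + beta v v')"
  using assms dec_enc[of "(v, w)"] dec_enc[of "(v', w')"] by (simp add: G_def pmul_def)

lemma enc_in: "v \<in> vec n \<Longrightarrow> w \<in> vec m \<Longrightarrow> enc (v, w) \<in> carrier G"
  by (simp add: carrier_G)

lemma carrier_cases:
  assumes "x \<in> carrier G"
  obtains v w where "x = enc (v, w)" "v \<in> vec n" "w \<in> vec m"
  using assms by (auto simp: carrier_G)

sublocale group G
proof (rule groupI)
  fix x y assume "x \<in> carrier G" "y \<in> carrier G"
  then show "x \<otimes>\<^bsub>G\<^esub> y \<in> carrier G"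
    by (elim carrier_cases) (simp add: enc_mult enc_in vec_closed beta_in)
next
  show "\<one>\<^bsub>G\<^esub> \<in> carrier G"
    by (simp add: one_G enc_in vec_closed)
next
  fix x y z assume "x \<in> carrier G" "y \<in> carrier G" "z \<in> carrier G"
  then show "x \<otimes>\<^bsub>G\<^esub> y \<otimes>\<^bsub>G\<^esub> z = x \<otimes>\<^bsub>G\<^esub> (y \<otimes>\<^bsub>G\<^esub> z)"
    by (elim carrier_cases) (simp add: enc_mult vec_closed beta_in beta_add_left beta_add_right add_ac)
next
  fix x assume "x \<in> carrier G"
  then show "\<one>\<^bsub>G\<^esub> \<otimes>\<^bsub>G\<^esub> x = x"
    by (elim carrier_cases) (simp add: one_G enc_mult vec_closed beta_zero_left)
next
  fix x assume "x \<in> carrier G"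
  then obtain v w where x: "x = enc (v, w)" "v \<in> vec n" "w \<in> vec m"
    by (rule carrier_cases)
  have "enc (- v, - w + beta v v) \<otimes>\<^bsub>G\<^esub> x = enc (- v + v, - w + beta v v + w + beta (- v) v)"
    unfolding x(1) using x(2,3) by (intro enc_mult vec_closed beta_in)
  then have "enc (- v, - w + beta v v) \<otimes>\<^bsub>G\<^esub> x = \<one>\<^bsub>G\<^esub>"
    by (simp add: one_G beta_minus_left)
  moreover have "enc (- v, - w + beta v v) \<in> carrier G"
    using x(2,3) by (intro enc_in vec_closed beta_in)
  ultimately show "\<exists>y\<in>carrier G. y \<otimes>\<^bsub>G\<^esub> x = \<one>\<^bsub>G\<^esub>"
    by blast
qed

lemma finite_carrier: "finite (carrier G)"
  by (simp add: carrier_G finite_vec)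

lemma order_G: "order G = p ^ (n + m)"
  unfolding order_def carrier_G
  by (simp add: card_image enc_inj card_cartesian_product card_vec power_add)

lemma enc_commutator:
  assumes v: "v \<in> vec n" "v' \<in> vec n" and w: "w \<in> vec m" "w' \<in> vec m"
  shows "enc (v, w) \<otimes>\<^bsub>G\<^esub> enc (v', w') \<otimes>\<^bsub>G\<^esub> inv\<^bsub>G\<^esub> enc (v, w) \<otimes>\<^bsub>G\<^esub> inv\<^bsub>G\<^esub> enc (v', w') = enc (0, \<lambda>c. ev n (B c) v v')"
proof -
  let ?x = "enc (v, w)" and ?y = "enc (v', w')"
  have b: "(\<lambda>c. ev n (B c) v v') = beta v v' - beta v' v"
    by (simp add: fun_eq_iff beta_diff)
  have b_in: "(\<lambda>c. ev n (B c) v v') \<in> vec m"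
    unfolding b by (intro diff_in_vec beta_in)
  let ?c = "enc (0, \<lambda>c. ev n (B c) v v')"
  have xy: "?x \<in> carrier G" "?y \<in> carrier G" and c: "?c \<in> carrier G"
    using v w b_in by (auto intro!: enc_in vec_closed)
  \<comment> \<open>Checking \<open>c y x = x y\<close> avoids computing inverses.\<close>
  have "?c \<otimes>\<^bsub>G\<^esub> (?y \<otimes>\<^bsub>G\<^esub> ?x) = ?x \<otimes>\<^bsub>G\<^esub> ?y"
    using v w b_in by (simp add: enc_mult vec_closed beta_in beta_zero_left) (simp add: b add_ac)
  then have "?x \<otimes>\<^bsub>G\<^esub> ?y \<otimes>\<^bsub>G\<^esub> inv\<^bsub>G\<^esub> ?x \<otimes>\<^bsub>G\<^esub> inv\<^bsub>G\<^esub> ?y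
    = ?c \<otimes>\<^bsub>G\<^esub> (?y \<otimes>\<^bsub>G\<^esub> ?x) \<otimes>\<^bsub>G\<^esub> inv\<^bsub>G\<^esub> ?x \<otimes>\<^bsub>G\<^esub> inv\<^bsub>G\<^esub> ?y"
    by simp
  also have "\<dots> = ?c"
    using xy c by (simp add: m_assoc)
  finally show ?thesis .
qed

text \<open>Over a prime field every scalar is a multiple of the unit, so scalar multiplication is
  repeated addition. This is how subgroups yield subspaces.\<close>

lemma subsp_if_add_closed:
  assumes "U \<subseteq> zfun I K" "0 \<in> U" "\<And>x y. x \<in> U \<Longrightarrow> y \<in> U \<Longrightarrow> x + y \<in> U"
  shows "subsp U"
  unfolding subsp_def
proof (intro conjI ballI)
  fix c x assume "c \<in> K" "x \<in> U"
  then obtain k where k: "c = of_nat k * u"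
    using ex_nat by blast
  have "smul (of_nat k * u) x \<in> U"
  proof (induction k)
    case 0
    then show ?case
      using assms(2) by (simp add: smul_def zero_fun_def)
  next
    case (Suc k)
    have "smul (of_nat (Suc k) * u) x = smul u x + smul (of_nat k * u) x"
      by (simp add: smul_def fun_eq_iff algebra_simps)
    also have "smul u x = x"
      using \<open>x \<in> U\<close> assms(1) by (intro smul_u[of x I]) auto
    finally show ?case
      using assms(3)[OF \<open>x \<in> U\<close> Suc.IH] by (simp only:)
  qed
  then show "smul c x \<in> U"
    by (simp add: k)
qed (use assms in auto)

definition proj :: "nat set \<Rightarrow> (nat \<Rightarrow> 'a) set"
  where "proj S = {v \<in> vec n. \<exists>w\<in>vec m. enc (v, w) \<in> S}"

text \<open>The intersection with the central subgroup \<open>W\<close>, read as a subspace;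
  \<open>proj\<close> is the image in the quotient \<open>V\<close>.\<close>

definition core :: "nat set \<Rightarrow> (nat \<Rightarrow> 'a) set"
  where "core S = {w \<in> vec m. enc (0, w) \<in> S}"

lemma subsp_proj:
  assumes "subgroup S G"
  shows "subsp (proj S)"
proof (rule subsp_if_add_closed)
  show "0 \<in> proj S"
    using subgroup.one_closed[OF assms] vec_closed(2) by (auto simp: proj_def one_G)
  fix x y assume "x \<in> proj S" "y \<in> proj S"
  then obtain w w' where *: "x \<in> vec n" "y \<in> vec n" "w \<in> vec m" "w' \<in> vec m" "enc (x, w) \<in> S" "enc (y, w') \<in> S"
    by (auto simp: proj_def)
  then have "enc (x + y, w + w' + beta x y) \<in> S"
    using subgroup.m_closed[OF assms *(5,6)] by (simp add: enc_mult)
  then show "x + y \<in> proj S"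
    unfolding proj_def using * vec_closed(1) beta_in by blast
qed (auto simp: proj_def)

lemma subsp_core:
  assumes "subgroup S G"
  shows "subsp (core S)"
proof (rule subsp_if_add_closed)
  show "0 \<in> core S"
    using subgroup.one_closed[OF assms] vec_closed(2) by (auto simp: core_def one_G)
  fix x y assume "x \<in> core S" "y \<in> core S"
  then have *: "x \<in> vec m" "y \<in> vec m" "enc (0, x) \<in> S" "enc (0, y) \<in> S"
    by (auto simp: core_def)
  then have "enc (0, x + y) \<in> S"
    using subgroup.m_closed[OF assms *(3,4)] by (simp add: enc_mult vec_closed beta_zero_left)
  then show "x + y \<in> core S"
    unfolding core_def using * vec_closed(1) by blast
qed (auto simp: core_def)

lemma ev_in_vec: "(\<lambda>c. ev n (B c) x y) \<in> vec m"
proof -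
  have "(\<lambda>c. ev n (B c) x y) = beta x y - beta y x"
    by (simp add: fun_eq_iff beta_diff)
  then show ?thesis
    using diff_in_vec[OF beta_in beta_in] by (simp only:)
qed

lemma ev_in_core_derived:
  assumes "subgroup S G" "x \<in> proj S" "y \<in> proj S"
  shows "(\<lambda>c. ev n (B c) x y) \<in> core (derived G S)"
proof -
  obtain w w' where *: "x \<in> vec n" "y \<in> vec n" "w \<in> vec m" "w' \<in> vec m" "enc (x, w) \<in> S" "enc (y, w') \<in> S"
    using assms(2,3) by (auto simp: proj_def)
  have "enc (0, \<lambda>c. ev n (B c) x y) \<in> derived_set G S"
    unfolding enc_commutator[OF *(1-4), symmetric] using *(5,6) by blast
  then have "enc (0, \<lambda>c. ev n (B c) x y) \<in> derived G S"
    unfolding derived_def by (rule generate.incl)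
  then show ?thesis
    using ev_in_vec by (simp add: core_def)
qed

lemma card_core_le: "finite S \<Longrightarrow> card (core S) \<le> card S"
proof (rule card_inj_on_le)
  show "inj_on (\<lambda>w. enc (0, w)) (core S)"
    using enc_inj vec_closed(2) by (auto simp: inj_on_def core_def)
qed (auto simp: core_def)

lemma card_subgroup_le:
  assumes "S \<subseteq> carrier G"
  shows "card S \<le> card (proj S) * p ^ m"
proof -
  have fin: "finite (proj S \<times> vec m)"
    using finite_subset[OF _ finite_vec[of n], of "proj S"] finite_vec by (auto simp: proj_def)
  have "S \<subseteq> enc ` (proj S \<times> vec m)"
    using assms by (fastforce simp: carrier_G proj_def)
  then have "card S \<le> card (enc ` (proj S \<times> vec m))"
    using fin by (intro card_mono) auto
  also have "\<dots> \<le> card (proj S \<times> vec m)"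
    by (rule card_image_le[OF fin])
  finally show ?thesis
    by (simp add: card_cartesian_product card_vec)
qed

lemma subgroup_eq_carrier:
  assumes "subgroup S G" "proj S = vec n" "core S = vec m"
  shows "S = carrier G"
proof
  show "S \<subseteq> carrier G"
    by (rule subgroup.subset[OF assms(1)])
  show "carrier G \<subseteq> S"
  proof
    fix x assume "x \<in> carrier G"
    then obtain v w where x: "x = enc (v, w)" "v \<in> vec n" "w \<in> vec m"
      by (rule carrier_cases)
    then obtain w' where w': "w' \<in> vec m" "enc (v, w') \<in> S"
      using assms(2) by (auto simp: proj_def)
    have d: "w - w' \<in> vec m"
      using x(3) w'(1) by (rule diff_in_vec)
    then have "enc (0, w - w') \<in> S"
      using assms(3) by (auto simp: core_def)
    from subgroup.m_closed[OF assms(1) this w'(2)] show "x \<in> S"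
      using x d w'(1) by (simp add: enc_mult vec_closed beta_zero_left)
  qed
qed

lemma derived_subset: "derived G (carrier G) \<subseteq> enc ` ({0} \<times> vec m)"
proof -
  let ?Z = "enc ` ({0} \<times> vec m)"
  have Zsub: "?Z \<subseteq> carrier G"
    using vec_closed(2) by (auto simp: carrier_G)
  have "subgroup ?Z G"
  proof (rule subgroupI[OF Zsub])
    fix x assume "x \<in> ?Z"
    then obtain w where w: "x = enc (0, w)" "w \<in> vec m"
      by auto
    have "enc (0, - w) \<otimes>\<^bsub>G\<^esub> x = \<one>\<^bsub>G\<^esub>"
      using w(2) by (simp add: w(1) one_G enc_mult vec_closed beta_zero_left)
    then have "inv\<^bsub>G\<^esub> x = enc (0, - w)"
      using w by (intro inv_equality) (auto intro!: enc_in vec_closed)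
    then show "inv\<^bsub>G\<^esub> x \<in> ?Z"
      using vec_closed(3)[OF w(2)] by auto
  next
    fix x y assume "x \<in> ?Z" "y \<in> ?Z"
    then obtain w w' where w: "x = enc (0, w)" "y = enc (0, w')" "w \<in> vec m" "w' \<in> vec m"
      by auto
    then show "x \<otimes>\<^bsub>G\<^esub> y \<in> ?Z"
      using vec_closed(1)[OF w(3,4)] by (simp add: enc_mult vec_closed beta_zero_left)
  qed (use vec_closed(2) in auto)
  moreover have "derived_set G (carrier G) \<subseteq> ?Z"
  proof
    fix z assume "z \<in> derived_set G (carrier G)"
    then obtain x y where xy: "x \<in> carrier G" "y \<in> carrier G" "z = x \<otimes>\<^bsub>G\<^esub> y \<otimes>\<^bsub>G\<^esub> inv\<^bsub>G\<^esub> x \<otimes>\<^bsub>G\<^esub> inv\<^bsub>G\<^esub> y"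
      by blast
    obtain v w where x: "x = enc (v, w)" "v \<in> vec n" "w \<in> vec m"
      using xy(1) by (rule carrier_cases)
    obtain v' w' where y: "y = enc (v', w')" "v' \<in> vec n" "w' \<in> vec m"
      using xy(2) by (rule carrier_cases)
    have "z = enc (0, \<lambda>c. ev n (B c) v v')"
      using enc_commutator x y xy(3) by simp
    then show "z \<in> ?Z"
      using ev_in_vec by blast
  qed
  ultimately show ?thesis
    unfolding derived_def by (intro generate_subgroup_incl)
qed

lemma card_derived:
  assumes "core (derived G (carrier G)) = vec m"
  shows "card (derived G (carrier G)) = p ^ m"
proof -
  have "enc ` ({0} \<times> vec m) \<subseteq> derived G (carrier G)"
    using assms by (auto simp: core_def)
  then have "derived G (carrier G) = enc ` ({0} \<times> vec m)"
    using derived_subset by blast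
  moreover have "inj_on enc ({0} \<times> vec m)"
    using vec_closed(2) by (intro inj_on_subset[OF enc_inj]) auto
  ultimately show ?thesis
    by (simp add: card_image card_cartesian_product card_vec)
qed

lemma group_index_derived:
  assumes "subgroup S G"
  shows "group_index (G\<lparr>carrier := S\<rparr>) (derived G S) * card (derived G S) = card S"
proof -
  interpret S: group "G\<lparr>carrier := S\<rparr>"
    by (rule subgroup.subgroup_is_group[OF assms group_axioms])
  have "subgroup (derived G S) (G\<lparr>carrier := S\<rparr>)"
    using derived_incl[OF subset_refl assms] derived_is_subgroup[OF subgroup.subset[OF assms]] assms
    by (intro subgroup_incl)
  from S.lagrange[OF this] show ?thesis
    by (simp add: group_index_def order_def)
qed

text \<open>The factor number \<open>k + 1\<close> contributes \<open>k\<close> times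
  \<open>beta v v\<close>; summing gives the binomial coefficient. Scalars are written
  \<open>of_nat k * u\<close> to lie in \<open>K\<close>.\<close>

lemma pow_enc:
  assumes "v \<in> vec n" "w \<in> vec m"
  shows "enc (v, w) [^]\<^bsub>G\<^esub> (k::nat) =
    enc (smul (of_nat k * u) v, smul (of_nat k * u) w + smul (of_nat (k choose 2) * u) (beta v v))"
proof (induction k)
  case 0
  have z: "smul 0 x = 0" for x :: "nat \<Rightarrow> 'a"
    by (simp add: smul_def fun_eq_iff)
  have "0 choose 2 = (0::nat)"
    by simp
  then show ?case
    by (simp only: one_G nat_pow_0 of_nat_0 mult_zero_left z add_0)
next
  case (Suc k)
  have kK: "of_nat k * u \<in> K" for k
    by (intro mult_in' u_in)
  have Suc2: "Suc k choose 2 = (k choose 2) + k"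
    by (simp add: numeral_2_eq_2)
  have s: "smul (of_nat (Suc k) * u) x = smul (of_nat k * u) x + x" if "x \<in> zfun I K" for x :: "nat \<Rightarrow> 'a" and I
    using smul_u[OF that] by (simp add: smul_def fun_eq_iff algebra_simps)
  have "smul (of_nat k * u) w + smul (of_nat (k choose 2) * u) (beta v v) + w + beta (smul (of_nat k * u) v) v
    = smul (of_nat (Suc k) * u) w + smul (of_nat (Suc k choose 2) * u) (beta v v)"
    unfolding s[OF assms(2)] beta_smul_left Suc2 by (simp add: smul_def fun_eq_iff algebra_simps)
  moreover have "enc (v, w) [^]\<^bsub>G\<^esub> Suc k =
    enc (smul (of_nat k * u) v, smul (of_nat k * u) w + smul (of_nat (k choose 2) * u) (beta v v)) \<otimes>\<^bsub>G\<^esub> enc (v, w)"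
    by (simp only: nat_pow_Suc Suc.IH)
  moreover have "\<dots> = enc (smul (of_nat k * u) v + v,
    smul (of_nat k * u) w + smul (of_nat (k choose 2) * u) (beta v v) + w + beta (smul (of_nat k * u) v) v)"
    by (intro enc_mult smul_in_vec kK vec_closed(1) beta_in assms)
  ultimately show ?case
    by (simp only: s[OF assms(1)])
qed

lemma pow_p:
  assumes "p \<noteq> 2" "x \<in> carrier G"
  shows "x [^]\<^bsub>G\<^esub> p = \<one>\<^bsub>G\<^esub>"
proof -
  obtain v w where x: "x = enc (v, w)" "v \<in> vec n" "w \<in> vec m"
    using assms(2) by (rule carrier_cases)
  have "odd p"
    using prime_p assms(1) primes_dvd_imp_eq two_is_prime_nat by blast
  then obtain r where "p = 2 * r + 1"
    by (rule oddE)
  \<comment> \<open>For odd \<open>p\<close> the coefficient of \<open>beta v v\<close> is divisible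
    by \<open>p\<close>, so no condition on \<open>beta\<close> is required.\<close>
  then have "p choose 2 = p * r"
    by (simp add: choose_two)
  then have "of_nat (p choose 2) * u = of_nat r * (of_nat p * u)"
    by (simp add: mult_ac)
  then have "of_nat (p choose 2) * u = 0"
    by (simp add: char_p)
  moreover have "smul 0 y = 0" for y :: "nat \<Rightarrow> 'a"
    by (simp add: smul_def fun_eq_iff)
  ultimately show ?thesis
    unfolding x(1) pow_enc[OF x(2,3)] by (simp add: char_p one_G)
qed

lemma group_exponent_G:
  assumes "p \<noteq> 2" "n + m > 0"
  shows "group_exponent G = p"
proof -
  have dvd: "ord x dvd p" if "x \<in> carrier G" for x
    using pow_p[OF assms(1) that] pow_eq_id[OF that] by simp
  have "card (carrier G) \<noteq> 1"
    using order_G assms(2) p_ge_2 by (simp add: order_def)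
  then obtain x where x: "x \<in> carrier G" "x \<noteq> \<one>\<^bsub>G\<^esub>"
    using one_closed by (metis is_singletonI' is_singleton_altdef empty_iff)
  have "ord x \<noteq> 1"
    using ord_eq_1[OF x(1)] x(2) by simp
  then have "ord x = p"
    using dvd[OF x(1)] prime_p prime_nat_iff by blast
  show ?thesis
    unfolding group_exponent_def
  proof (rule dvd_antisym)
    show "Lcm (ord ` carrier G) dvd p"
      using dvd by (intro Lcm_least) auto
    show "p dvd Lcm (ord ` carrier G)"
      using x(1) \<open>ord x = p\<close> by (metis dvd_Lcm imageI)
  qed
qed

text \<open>\<open>card S\<close> is at most \<open>card (proj S) * p ^ m\<close>, while
  \<open>derived G S\<close> has at least \<open>card (proj S) / p ^ 2\<close> elements. The index
  is thus at most \<open>p ^ (m + 2) = p ^ (n - 1)\<close>, unless \<open>proj S\<close> is all of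
  \<open>V\<close>.\<close>

lemma ab_maximal_G:
  assumes n: "n \<ge> 3" "m = n - 3"
    and card_le: "\<forall>U E. subsp U \<and> U \<subset> vec n \<and> subsp E \<and> E \<subseteq> vec m \<and>
      (\<forall>x\<in>U. \<forall>y\<in>U. (\<lambda>c. ev n (B c) x y) \<in> E) \<longrightarrow> card U \<le> p ^ 2 * card E"
  shows "card (derived G (carrier G)) = p ^ m" "group_index G (derived G (carrier G)) = p ^ n" "ab_maximal G"
proof -
  have good: "card U \<le> p ^ 2 * card E" if "subsp U" "U \<subset> vec n" "subsp E" "E \<subseteq> vec m"
    "\<And>x y. x \<in> U \<Longrightarrow> y \<in> U \<Longrightarrow> (\<lambda>c. ev n (B c) x y) \<in> E" for U E
    by (rule card_le[rule_format]) (use that in blast)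
  have e: "n - 1 = m + 2"
    using n by simp
  have core_full: "core (derived G S) = vec m" if S: "subgroup S G" "proj S = vec n" for S
  proof -
    have sub: "subgroup (derived G S) G"
      by (rule derived_is_subgroup[OF subgroup.subset[OF S(1)]])
    \<comment> \<open>The inequality speaks of proper subspaces only. This coordinate hyperplane has
      \<open>p ^ (m + 2)\<close> elements, just enough to force the core up to
      \<open>p ^ m\<close>.\<close>
    let ?U = "zfun {1..<n} K :: (nat \<Rightarrow> 'a) set"
    have U: "?U \<subseteq> vec n"
      using zero_in by (auto simp: zfun_def)
    have cU: "card ?U = p ^ (n - 1)"
      by (simp add: card_zfun card_K)
    have "p ^ (n - 1) < p ^ n"
      using n(1) p_ge_2 by (intro power_strict_increasing) auto
    then have "?U \<noteq> vec n"
      using cU card_vec[of n] by (metis less_irrefl)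
    then have "card ?U \<le> p ^ 2 * card (core (derived G S))"
    proof (intro good subsp_vec subsp_core sub)
      show "?U \<subset> vec n"
        using U \<open>?U \<noteq> vec n\<close> by blast
      show "core (derived G S) \<subseteq> vec m"
        by (auto simp: core_def)
      show "(\<lambda>c. ev n (B c) x y) \<in> core (derived G S)" if "x \<in> ?U" "y \<in> ?U" for x y
        using that U by (intro ev_in_core_derived[OF S(1)]) (auto simp: S(2))
    qed
    then have "p ^ (m + 2) \<le> p ^ 2 * card (core (derived G S))"
      unfolding cU e .
    then have "p ^ 2 * p ^ m \<le> p ^ 2 * card (core (derived G S))"
      by (simp only: power_add mult.commute)
    then have "p ^ m \<le> card (core (derived G S))"
      using p_ge_2 by simp
    then show ?thesis
      using card_subset_eq[OF finite_vec[of m], of "core (derived G S)"] card_mono[OF finite_vec[of m], of "core (derived G S)"]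
      by (auto simp: core_def card_vec)
  qed
  have projG: "proj (carrier G) = vec n"
    using vec_closed(2) enc_in by (auto simp: proj_def)
  show d: "card (derived G (carrier G)) = p ^ m"
    by (rule card_derived[OF core_full[OF subgroup_self projG]])
  have "group_index G (derived G (carrier G)) * p ^ m = p ^ n * p ^ m"
    using group_index_derived[OF subgroup_self] d order_G by (simp add: order_def power_add)
  then show ind: "group_index G (derived G (carrier G)) = p ^ n"
    using p_ge_2 by simp
  have "group_index (G\<lparr>carrier := S\<rparr>) (derived G S) < p ^ n" if S: "subgroup S G" "S \<noteq> carrier G" for S
  proof -
    have sub: "subgroup (derived G S) G"
      by (rule derived_is_subgroup[OF subgroup.subset[OF S(1)]])
    \<comment> \<open>A subgroup that projects onto \<open>V\<close> contains all of
      \<open>W\<close> in its derived subgroup, hence is the whole group.\<close>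
    have "proj S \<noteq> vec n"
    proof
      assume *: "proj S = vec n"
      have "core (derived G S) \<subseteq> core S"
        using derived_incl[OF subset_refl S(1)] by (auto simp: core_def)
      then have "core S = vec m"
        using core_full[OF S(1) *] by (auto simp: core_def)
      then show False
        using subgroup_eq_carrier[OF S(1) *] S(2) by blast
    qed
    then have "card (proj S) \<le> p ^ 2 * card (core (derived G S))"
    proof (intro good subsp_proj subsp_core sub S(1) ev_in_core_derived)
      show "proj S \<subset> vec n"
        using \<open>proj S \<noteq> vec n\<close> by (auto simp: proj_def)
      show "core (derived G S) \<subseteq> vec m"
        by (auto simp: core_def)
    qed
    moreover have "finite (derived G S)"
      using finite_subset[OF subgroup.subset[OF sub] finite_carrier] .
    then have core_le: "card (core (derived G S)) \<le> card (derived G S)" and pos: "card (derived G S) > 0"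
      using card_core_le subgroup.one_closed[OF sub] card_gt_0_iff by auto
    ultimately have "card (proj S) \<le> p ^ 2 * card (derived G S)"
      by (meson le_trans mult_le_mono2)
    then have "card S \<le> p ^ 2 * card (derived G S) * p ^ m"
      using card_subgroup_le[OF subgroup.subset[OF S(1)]] by (meson le_trans mult_le_mono1)
    also have "\<dots> = p ^ (n - 1) * card (derived G S)"
      by (simp only: e power_add mult_ac)
    finally have "group_index (G\<lparr>carrier := S\<rparr>) (derived G S) * card (derived G S) \<le> p ^ (n - 1) * card (derived G S)"
      using group_index_derived[OF S(1)] by simp
    then have "group_index (G\<lparr>carrier := S\<rparr>) (derived G S) \<le> p ^ (n - 1)"
      using pos by simp
    also have "\<dots> < p ^ n"
      using n(1) p_ge_2 by (intro power_strict_increasing) auto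
    finally show ?thesis .
  qed
  then show "ab_maximal G"
    unfolding ab_maximal_def ind using finite_carrier group_axioms by blast
qed

end

context prime_field_ideal
begin

lemma ex_ab_maximal_group:
  assumes "n \<ge> 160"
  shows "\<exists>G :: nat monoid. finite_p_group p G \<and> ab_maximal G \<and>
    group_index G (derived G (carrier G)) = p ^ n \<and> card (derived G (carrier G)) = p ^ (n - 3) \<and>
    (p \<noteq> 2 \<longrightarrow> group_exponent G = p)"
proof -
  obtain B where B: "B \<in> fam (n - 3) n" and good: "\<forall>U E. subsp U \<and> U \<subset> vec n \<and> subsp E \<and> E \<subseteq> vec (n - 3) \<and>
    (\<forall>x\<in>U. \<forall>y\<in>U. (\<lambda>c. ev n (B c) x y) \<in> E) \<longrightarrow> card U \<le> p ^ 2 * card E"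
    using ex_good_forms[OF assms] by blast
  obtain enc :: "(nat \<Rightarrow> 'a) \<times> (nat \<Rightarrow> 'a) \<Rightarrow> nat" where enc: "inj_on enc (vec n \<times> vec (n - 3))"
    using finite_imp_inj_to_nat_seg[of "vec n \<times> vec (n - 3)"] finite_vec by blast
  interpret class_two_group K u p n "n - 3" B enc
    by unfold_locales (fact B enc)+
  have "finite_p_group p G"
    unfolding finite_p_group_def using group_axioms finite_carrier order_G by blast
  moreover have n3: "n \<ge> 3"
    using assms by simp
  moreover have "p \<noteq> 2 \<longrightarrow> group_exponent G = p"
    using group_exponent_G assms by simp
  ultimately show ?thesis
    using ab_maximal_G[OF n3 refl good] by (intro exI[of _ G] conjI)
qed

end

subsection \<open>Prime fields as ideals of a single ring\<close>

text \<open>Since \<open>p\<close> is a variable, there is no type with \<open>p\<close> elements. The product of the rings \<open>\<int>/q\<close> over all \<open>q\<close>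
  is one type that contains every prime field as an ideal.\<close>

typedef residue_product = "{f :: nat \<Rightarrow> int. \<forall>q. f q mod int q = f q}"
  by (rule exI[of _ "\<lambda>_. 0"]) simp

setup_lifting type_definition_residue_product

instantiation residue_product :: comm_ring_1
begin

lift_definition zero_residue_product :: residue_product is "\<lambda>_. 0" by simp
lift_definition one_residue_product :: residue_product is "\<lambda>q. 1 mod int q" by simp
lift_definition plus_residue_product :: "residue_product \<Rightarrow> residue_product \<Rightarrow> residue_product"
  is "\<lambda>f g q. (f q + g q) mod int q" by simp
lift_definition minus_residue_product :: "residue_product \<Rightarrow> residue_product \<Rightarrow> residue_product"
  is "\<lambda>f g q. (f q - g q) mod int q" by simp
lift_definition uminus_residue_product :: "residue_product \<Rightarrow> residue_product"
  is "\<lambda>f q. (- f q) mod int q" by simp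
lift_definition times_residue_product :: "residue_product \<Rightarrow> residue_product \<Rightarrow> residue_product"
  is "\<lambda>f g q. (f q * g q) mod int q" by simp

instance
proof
  fix a b c :: residue_product
  show "a * b * c = a * (b * c)"
    by transfer (simp add: fun_eq_iff mod_simps mult.assoc)
  show "a * b = b * a"
    by transfer (simp add: mult.commute)
  show "1 * a = a"
    by transfer (simp add: fun_eq_iff mod_simps)
  show "a + b + c = a + (b + c)"
    by transfer (simp add: fun_eq_iff mod_simps add.assoc)
  show "a + b = b + a"
    by transfer (simp add: add.commute)
  show "0 + a = a"
    by transfer (simp add: fun_eq_iff)
  show "- a + a = 0"
    by transfer (simp add: fun_eq_iff mod_simps)
  show "a - b = a + - b"
    by transfer (simp add: fun_eq_iff mod_simps)
  show "(a + b) * c = a * c + b * c"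
    by transfer (simp add: fun_eq_iff mod_simps distrib_right)
  \<comment> \<open>The witness is the component at 0: there \<open>1 mod 0 = 1\<close>, and the
    component is a copy of \<open>\<int>\<close>.\<close>
  show "(0::residue_product) \<noteq> 1"
    by transfer (simp add: fun_eq_iff exI[of _ 0])
qed

end

text \<open>The residue field placed in the single component \<open>p\<close>; its unit
  \<open>residue_at p 1\<close> is an idempotent of the product ring.\<close>

lift_definition residue_at :: "nat \<Rightarrow> int \<Rightarrow> residue_product"
  is "\<lambda>p k q. if q = p then k mod int p else 0" by simp

lemma residue_at_add: "residue_at p k + residue_at p l = residue_at p (k + l)"
  by transfer (simp add: fun_eq_iff mod_simps)

lemma residue_at_mult: "residue_at p k * residue_at p l = residue_at p (k * l)"
  by transfer (simp add: fun_eq_iff mod_simps)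

lemma residue_at_eq_iff: "residue_at p k = residue_at p l \<longleftrightarrow> k mod int p = l mod int p"
  by transfer (auto simp: fun_eq_iff)

lemma residue_at_mod: "residue_at p (k mod int p) = residue_at p k"
  by (simp add: residue_at_eq_iff)

lemma residue_at_times_ex: "\<exists>l. residue_at p k * r = residue_at p l"
proof transfer
  fix p :: nat and k :: int and r :: "nat \<Rightarrow> int"
  show "\<exists>l. (\<lambda>q. (if q = p then k mod int p else 0) * r q mod int q) = (\<lambda>q. if q = p then l mod int p else 0)"
    by (rule exI[of _ "k mod int p * r p"]) (simp add: fun_eq_iff)
qed

lemma of_nat_times_residue_at: "of_nat j * residue_at p k = residue_at p (int j * k)"
proof (induction j)
  case 0
  have "residue_at p 0 = 0"
    by transfer (simp add: fun_eq_iff)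
  then show ?case by simp
next
  case (Suc j)
  then show ?case
    by (simp add: distrib_right residue_at_add)
qed

lemma prime_field_ideal_residue_at:
  assumes "Factorial_Ring.prime p"
  shows "prime_field_ideal (range (residue_at p)) (residue_at p 1) p"
proof
  have p: "p > 0"
    using assms prime_gt_0_nat by blast
  show "Factorial_Ring.prime p"
    by fact
  have "range (residue_at p) = residue_at p ` {0..<int p}"
  proof
    show "range (residue_at p) \<subseteq> residue_at p ` {0..<int p}"
    proof
      fix x assume "x \<in> range (residue_at p)"
      then obtain k where "x = residue_at p k"
        by blast
      then have "x = residue_at p (k mod int p)"
        by (simp add: residue_at_mod)
      moreover have "k mod int p \<in> {0..<int p}"
        using p by simp
      ultimately show "x \<in> residue_at p ` {0..<int p}"
        by blast
    qed
  qed blast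
  moreover have "inj_on (residue_at p) {0..<int p}"
    by (auto simp: inj_on_def residue_at_eq_iff)
  ultimately show "card (range (residue_at p)) = p"
    by (simp add: card_image)
  show "residue_at p 1 \<in> range (residue_at p)"
    by simp
  show "of_nat p * residue_at p 1 = 0"
  proof -
    have "residue_at p (int p) = residue_at p 0" "residue_at p 0 = 0"
      by (simp add: residue_at_eq_iff, transfer, simp add: fun_eq_iff)
    then show ?thesis
      by (simp add: of_nat_times_residue_at)
  qed
next
  fix x y assume "x \<in> range (residue_at p)" "y \<in> range (residue_at p)"
  then show "x + y \<in> range (residue_at p)"
    by (auto simp: residue_at_add)
next
  fix x r assume "x \<in> range (residue_at p)"
  then show "x * r \<in> range (residue_at p)"
    using residue_at_times_ex by blast
next
  fix x assume "x \<in> range (residue_at p)"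
  then show "residue_at p 1 * x = x"
    by (auto simp: residue_at_mult)
next
  fix x assume "x \<in> range (residue_at p)" "x \<noteq> 0"
  then obtain k where k: "x = residue_at p k"
    by blast
  have "residue_at p 0 = 0"
    by transfer (simp add: fun_eq_iff)
  then have "\<not> int p dvd k"
    using \<open>x \<noteq> 0\<close> residue_at_eq_iff[of p k 0] k by (auto simp: dvd_eq_mod_eq_0)
  moreover have "Factorial_Ring.prime (int p)"
    using assms by simp
  ultimately have "coprime (int p) k"
    using prime_imp_coprime by blast
  \<comment> \<open>The Bezout coefficient \<open>b\<close> of \<open>k\<close> is its inverse
    modulo \<open>p\<close>.\<close>
  then obtain a b where "a * int p + b * k = 1"
    using bezout_int[of "int p" k] by auto
  then have "k * b = 1 + int p * (- a)"
    by (simp add: algebra_simps)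
  then have "(k * b) mod int p = 1 mod int p"
    by (metis mod_mult_self2)
  then have "x * residue_at p b = residue_at p 1"
    by (simp add: k residue_at_mult residue_at_eq_iff)
  then show "\<exists>y\<in>range (residue_at p). x * y = residue_at p 1"
    by blast
next
  fix x assume "x \<in> range (residue_at p)"
  then obtain k where "x = residue_at p k"
    by blast
  then have "x = residue_at p (int (nat (k mod int p)) * 1)"
    using assms prime_gt_0_nat[of p] by (simp add: residue_at_mod)
  then have "x = of_nat (nat (k mod int p)) * residue_at p 1"
    by (simp only: of_nat_times_residue_at)
  then show "\<exists>k. x = of_nat k * residue_at p 1"
    by blast
qed

theorem theorem1p1:
  fixes p n :: nat
  assumes "Factorial_Ring.prime p" and "n \<ge> 160"
  shows "\<exists>G :: nat monoid.
    finite_p_group p G \<and> ab_maximal G \<and>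
    group_index G (derived G (carrier G)) = p ^ n \<and>
    card (derived G (carrier G)) = p ^ (n - 3) \<and>
    (p \<noteq> 2 \<longrightarrow> group_exponent G = p)"
  by (rule prime_field_ideal.ex_ab_maximal_group[OF prime_field_ideal_residue_at[OF assms(1)] assms(2)])

end
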